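(* Let $\vec{\mathbf H}(z,t,p_1,p_2,\dots)=\sum_{d\ge 1}\frac{z^d}{d!}\sum_{r\ge 0}t^r\sum_{\alpha\vdash d}\vec H^r(\alpha)\,p_\alpha$. Then $\vec{\mathbf H}$ is the unique formal power series solution (in $\mathbb{Q}[[z,t,p_1,p_2,\dots]]$) of the partial differential equation $$\frac{1}{2t}\left(z\frac{\partial \vec{\mathbf H}}{\partial z}-zp_1\right)=\frac12\sum_{i,j\ge 1}\left((i+j)p_ip_j\frac{\partial \vec{\mathbf H}}{\partial p_{i+j}}+ij\,p_{i+j}\frac{\partial^2 \vec{\mathbf H}}{\partial p_i\partial p_j}+ij\,p_{i+j}\frac{\partial \vec{\mathbf H}}{\partial p_i}\frac{\partial \vec{\mathbf H}}{\partial p_j}\right)$$ with the initial condition $[z^0]\vec{\mathbf H}=0$.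
   Context: For a partition $\alpha$ of $d\ge 1$ and an integer $r\ge 0$, $\vec H^r(\alpha)$ denotes the number of $(r+1)$-tuples $(\sigma,\tau_1,\dots,\tau_r)$ of permutations in the symmetric group on $\{1,\dots,d\}$ such that: $\sigma$ has cycle type $\alpha$ and the $\tau_i$ are transpositions; $\sigma\tau_1\cdots\tau_r$ is the identity; the group $\langle\sigma,\tau_1,\dots,\tau_r\rangle$ acts transitively on $\{1,\dots,d\}$; and, writing $\tau_i=(s_i\ t_i)$ with $s_i<t_i$, one has $t_1\le\dots\le t_r$. Here $z,t,p_1,p_2,\dots$ are indeterminates and $p_\alpha=\prod_i p_{\alpha_i}$. *)

theory Defs
  imports
    Complex_Main
    "HOL-Library.Multiset_Order"
    "HOL-Computational_Algebra.Fraction_Field"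
    "HOL-Combinatorics.Orbits"
    "HOL-Algebra.Sym_Groups"
begin

section \<open>Formal power series in an arbitrary set of indeterminates\<close>

text \<open>
  The indeterminates are the elements of the type \<^typ>\<open>'v\<close>, which may be infinite. A monomial is
  a finite multiset of indeterminates (the exponent of \<open>v\<close> is its multiplicity), and a formal power
  series assigns an arbitrary coefficient to every monomial.
\<close>

typedef ('v, 'a) mfps = "UNIV :: ('v multiset \<Rightarrow> 'a) set"
  morphisms mfps_nth Abs_mfps
  by simp

lemma mfps_nth_Abs [simp]: "mfps_nth (Abs_mfps f) = f"
  by (simp add: Abs_mfps_inverse)

lemma mfps_ext: "(\<And>m. mfps_nth f m = mfps_nth g m) \<Longrightarrow> f = g"
  by (metis ext mfps_nth_inject)

lemma mfps_eq_iff: "f = g \<longleftrightarrow> (\<forall>m. mfps_nth f m = mfps_nth g m)"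
  using mfps_ext by blast

instantiation mfps :: (type, comm_ring_1) "{zero, one, plus, minus, uminus, times}"
begin

definition "0 = Abs_mfps (\<lambda>_. 0)"
definition "1 = Abs_mfps (\<lambda>m. if m = {#} then 1 else 0)"
definition "f + g = Abs_mfps (\<lambda>m. mfps_nth f m + mfps_nth g m)"
definition "f - g = Abs_mfps (\<lambda>m. mfps_nth f m - mfps_nth g m)"
definition "- f = Abs_mfps (\<lambda>m. - mfps_nth f m)"
definition "f * g = Abs_mfps (\<lambda>m. \<Sum>(k, l) | k + l = m. mfps_nth f k * mfps_nth g l)"

instance ..

end

lemma mfps_nth_zero [simp]: "mfps_nth 0 m = 0"
  by (simp add: zero_mfps_def)

lemma mfps_nth_one: "mfps_nth 1 m = (if m = {#} then 1 else 0)"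
  by (simp add: one_mfps_def)

lemma mfps_nth_add [simp]: "mfps_nth (f + g) m = mfps_nth f m + mfps_nth g m"
  by (simp add: plus_mfps_def)

lemma mfps_nth_diff [simp]: "mfps_nth (f - g) m = mfps_nth f m - mfps_nth g m"
  by (simp add: minus_mfps_def)

lemma mfps_nth_uminus [simp]: "mfps_nth (- f) m = - mfps_nth f m"
  by (simp add: uminus_mfps_def)

lemma mfps_nth_mult:
  "mfps_nth (f * g) m = (\<Sum>(k, l) | k + l = m. mfps_nth f k * mfps_nth g l)"
  by (simp add: times_mfps_def)

lemma finite_submultisets: "finite {k. k \<subseteq># (m :: 'v multiset)}"
proof (induction m)
  case (add x m)
  have "k \<in> {k. k \<subseteq># m} \<union> add_mset x ` {k. k \<subseteq># m}" if k: "k \<subseteq># add_mset x m" for k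
  proof (cases "x \<in># k")
    case True
    then obtain k' where "k = add_mset x k'"
      by (metis insert_DiffM)
    with k show ?thesis
      by simp
  next
    case False
    then have "count k a \<le> count m a" for a
      using mset_subset_eq_count[OF k, of a] by (cases "a = x") (auto simp: not_in_iff)
    then show ?thesis
      by (simp add: subseteq_mset_def)
  qed
  then have "{k. k \<subseteq># add_mset x m} \<subseteq> {k. k \<subseteq># m} \<union> add_mset x ` {k. k \<subseteq># m}"
    by blast
  then show ?case
    by (rule finite_subset) (use add in simp)
qed simp

lemma finite_mset_splits [simp]: "finite {(k, l). k + l = (m :: 'v multiset)}"
proof -
  have "finite ({k. k \<subseteq># m} \<times> {l. l \<subseteq># m})"
    by (simp add: finite_submultisets)
  moreover have "{(k, l). k + l = m} \<subseteq> {k. k \<subseteq># m} \<times> {l. l \<subseteq># m}"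
    by auto
  ultimately show ?thesis
    by (rule rev_finite_subset)
qed

instance mfps :: (type, comm_ring_1) comm_ring_1
proof
  fix f g h :: "('a, 'b) mfps"
  show "f + g + h = f + (g + h)" "f + g = g + f" "0 + f = f" "- f + f = 0" "f - g = f + - g"
    by (auto intro!: mfps_ext)
  show "(0 :: ('a, 'b) mfps) \<noteq> 1"
    by (auto simp: mfps_eq_iff mfps_nth_one)
  show "f * g = g * f"
    unfolding mfps_eq_iff mfps_nth_mult
    by (intro allI sum.reindex_bij_witness[where i = prod.swap and j = prod.swap])
      (auto simp: add.commute mult.commute)
  show "(f + g) * h = f * h + g * h"
    by (rule mfps_ext) (simp add: mfps_nth_mult case_prod_beta distrib_right sum.distrib)
  show "1 * f = f"
  proof (rule mfps_ext)
    fix m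
    have "mfps_nth (1 * f) m = (\<Sum>(k, l)\<in>{({#}, m)}. mfps_nth (1 :: ('a, 'b) mfps) k * mfps_nth f l)"
      unfolding mfps_nth_mult
      by (rule sum.mono_neutral_right) (auto simp: mfps_nth_one split: if_splits)
    then show "mfps_nth (1 * f) m = mfps_nth f m"
      by (simp add: mfps_nth_one)
  qed
  show "f * g * h = f * (g * h)"
  proof (rule mfps_ext)
    fix m
    let ?S = "\<lambda>m :: 'a multiset. {(k, l). k + l = m}"
    have "mfps_nth (f * g * h) m
        = (\<Sum>p\<in>?S m. \<Sum>q\<in>?S (fst p). mfps_nth f (fst q) * mfps_nth g (snd q) * mfps_nth h (snd p))"
      by (simp add: mfps_nth_mult case_prod_beta sum_distrib_right)
    also have "\<dots> = (\<Sum>(p, q)\<in>(SIGMA p:?S m. ?S (fst p)).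
        mfps_nth f (fst q) * mfps_nth g (snd q) * mfps_nth h (snd p))"
      by (rule sum.Sigma) auto
    also have "\<dots> = (\<Sum>(p, q)\<in>(SIGMA p:?S m. ?S (snd p)).
        mfps_nth f (fst p) * (mfps_nth g (fst q) * mfps_nth h (snd q)))"
      by (rule sum.reindex_bij_witness
          [where i = "\<lambda>(p, q). ((fst p + fst q, snd q), (fst p, fst q))"
             and j = "\<lambda>(p, q). ((fst q, snd q + snd p), (snd q, snd p))"])
        (auto simp: mult.assoc add.assoc)
    also have "\<dots> = (\<Sum>p\<in>?S m. \<Sum>q\<in>?S (snd p).
        mfps_nth f (fst p) * (mfps_nth g (fst q) * mfps_nth h (snd q)))"
      by (rule sum.Sigma[symmetric]) auto
    also have "\<dots> = mfps_nth (f * (g * h)) m"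
      by (simp add: mfps_nth_mult case_prod_beta sum_distrib_left)
    finally show "mfps_nth (f * g * h) m = mfps_nth (f * (g * h)) m" .
  qed
qed

text \<open>
  The order on the indeterminates is only used to show that there are no zero divisors, so that the
  field of fractions exists.
\<close>

instance mfps :: (wellorder, idom) idom
proof
  fix f g :: "('a, 'b) mfps"
  assume fg: "f \<noteq> 0" "g \<noteq> 0"
  define a where "a = (LEAST m. mfps_nth f m \<noteq> 0)"
  define b where "b = (LEAST m. mfps_nth g m \<noteq> 0)"
  from fg(1) have "\<exists>m. mfps_nth f m \<noteq> 0"
    by (simp add: mfps_eq_iff)
  then have a: "mfps_nth f a \<noteq> 0"
    unfolding a_def by (rule LeastI_ex)
  from fg(2) have "\<exists>m. mfps_nth g m \<noteq> 0"
    by (simp add: mfps_eq_iff)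
  then have b: "mfps_nth g b \<noteq> 0"
    unfolding b_def by (rule LeastI_ex)
  have a_le: "a \<le> m" if "mfps_nth f m \<noteq> 0" for m
    unfolding a_def using that by (rule Least_le)
  have b_le: "b \<le> m" if "mfps_nth g m \<noteq> 0" for m
    unfolding b_def using that by (rule Least_le)
  have zero: "mfps_nth f k * mfps_nth g l = 0" if sum: "k + l = a + b" and ne: "(k, l) \<noteq> (a, b)"
    for k l
  proof (rule ccontr)
    assume "mfps_nth f k * mfps_nth g l \<noteq> 0"
    then have le: "a \<le> k" "b \<le> l"
      using a_le b_le by auto
    have "k = a"
    proof (rule ccontr)
      assume "k \<noteq> a"
      with le(1) have "a < k"
        by order
      from add_less_le_mono[OF this le(2)] sum show False
        by simp
    qed
    with sum ne show False
      by simp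
  qed
  have "mfps_nth (f * g) (a + b) = (\<Sum>(k, l)\<in>{(a, b)}. mfps_nth f k * mfps_nth g l)"
    unfolding mfps_nth_mult
  proof (rule sum.mono_neutral_right)
    show "finite {(k, l). k + l = a + b}"
      by (rule finite_mset_splits)
    show "{(a, b)} \<subseteq> {(k, l). k + l = a + b}"
      by blast
    show "\<forall>p\<in>{(k, l). k + l = a + b} - {(a, b)}.
        (case p of (k, l) \<Rightarrow> mfps_nth f k * mfps_nth g l) = 0"
    proof
      fix p
      assume "p \<in> {(k, l). k + l = a + b} - {(a, b)}"
      then show "(case p of (k, l) \<Rightarrow> mfps_nth f k * mfps_nth g l) = 0"
        using zero[of "fst p" "snd p"] by (cases p) simp
    qed
  qed
  with a b have "mfps_nth (f * g) (a + b) \<noteq> 0"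
    by simp
  then show "f * g \<noteq> 0"
    by (metis mfps_nth_zero)
qed

definition mfps_const :: "'a \<Rightarrow> ('v, 'a :: zero) mfps" where
  "mfps_const c = Abs_mfps (\<lambda>m. if m = {#} then c else 0)"

definition mfps_X :: "'v \<Rightarrow> ('v, 'a :: zero_neq_one) mfps" where
  "mfps_X v = Abs_mfps (\<lambda>m. if m = {#v#} then 1 else 0)"

definition mfps_deriv :: "'v \<Rightarrow> ('v, 'a :: semiring_1) mfps \<Rightarrow> ('v, 'a) mfps" where
  "mfps_deriv v f = Abs_mfps (\<lambda>m. of_nat (Suc (count m v)) * mfps_nth f (add_mset v m))"

text \<open>\<open>mfps_coeff v n f\<close> is \<open>[v\<^sup>n] f\<close>, again a series, in which \<open>v\<close> does not occur.\<close>

definition mfps_coeff :: "'v \<Rightarrow> nat \<Rightarrow> ('v, 'a :: zero) mfps \<Rightarrow> ('v, 'a) mfps" where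
  "mfps_coeff v n f =
     Abs_mfps (\<lambda>m. if count m v = 0 then mfps_nth f (m + replicate_mset n v) else 0)"

text \<open>
  Sum of a possibly infinite family of series, coefficient by coefficient. It has its usual meaning
  when each monomial has a nonzero coefficient in only finitely many members of the family; any
  coefficient for which this fails would be \<open>0\<close>.
\<close>

definition mfps_sum :: "('i \<Rightarrow> ('v, 'a :: comm_monoid_add) mfps) \<Rightarrow> 'i set \<Rightarrow> ('v, 'a) mfps" where
  "mfps_sum f A = Abs_mfps (\<lambda>m. \<Sum>i | i \<in> A \<and> mfps_nth (f i) m \<noteq> 0. mfps_nth (f i) m)"

definition mfps_summable :: "('i \<Rightarrow> ('v, 'a :: zero) mfps) \<Rightarrow> 'i set \<Rightarrow> bool" where
  "mfps_summable f A \<longleftrightarrow> (\<forall>m. finite {i \<in> A. mfps_nth (f i) m \<noteq> 0})"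

lemma mfps_nth_X_mult:
  fixes g :: "('v, 'a :: comm_ring_1) mfps"
  shows "mfps_nth (mfps_X v * g) m = (if v \<in># m then mfps_nth g (m - {#v#}) else 0)"
proof (cases "v \<in># m")
  case True
  have "mfps_nth (mfps_X v * g) m
      = (\<Sum>(k, l)\<in>{({#v#}, m - {#v#})}. mfps_nth (mfps_X v) k * mfps_nth g l)"
    unfolding mfps_nth_mult
    by (rule sum.mono_neutral_right) (use True in \<open>auto simp: mfps_X_def split: if_splits\<close>)
  with True show ?thesis
    by (simp add: mfps_X_def)
next
  case False
  have "mfps_nth (mfps_X v * g) m = 0"
    unfolding mfps_nth_mult by (rule sum.neutral) (use False in \<open>auto simp: mfps_X_def\<close>)
  with False show ?thesis
    by simp
qed

lemma mfps_nth_X_power_mult: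
  fixes g :: "('v, 'a :: comm_ring_1) mfps"
  shows "mfps_nth (mfps_X v ^ n * g) m \<noteq> 0 \<Longrightarrow> n \<le> count m v"
proof (induction n arbitrary: m)
  case (Suc n)
  have *: "mfps_nth (mfps_X v * (mfps_X v ^ n * g)) m \<noteq> 0"
    using Suc.prems by (simp add: mult.assoc)
  then have v: "v \<in># m" and "mfps_nth (mfps_X v ^ n * g) (m - {#v#}) \<noteq> 0"
    by (auto simp: mfps_nth_X_mult split: if_splits)
  from Suc.IH[OF this(2)] have "n \<le> count m v - 1"
    by simp
  moreover from v have "0 < count m v"
    by simp
  ultimately show ?case
    by linarith
qed simp


section \<open>The ring \<open>\<rat>[[z, t, p\<^sub>1, p\<^sub>2, \<dots>]]\<close>\<close>

text \<open>\<open>Var_p k\<close> stands for \<open>p\<^sub>k\<^sub>+\<^sub>1\<close>, so that there is no indeterminate \<open>p\<^sub>0\<close>.\<close>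

datatype indet = Var_z | Var_t | Var_p nat

fun indet_index :: "indet \<Rightarrow> nat" where
  "indet_index Var_z = 0"
| "indet_index Var_t = 1"
| "indet_index (Var_p k) = k + 2"

lemma indet_index_inject: "indet_index u = indet_index v \<longleftrightarrow> u = v"
  by (cases u; cases v) auto

instantiation indet :: wellorder
begin

definition "u \<le> v \<longleftrightarrow> indet_index u \<le> indet_index v"
definition "u < v \<longleftrightarrow> indet_index u < indet_index v"

instance
proof
  fix P :: "indet \<Rightarrow> bool" and u
  assume step: "\<And>v. (\<And>w. w < v \<Longrightarrow> P w) \<Longrightarrow> P v"
  show "P u"
  proof (induction u rule: measure_induct_rule[of indet_index])
    case (less v)
    show ?case
      by (rule step) (rule less, simp add: less_indet_def)
  qed
qed (auto simp: less_eq_indet_def less_indet_def indet_index_inject)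

end

type_synonym series = "(indet, rat) mfps"

abbreviation z_ser :: series where "z_ser \<equiv> mfps_X Var_z"
abbreviation t_ser :: series where "t_ser \<equiv> mfps_X Var_t"

text \<open>The index of \<open>p_var\<close>, \<open>p_ser\<close> and \<open>D_p\<close> is the mathematical one and has to be at least 1.\<close>

definition p_var :: "nat \<Rightarrow> indet" where "p_var i = Var_p (i - 1)"

abbreviation p_ser :: "nat \<Rightarrow> series" where "p_ser i \<equiv> mfps_X (p_var i)"
abbreviation D_z :: "series \<Rightarrow> series" where "D_z \<equiv> mfps_deriv Var_z"
abbreviation D_p :: "nat \<Rightarrow> series \<Rightarrow> series" where "D_p i \<equiv> mfps_deriv (p_var i)"


section \<open>Monotone Hurwitz numbers\<close>

definition partitions_of :: "nat \<Rightarrow> nat multiset set" where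
  "partitions_of d = {\<alpha>. 0 \<notin># \<alpha> \<and> sum_mset \<alpha> = d}"

lemma finite_partitions_of: "finite (partitions_of d)"
proof (rule finite_subset)
  show "partitions_of d \<subseteq> mset ` {xs. set xs \<subseteq> {1..d} \<and> length xs \<le> d}"
  proof
    fix \<alpha>
    assume \<alpha>: "\<alpha> \<in> partitions_of d"
    obtain xs where xs: "\<alpha> = mset xs"
      by (metis ex_mset)
    have pos: "\<forall>x\<in>set xs. 1 \<le> x" and sum: "sum_list xs = d"
      using \<alpha> by (auto simp: partitions_of_def xs sum_mset_sum_list Suc_le_eq intro!: gr0I)
    have "set xs \<subseteq> {1..d}"
      using pos member_le_sum_list[of _ xs] sum by auto
    moreover have "length xs \<le> sum_list xs"
      using pos by (induction xs) auto
    ultimately show "\<alpha> \<in> mset ` {xs. set xs \<subseteq> {1..d} \<and> length xs \<le> d}"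
      using xs sum by auto
  qed
qed (auto intro: finite_imageI finite_lists_length_le)

definition cycle_type :: "nat \<Rightarrow> (nat \<Rightarrow> nat) \<Rightarrow> nat multiset" where
  "cycle_type d \<sigma> = image_mset card (mset_set ((\<lambda>x. Orbits.orbit \<sigma> x) ` {1..d}))"

definition monotone_transpositions :: "nat \<Rightarrow> (nat \<Rightarrow> nat) list \<Rightarrow> bool" where
  "monotone_transpositions d \<tau> \<longleftrightarrow>
     (\<exists>s t :: nat \<Rightarrow> nat.
        (\<forall>i < length \<tau>. 1 \<le> s i \<and> s i < t i \<and> t i \<le> d \<and> \<tau> ! i = transpose (s i) (t i)) \<and>
        (\<forall>i j. i \<le> j \<and> j < length \<tau> \<longrightarrow> t i \<le> t j))"

text \<open>
  A permutation of \<open>{1..d}\<close> is a function on the naturals fixing everything outside \<open>{1..d}\<close>, and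
  products in \<^term>\<open>sym_group d\<close> are compositions; composing in the other direction gives the same
  numbers, since inversion preserves cycle types.
\<close>

definition monotone_factorizations ::
    "nat \<Rightarrow> nat \<Rightarrow> nat multiset \<Rightarrow> ((nat \<Rightarrow> nat) \<times> (nat \<Rightarrow> nat) list) set" where
  "monotone_factorizations d r \<alpha> =
     {(\<sigma>, \<tau>).
        \<sigma> permutes {1..d} \<and> cycle_type d \<sigma> = \<alpha> \<and>
        length \<tau> = r \<and> monotone_transpositions d \<tau> \<and>
        \<sigma> \<circ> foldr (\<circ>) \<tau> id = id \<and>
        (\<forall>x\<in>{1..d}. \<forall>y\<in>{1..d}. \<exists>g\<in>generate (sym_group d) (insert \<sigma> (set \<tau>)). g x = y)}"

lemma finite_monotone_factorizations: "finite (monotone_factorizations d r \<alpha>)"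
proof (rule finite_subset)
  let ?T = "(\<lambda>(s, t). transpose s t) ` ({1..d} \<times> {1..d})"
  show "monotone_factorizations d r \<alpha>
      \<subseteq> {\<sigma>. \<sigma> permutes {1..d}} \<times> {\<tau>. set \<tau> \<subseteq> ?T \<and> length \<tau> = r}"
  proof (clarsimp simp: monotone_factorizations_def monotone_transpositions_def)
    fix \<tau> :: "(nat \<Rightarrow> nat) list" and x s t
    assume st: "\<forall>i<length \<tau>. Suc 0 \<le> s i \<and> s i < t i \<and> t i \<le> d \<and> \<tau> ! i = transpose (s i) (t i)"
      and "x \<in> set \<tau>"
    then obtain i where i: "i < length \<tau>" "x = \<tau> ! i"
      by (auto simp: in_set_conv_nth)
    with st have "x = (case (s i, t i) of (s, t) \<Rightarrow> transpose s t)"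
        "(s i, t i) \<in> {Suc 0..d} \<times> {Suc 0..d}"
      by force+
    then show "x \<in> (\<lambda>(s, t). transpose s t) ` ({Suc 0..d} \<times> {Suc 0..d})"
      by (rule image_eqI)
  qed
qed (intro finite_cartesian_product finite_permutations finite_lists_length_eq, auto)

definition monotone_hurwitz :: "nat \<Rightarrow> nat multiset \<Rightarrow> nat" where
  "monotone_hurwitz r \<alpha> = card (monotone_factorizations (sum_mset \<alpha>) r \<alpha>)"

definition monotone_hurwitz_series :: series where
  "monotone_hurwitz_series =
     mfps_sum (\<lambda>d. mfps_const (1 / fact d) * z_ser ^ d *
       mfps_sum (\<lambda>r. t_ser ^ r *
         (\<Sum>\<alpha>\<in>partitions_of d. of_nat (monotone_hurwitz r \<alpha>) * (\<Prod>i\<in>#\<alpha>. p_ser i))) UNIV) {1..}"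

lemma monotone_hurwitz_series_summable:
  fixes c :: "nat \<Rightarrow> series" and g :: "nat \<Rightarrow> series"
  shows "mfps_summable (\<lambda>d. c d * z_ser ^ d * g d) A" "mfps_summable (\<lambda>r. t_ser ^ r * g r) B"
proof -
  have "{d \<in> A. mfps_nth (c d * z_ser ^ d * g d) m \<noteq> 0} \<subseteq> {..count m Var_z}" for m
  proof clarsimp
    fix d
    assume "mfps_nth (c d * z_ser ^ d * g d) m \<noteq> 0"
    moreover have "c d * z_ser ^ d * g d = z_ser ^ d * (c d * g d)"
      by (simp only: mult_ac)
    ultimately show "d \<le> count m Var_z"
      by (metis mfps_nth_X_power_mult)
  qed
  then show "mfps_summable (\<lambda>d. c d * z_ser ^ d * g d) A"
    unfolding mfps_summable_def by (meson finite_atMost finite_subset)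
  have "{r \<in> B. mfps_nth (t_ser ^ r * g r) m \<noteq> 0} \<subseteq> {..count m Var_t}" for m
    by (auto intro: mfps_nth_X_power_mult)
  then show "mfps_summable (\<lambda>r. t_ser ^ r * g r) B"
    unfolding mfps_summable_def by (meson finite_atMost finite_subset)
qed


section \<open>The join-cut equation\<close>

definition join_cut_term :: "series \<Rightarrow> nat \<times> nat \<Rightarrow> series" where
  "join_cut_term F = (\<lambda>(i, j).
       of_nat (i + j) * p_ser i * p_ser j * D_p (i + j) F
     + of_nat (i * j) * p_ser (i + j) * D_p i (D_p j F)
     + of_nat (i * j) * p_ser (i + j) * D_p i F * D_p j F)"

lemma join_cut_term_summable: "mfps_summable (join_cut_term F) ({1..} \<times> {1..})"
  unfolding mfps_summable_def
proof
  fix m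
  define N where "N = Max (insert 0 ((\<lambda>v. indet_index v) ` set_mset m))"
  have p: "k \<le> N" if "p_var k \<in># m" for k
  proof -
    have "indet_index (p_var k) \<le> N"
      unfolding N_def using that by (intro Max_ge) auto
    then show ?thesis
      by (simp add: p_var_def)
  qed
  have zero: "mfps_nth (mfps_X v * g) m = 0" if "v \<notin># m" for v and g :: series
    using that by (simp add: mfps_nth_X_mult)
  have "{x \<in> {1..} \<times> {1..}. mfps_nth (join_cut_term F x) m \<noteq> 0} \<subseteq> {..N} \<times> {..N}"
  proof clarsimp
    fix i j
    assume nz: "mfps_nth (join_cut_term F (i, j)) m \<noteq> 0"
    have "join_cut_term F (i, j) = p_ser i * (p_ser j * (of_nat (i + j) * D_p (i + j) F))
        + p_ser (i + j) * (of_nat (i * j) * (D_p i (D_p j F) + D_p i F * D_p j F))"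
      by (simp add: join_cut_term_def algebra_simps)
    moreover have "p_ser i * (p_ser j * (of_nat (i + j) * D_p (i + j) F))
        = p_ser j * (p_ser i * (of_nat (i + j) * D_p (i + j) F))"
      by (simp only: mult_ac)
    ultimately have "p_var i \<in># m \<and> p_var j \<in># m \<or> p_var (i + j) \<in># m"
      using nz zero by (metis add.right_neutral mfps_nth_add)
    then show "i \<le> N \<and> j \<le> N"
      using p[of i] p[of j] p[of "i + j"] by auto
  qed
  then show "finite {x \<in> {1..} \<times> {1..}. mfps_nth (join_cut_term F x) m \<noteq> 0}"
    by (rule finite_subset) simp
qed

lemma two_t_ser_nonzero: "2 * t_ser \<noteq> 0"
proof
  assume "2 * t_ser = 0"
  then have "mfps_nth (t_ser + t_ser) {#Var_t#} = 0"
    by (simp only: mult_2 mfps_nth_zero)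
  then show False
    by (simp only: mfps_nth_add) (simp add: mfps_X_def)
qed

text \<open>
  Because of the factor \<open>1 / (2 t)\<close>, the equation is one between elements of the field of fractions
  of \<open>\<rat>[[z, t, p\<^sub>1, p\<^sub>2, \<dots>]]\<close>.
\<close>

definition join_cut_equation :: "series \<Rightarrow> bool" where
  "join_cut_equation F \<longleftrightarrow>
     Fract 1 (2 * t_ser) * Fract (z_ser * D_z F - z_ser * p_ser 1) 1
     = Fract (mfps_const (1/2) * mfps_sum (join_cut_term F) ({1..} \<times> {1..})) 1"

end

theory Submission
  imports Defs "HOL-Library.Infinite_Set"
begin

text \<open>
  Let \<open>Z = exp H\<close> count the same tuples without the transitivity condition. In the group algebra the
  products of monotone sequences of transpositions sum to \<open>F\<^sub>d = \<Prod>\<^sub>k (1 - t J\<^sub>k)\<inverse>\<close>, with \<open>J\<^sub>k\<close> the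
  Jucys--Murphy elements, so \<open>F\<^sub>d\<close> is central and \<open>F\<^sub>d = F\<^sub>d\<^sub>-\<^sub>1 + t F\<^sub>d J\<^sub>d\<close>. By centrality the letter \<open>d\<close> in
  this recursion may be replaced by any other one. Averaging over all choices turns multiplication by
  \<open>J\<^sub>d\<close> into multiplication by the sum of all transpositions, which acts on cycle types by cutting and
  joining; this is the linear equation
  \<open>z Z\<^sub>z = z p\<^sub>1 Z + t \<Sum>\<^sub>i\<^sub>j ((i + j) p\<^sub>i p\<^sub>j Z\<^sub>i\<^sub>+\<^sub>j + i j p\<^sub>i\<^sub>+\<^sub>j Z\<^sub>i\<^sub>j)\<close>. Splitting off the component of one point
  gives \<open>z Z\<^sub>z = Z \<cdot> z H\<^sub>z\<close>, which forces \<open>Z\<^sub>i = Z H\<^sub>i\<close>; dividing the linear equation by \<open>Z\<close> yields the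
  join-cut equation. Uniqueness holds because the equation determines the coefficients of \<open>t\<^sup>r\<close> from
  those of lower powers of \<open>t\<close>.
\<close>

section \<open>Counting monotone factorizations of a permutation\<close>

text \<open>Group algebra elements appear as coefficient functions on permutations, with values in
  the natural numbers, so relations with minus signs have their negative terms moved across.
  Centrality is checked against adjacent transpositions by induction on d. Those below the top only
  permute the summands of the last Jucys--Murphy element. The obstacle is s = (d d+1): neither J_d
  nor J_{d+1} commutes with it, but J_d + J_{d+1} and J_d J_{d+1} do, which is why two steps of the
  recursion are taken together. The letter x put in place of d has d possible values, which gives
  the factor d of the Euler operator in z. The pairs (x, y) are then ordered, so every transposition
  is met twice; this is why the linear equation carries no 1/2. No exponential is ever formed:
  \<open>Z\<close> is given by its counts, and its relation to H is used only in differentiated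
  form, through a first-order equation in z whose solution is unique. Monotonicity refers to the
  order of the letters. Components sit on arbitrary subsets, so the counts are defined over any set
  of naturals and compared by increasing relabellings.\<close>

fun mono_count :: "nat \<Rightarrow> nat \<Rightarrow> (nat \<Rightarrow> nat) \<Rightarrow> nat" where
  "mono_count d 0 g = (if g = id then 1 else 0)"
| "mono_count 0 (Suc r) g = 0"
| "mono_count (Suc d) (Suc r) g =
     mono_count d (Suc r) g + (\<Sum>a\<in>{1..d}. mono_count (Suc d) r (g \<circ> transpose a (Suc d)))"

text \<open>Coefficients of the group algebra product f J_d: a term h (a d) = g has h = g (a d), as
  a transposition is its own inverse.\<close>

definition jucys_murphy :: "nat \<Rightarrow> ((nat \<Rightarrow> nat) \<Rightarrow> nat) \<Rightarrow> (nat \<Rightarrow> nat) \<Rightarrow> nat" where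
  "jucys_murphy d f g = (\<Sum>a\<in>{1..<d}. f (g \<circ> transpose a d))"

text \<open>This is F_{d+1} = F_d + t F_{d+1} J_{d+1}, where \<open>mono_count d r g\<close> is the
  coefficient of t^r at g in F_d: the last transposition either moves d+1 and is split off, or all
  letters are at most d.\<close>

lemma mono_count_Suc:
  "mono_count (Suc d) (Suc r) g = mono_count d (Suc r) g + jucys_murphy (Suc d) (mono_count (Suc d) r) g"
  by (simp add: jucys_murphy_def atLeastLessThanSuc_atLeastAtMost)

lemma mono_count_nonzero_permutes: "mono_count d r g \<noteq> 0 \<Longrightarrow> g permutes {1..d}"
proof (induction d r g rule: mono_count.induct)
  case (1 d g)
  then show ?case by (cases "g = id") (simp_all only: mono_count.simps permutes_id if_False)
next
  case (3 d r g)
  show ?case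
  proof (cases "mono_count d (Suc r) g = 0")
    case False
    with 3 have "g permutes {1..d}" by blast
    then show ?thesis by (rule permutes_subset) auto
  next
    case True
    with 3(3) obtain a where a: "a \<in> {1..d}" "mono_count (Suc d) r (g \<circ> transpose a (Suc d)) \<noteq> 0"
      by (auto simp: sum_nonneg_eq_0_iff)
    have "(g \<circ> transpose a (Suc d)) permutes {1..Suc d}"
      using 3(2)[OF a] .
    moreover have "transpose a (Suc d) permutes {1..Suc d}"
      using a by (intro permutes_swap_id) auto
    ultimately have "(g \<circ> transpose a (Suc d)) \<circ> transpose a (Suc d) permutes {1..Suc d}"
      by (rule permutes_compose[rotated])
    then show ?thesis by (simp add: comp_assoc)
  qed
qed simp

text \<open>Pulls a factor \<open>h\<close> to the right of a conjugate into the conjugation, at the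
  price of conjugating \<open>h\<close>, so that invariance of a count can be applied to the whole
  product.\<close>

lemma conj_transpose_comp:
  "transpose x y \<circ> g \<circ> transpose x y \<circ> h = transpose x y \<circ> (g \<circ> (transpose x y \<circ> h \<circ> transpose x y)) \<circ> transpose x y"
  by (simp add: fun_eq_iff)

lemma conj_transpose_transpose:
  "transpose x y \<circ> transpose a b \<circ> transpose x y = transpose (transpose x y a) (transpose x y b)"
  by (auto simp: fun_eq_iff transpose_def)

text \<open>Since s J_d s = J_{d+1} - s, the sum and the product of J_d and J_{d+1} commute with s.
  Multiplying an s-invariant function by either of them therefore preserves invariance.\<close>

lemma jucys_murphy_conj:
  assumes inv: "\<And>g. f (transpose d (Suc d) \<circ> g \<circ> transpose d (Suc d)) = f g" and d: "d \<ge> 1"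
  defines "s \<equiv> transpose d (Suc d)"
  shows "jucys_murphy d f (s \<circ> g \<circ> s) + jucys_murphy (Suc d) f (s \<circ> g \<circ> s)
           = jucys_murphy d f g + jucys_murphy (Suc d) f g" (is ?A)
    and "jucys_murphy d (jucys_murphy (Suc d) f) (s \<circ> g \<circ> s)
           = jucys_murphy d (jucys_murphy (Suc d) f) g" (is ?B)
proof -
  let ?D = "Suc d"
  have inv: "f (s \<circ> g \<circ> s \<circ> transpose a b) = f (g \<circ> transpose (s a) (s b))" for g a b
    unfolding s_def by (subst conj_transpose_comp) (simp only: inv conj_transpose_transpose)
  have s: "s d = ?D" "s ?D = d" "\<And>a. a < d \<Longrightarrow> s a = a"
    by (auto simp: s_def)
  have split: "{1..<?D} = insert d {1..<d}" using d by auto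
  have J1: "jucys_murphy d f (s \<circ> g \<circ> s) = (\<Sum>a\<in>{1..<d}. f (g \<circ> transpose a ?D))" for g
    by (simp add: jucys_murphy_def inv s)
  have J2: "jucys_murphy ?D f (s \<circ> g \<circ> s) = f (g \<circ> transpose d ?D) + (\<Sum>a\<in>{1..<d}. f (g \<circ> transpose a d))" for g
    using d by (simp add: jucys_murphy_def split inv s transpose_commute)
  have J3: "jucys_murphy ?D f g = f (g \<circ> transpose d ?D) + (\<Sum>a\<in>{1..<d}. f (g \<circ> transpose a ?D))" for g
    unfolding jucys_murphy_def split by (subst sum.insert) auto
  show ?A unfolding J1 J2 unfolding J3 by (simp add: jucys_murphy_def)
  have L: "jucys_murphy d (jucys_murphy ?D f) (s \<circ> g \<circ> s) =
    (\<Sum>a\<in>{1..<d}. f (g \<circ> (transpose a ?D \<circ> transpose d ?D)) +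
       (\<Sum>b\<in>{1..<d}. f (g \<circ> (transpose a ?D \<circ> transpose b d))))"
  proof -
    have "jucys_murphy ?D f (s \<circ> g \<circ> s \<circ> transpose a d) =
       f (g \<circ> (transpose a ?D \<circ> transpose d ?D)) + (\<Sum>b\<in>{1..<d}. f (g \<circ> (transpose a ?D \<circ> transpose b d)))"
      if "a < d" for a
    proof -
      have "s \<circ> g \<circ> s \<circ> transpose a d = s \<circ> (g \<circ> transpose a ?D) \<circ> s"
        unfolding s_def by (subst conj_transpose_comp) (use that in \<open>simp only: conj_transpose_transpose, simp\<close>)
      then show ?thesis by (simp only: J2) (simp only: comp_assoc)
    qed
    then show ?thesis by (simp add: jucys_murphy_def)
  qed
  have R: "jucys_murphy d (jucys_murphy ?D f) g =
    (\<Sum>a\<in>{1..<d}. f (g \<circ> (transpose a d \<circ> transpose d ?D)) +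
       (\<Sum>b\<in>{1..<d}. f (g \<circ> (transpose a d \<circ> transpose b ?D))))"
    unfolding jucys_murphy_def[of d "jucys_murphy ?D f"] J3 by (simp only: comp_assoc)
  \<comment> \<open>For distinct a and b the two transpositions are disjoint and commute.\<close>
  have offdiag: "(\<Sum>b\<in>{1..<d}. \<Sum>a\<in>{1..<d}-{b}. f (g \<circ> (transpose a ?D \<circ> transpose b d)))
      = (\<Sum>b\<in>{1..<d}. \<Sum>a\<in>{1..<d}-{b}. f (g \<circ> (transpose b d \<circ> transpose a ?D)))"
  proof (intro sum.cong refl)
    fix a b assume "b \<in> {1..<d}" "a \<in> {1..<d} - {b}"
    then have "transpose a ?D \<circ> transpose b d = transpose b d \<circ> transpose a ?D"
      by (auto simp: fun_eq_iff transpose_def)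
    then show "f (g \<circ> (transpose a ?D \<circ> transpose b d)) = f (g \<circ> (transpose b d \<circ> transpose a ?D))"
      by simp
  qed
  \<comment> \<open>Diagonal terms and terms containing (d d+1) trade places: each kind on one side
    equals the other kind on the other side.\<close>
  have diag: "f (g \<circ> (transpose a ?D \<circ> transpose d ?D)) = f (g \<circ> (transpose a d \<circ> transpose a ?D))"
      "f (g \<circ> (transpose a ?D \<circ> transpose a d)) = f (g \<circ> (transpose a d \<circ> transpose d ?D))"
    if "a \<in> {1..<d}" for a
  proof -
    have "transpose a ?D \<circ> transpose d ?D = transpose a d \<circ> transpose a ?D"
      "transpose a ?D \<circ> transpose a d = transpose a d \<circ> transpose d ?D"
      using that by (auto simp: fun_eq_iff transpose_def)
    then show "f (g \<circ> (transpose a ?D \<circ> transpose d ?D)) = f (g \<circ> (transpose a d \<circ> transpose a ?D))"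
      "f (g \<circ> (transpose a ?D \<circ> transpose a d)) = f (g \<circ> (transpose a d \<circ> transpose d ?D))"
      by simp_all
  qed
  have rem: "(\<Sum>b\<in>{1..<d}. h b) = h a + (\<Sum>b\<in>{1..<d}-{a}. h b)" if "a \<in> {1..<d}" for h :: "nat \<Rightarrow> nat" and a
    using that by (simp add: sum.remove)
  have "jucys_murphy d (jucys_murphy ?D f) (s \<circ> g \<circ> s) =
     (\<Sum>a\<in>{1..<d}. f (g \<circ> (transpose a ?D \<circ> transpose d ?D))) +
       (\<Sum>b\<in>{1..<d}. \<Sum>a\<in>{1..<d}. f (g \<circ> (transpose a ?D \<circ> transpose b d)))"
    unfolding L sum.distrib by (subst sum.swap) simp
  also have "\<dots> = (\<Sum>a\<in>{1..<d}. f (g \<circ> (transpose a ?D \<circ> transpose d ?D))) +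
       (\<Sum>a\<in>{1..<d}. f (g \<circ> (transpose a ?D \<circ> transpose a d)))
      + (\<Sum>b\<in>{1..<d}. \<Sum>a\<in>{1..<d}-{b}. f (g \<circ> (transpose a ?D \<circ> transpose b d)))"
    using rem by (simp add: sum.distrib)
  also have "\<dots> = (\<Sum>a\<in>{1..<d}. f (g \<circ> (transpose a d \<circ> transpose a ?D))) +
       (\<Sum>a\<in>{1..<d}. f (g \<circ> (transpose a d \<circ> transpose d ?D)))
      + (\<Sum>b\<in>{1..<d}. \<Sum>a\<in>{1..<d}-{b}. f (g \<circ> (transpose b d \<circ> transpose a ?D)))"
    unfolding offdiag by (simp add: diag)
  also have "\<dots> = jucys_murphy d (jucys_murphy ?D f) g"
    unfolding R sum.distrib using rem by (simp add: sum.distrib)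
  finally show ?B .
qed

text \<open>
  This is \<open>F\<^sub>d\<^sub>+\<^sub>1 (1 - t J\<^sub>d\<^sub>+\<^sub>1) (1 - t J\<^sub>d) = F\<^sub>d\<^sub>-\<^sub>1\<close>. The quadratic factor commutes with the transposition of
  \<open>d\<close> and \<open>d + 1\<close>, and so does \<open>F\<^sub>d\<^sub>-\<^sub>1\<close>.
\<close>

lemma mono_count_two_steps:
  assumes "d \<ge> 1"
  shows "mono_count (Suc d) (Suc (Suc r)) g + jucys_murphy d (jucys_murphy (Suc d) (mono_count (Suc d) r)) g
    = mono_count (d - 1) (Suc (Suc r)) g + jucys_murphy d (mono_count (Suc d) (Suc r)) g
      + jucys_murphy (Suc d) (mono_count (Suc d) (Suc r)) g"
proof -
  obtain e where e: "d = Suc e" using assms by (cases d) auto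
  have "jucys_murphy d (mono_count (Suc d) (Suc r)) g
      = jucys_murphy d (mono_count d (Suc r)) g + jucys_murphy d (jucys_murphy (Suc d) (mono_count (Suc d) r)) g"
    by (simp add: jucys_murphy_def[of d] mono_count_Suc sum.distrib del: mono_count.simps)
  then show ?thesis
    unfolding mono_count_Suc[of d] unfolding e mono_count_Suc[of e] by simp
qed

text \<open>The coefficient of t^1 in F_{d+1} (1 - t J_{d+1}) (1 - t J_d) = F_{d-1}; the quadratic
  term starts at t^2 and is absent.\<close>

lemma mono_count_one_step:
  assumes "d \<ge> 1"
  shows "mono_count (Suc d) (Suc 0) g
    = mono_count (d - 1) (Suc 0) g + jucys_murphy d (mono_count (Suc d) 0) g
      + jucys_murphy (Suc d) (mono_count (Suc d) 0) g"
proof -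
  obtain e where e: "d = Suc e" using assms by (cases d) auto
  show ?thesis
    unfolding mono_count_Suc[of d] unfolding e mono_count_Suc[of e]
    by (simp add: jucys_murphy_def del: mono_count.simps(3))
qed

lemma permutes_conj_transpose_far:
  assumes "x \<notin> S" "y \<notin> S" "g permutes S"
  shows "transpose x y \<circ> g \<circ> transpose x y = g"
proof
  fix v
  have "g x = x" "g y = y" using assms by (auto simp: permutes_def)
  moreover have "g v \<noteq> x" if "v \<noteq> x" using that \<open>g x = x\<close> permutes_inj[OF assms(3)] by (metis injD)
  moreover have "g v \<noteq> y" if "v \<noteq> y" using that \<open>g y = y\<close> permutes_inj[OF assms(3)] by (metis injD)
  ultimately show "(transpose x y \<circ> g \<circ> transpose x y) v = g v"
    by (auto simp: transpose_def)
qed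

text \<open>Permutations in the support fix all letters above d, so conjugation by (x y) leaves each
  of them unchanged; off the support both values are 0.\<close>

lemma mono_count_conj_far:
  assumes "x > d" "y > d"
  shows "mono_count d r (transpose x y \<circ> g \<circ> transpose x y) = mono_count d r g"
proof -
  have far: "transpose x y \<circ> g \<circ> transpose x y = g" if "g permutes {1..d}" for g
    using assms that by (intro permutes_conj_transpose_far[of _ "{1..d}"]) auto
  have inv: "transpose x y \<circ> (transpose x y \<circ> g \<circ> transpose x y) \<circ> transpose x y = g"
    by (simp add: fun_eq_iff)
  show ?thesis
    using far mono_count_nonzero_permutes inv by metis
qed

lemma mono_count_0_conj:
  "mono_count d 0 (transpose x y \<circ> g \<circ> transpose x y) = mono_count d 0 g"
proof -
  have "transpose x y \<circ> g \<circ> transpose x y = id \<longleftrightarrow> g = id"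
    by (metis comp_assoc comp_id transpose_comp_involutory id_comp)
  then show ?thesis by (simp only: mono_count.simps)
qed

lemma mono_count_conj_top:
  assumes "d \<ge> 1"
  shows "mono_count (Suc d) r (transpose d (Suc d) \<circ> g \<circ> transpose d (Suc d)) = mono_count (Suc d) r g"
\<comment> \<open>The two-step recursion has order two in r: invariance for r and r+1 gives it for
  r+2, so both 0 and 1 are base cases.\<close>
proof (induction r arbitrary: g rule: induct_nat_012)
  case 0
  show ?case by (rule mono_count_0_conj)
next
  case 1
  have "mono_count (d - 1) (Suc 0) (transpose d (Suc d) \<circ> g \<circ> transpose d (Suc d)) = mono_count (d - 1) (Suc 0) g"
    using assms by (intro mono_count_conj_far) auto
  then show ?case
    unfolding mono_count_one_step[OF assms] 
    using jucys_murphy_conj(1)[of "mono_count (Suc d) 0", OF mono_count_0_conj assms, of g] by presburger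
next
  case (ge2 r)
  have "mono_count (d - 1) (Suc (Suc r)) (transpose d (Suc d) \<circ> g \<circ> transpose d (Suc d)) = mono_count (d - 1) (Suc (Suc r)) g"
    using assms by (intro mono_count_conj_far) auto
  then show ?case
    using mono_count_two_steps[OF assms, of r g] mono_count_two_steps[OF assms, of r "transpose d (Suc d) \<circ> g \<circ> transpose d (Suc d)"]
    using jucys_murphy_conj(1)[of "mono_count (Suc d) (Suc r)", OF ge2(2) assms, of g]
      jucys_murphy_conj(2)[of "mono_count (Suc d) r", OF ge2(1) assms, of g]
    by linarith
qed

text \<open>If i+1 is below the top letter, conjugation fixes the top letter and permutes the
  others, so it merely permutes the summands of the last Jucys--Murphy element.\<close>

lemma mono_count_conj_adjacent:
  assumes "1 \<le> i" "i < d"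
  shows "mono_count d r (transpose i (Suc i) \<circ> g \<circ> transpose i (Suc i)) = mono_count d r g"
  using assms
proof (induction d r g rule: mono_count.induct)
  case (1 d g)
  show ?case by (rule mono_count_0_conj)
next
  case (3 d r g)
  show ?case
  proof (cases "i = d")
    case True
    with 3 show ?thesis using mono_count_conj_top by blast
  next
    case False
    let ?s = "transpose i (Suc i)"
    from False 3 have i: "i < d" by simp
    have "mono_count (Suc d) r (?s \<circ> g \<circ> ?s \<circ> transpose a (Suc d)) = mono_count (Suc d) r (g \<circ> transpose (?s a) (Suc d))"
      if "a \<in> {1..d}" for a
    proof -
      have "?s (Suc d) = Suc d" using i by simp
      moreover have "?s a \<in> {1..d}" using that i 3 by (auto simp: transpose_def)
      ultimately show ?thesis using 3(2)[of "?s a"] 3(3,4)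
        by (subst conj_transpose_comp) (simp only: conj_transpose_transpose)
    qed
    then have "(\<Sum>a\<in>{1..d}. mono_count (Suc d) r (?s \<circ> g \<circ> ?s \<circ> transpose a (Suc d)))
       = (\<Sum>a\<in>{1..d}. mono_count (Suc d) r (g \<circ> transpose (?s a) (Suc d)))"
      by (intro sum.cong) auto
    also have "\<dots> = (\<Sum>a\<in>{1..d}. mono_count (Suc d) r (g \<circ> transpose a (Suc d)))"
      by (rule sum.reindex_bij_betw) (use i 3 in auto)
    finally show ?thesis using 3(1)[OF 3(3) i] by (simp only: mono_count.simps)
  qed
qed simp

lemma mono_count_conj_transpose:
  assumes "x \<in> {1..d}" "y \<in> {1..d}"
  shows "mono_count d r (transpose x y \<circ> g \<circ> transpose x y) = mono_count d r g"
proof -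
  have *: "mono_count d r (transpose x y \<circ> g \<circ> transpose x y) = mono_count d r g"
    if "1 \<le> x" "x < y" "y \<le> d" for x y g
    using that(2,1,3)
  proof (induction arbitrary: g rule: less_Suc_induct)
    case (1 i)
    then show ?case by (intro mono_count_conj_adjacent) auto
  next
    case (2 i j k)
    \<comment> \<open>Conjugation by (i k) is thus a chain of three conjugations by transpositions
      of closer letters.\<close>
    have "transpose i k = transpose i j \<circ> transpose j k \<circ> transpose i j"
      using 2 by (subst transpose_comp_triple) auto
    then have "transpose i k \<circ> g \<circ> transpose i k =
      transpose i j \<circ> (transpose j k \<circ> (transpose i j \<circ> g \<circ> transpose i j) \<circ> transpose j k) \<circ> transpose i j"
      by (simp add: comp_assoc)
    moreover have "mono_count d r (transpose i j \<circ> h \<circ> transpose i j) = mono_count d r h"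
      "mono_count d r (transpose j k \<circ> h \<circ> transpose j k) = mono_count d r h" for h
      using "2.prems" "2.hyps" by (auto intro: "2.IH" simp del: o_apply)
    ultimately show ?case by (simp only:)
  qed
  show ?thesis
    using *[of x y] *[of y x] assms by (cases x y rule: linorder_cases) (auto simp: transpose_commute)
qed

section \<open>Cutting and joining cycles\<close>

text \<open>The analogue of \<open>cycle_type\<close> on any ground set, since the components of a
  sequence live on arbitrary subsets.\<close>

definition cycle_mset :: "'a set \<Rightarrow> ('a \<Rightarrow> 'a) \<Rightarrow> nat multiset" where
  "cycle_mset D g = image_mset card (mset_set (orbit g ` D))"

text \<open>\<open>orbit\<close> consists of the positive iterates, so a walk round a cycle is
  indexed by {1..m} and ends, rather than starts, at its base point.\<close>

lemma orbit_eqI_funpow: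
  assumes "m > 0" "\<And>n. n \<in> {1..m} \<Longrightarrow> (h ^^ n) z = u n" "u m = z"
  shows "orbit h z = u ` {1..m}"
proof -
  have "(h ^^ m) z = z" using assms by simp
  then have o: "orbit h z = {(h ^^ j) z | j. j < m}"
    by (rule orbit_altdef_bounded) fact
  have "(h ^^ j) z \<in> u ` {1..m}" if "j < m" for j
  proof (cases "j = 0")
    case True
    then show ?thesis using assms by (intro image_eqI[of _ _ m]) auto
  next
    case False
    then show ?thesis using assms(2)[of j] that by (intro image_eqI[of _ _ j]) auto
  qed
  moreover have "u n \<in> {(h ^^ j) z | j. j < m}" if "n \<in> {1..m}" for n
  proof (cases "n = m")
    case True
    then show ?thesis using assms by (auto intro!: exI[of _ 0])
  next
    case False
    then show ?thesis using assms(2)[of n] that by (auto intro!: exI[of _ n])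
  qed
  ultimately show ?thesis unfolding o by blast
qed

lemma orbit_eq_of_mem: "permutation g \<Longrightarrow> y \<in> orbit g x \<Longrightarrow> orbit g y = orbit g x"
  by (metis cyclic_on_orbit' orbit_cyclic_eq3)

lemma orbit_funpow_card:
  assumes "permutation g"
  shows "(g ^^ card (orbit g x)) x = x" "inj_on (\<lambda>n. (g ^^ n) x) {1..card (orbit g x)}"
    "(\<lambda>n. (g ^^ n) x) ` {1..card (orbit g x)} = orbit g x"
    "0 < card (orbit g x)"
proof -
  let ?k = "funpow_dist1 g x x"
  have x: "x \<in> orbit g x" using assms by (rule permutation_self_in_orbit)
  have inj: "inj_on (\<lambda>n. (g ^^ n) x) {0..<?k}" using x by (rule inj_on_funpow_dist1)
  have "card (orbit g x) = ?k"
    using orbit_conv_funpow_dist1[OF x] card_image[OF inj] by simp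
  then show 1: "(g ^^ card (orbit g x)) x = x" using funpow_dist1_prop[OF x] by simp
  show pos: "0 < card (orbit g x)" using \<open>card (orbit g x) = ?k\<close> by simp
  show 2: "(\<lambda>n. (g ^^ n) x) ` {1..card (orbit g x)} = orbit g x"
    by (rule orbit_eqI_funpow[symmetric]) (use pos 1 in auto)
  show "inj_on (\<lambda>n. (g ^^ n) x) {1..card (orbit g x)}"
    by (rule eq_card_imp_inj_on) (use 2 in auto)
qed

lemma orbit_comp_transpose_other:
  assumes "permutation g" "z \<notin> orbit g x" "z \<notin> orbit g y"
  shows "orbit (g \<circ> transpose x y) z = orbit g z"
proof (rule orbit_cong)
  show "z \<in> orbit g z" using assms(1) by (rule permutation_self_in_orbit)
  fix s assume "s \<in> orbit g z"
  then have "orbit g s = orbit g z" using orbit_eq_of_mem assms(1) by metis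
  then have "s \<noteq> x" "s \<noteq> y" using assms permutation_self_in_orbit by metis+
  then show "(g \<circ> transpose x y) s = g s" by simp
qed

context
  fixes g :: "'a \<Rightarrow> 'a" and x y :: 'a and i :: nat
  assumes g: "permutation g" and i: "0 < i" "i < card (orbit g x)" and y: "y = (g ^^ i) x"
begin

lemma cut_funpow_inj:
  "\<lbrakk>m \<in> {1..card (orbit g x)}; n \<in> {1..card (orbit g x)}; (g ^^ m) x = (g ^^ n) x\<rbrakk> \<Longrightarrow> m = n"
  by (rule inj_onD[OF orbit_funpow_card(2)[OF g, of x]])

lemma cut_funpow_neq:
  assumes "0 < m" "m < card (orbit g x)"
  shows "(g ^^ m) x \<noteq> x" "m \<noteq> i \<Longrightarrow> (g ^^ m) x \<noteq> y"
proof -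
  show "(g ^^ m) x \<noteq> x"
  proof
    assume "(g ^^ m) x = x"
    then have "(g ^^ m) x = (g ^^ card (orbit g x)) x"
      by (simp only: orbit_funpow_card(1)[OF g])
    then have "m = card (orbit g x)" by (rule cut_funpow_inj[rotated 2]) (use assms in simp_all)
    with assms show False by simp
  qed
  show "(g ^^ m) x \<noteq> y" if "m \<noteq> i"
  proof
    assume "(g ^^ m) x = y"
    then have "(g ^^ m) x = (g ^^ i) x" by (simp only: y)
    then have "m = i" by (rule cut_funpow_inj[rotated 2]) (use assms i in simp_all)
    with that show False by simp
  qed
qed

text \<open>The modified permutation sends y to g x, then follows g and is back at y = g^i x after i
  steps; the walk from x uses the remaining part of the old cycle.\<close>

lemma cut_funpow_y: "n \<in> {1..i} \<Longrightarrow> ((g \<circ> transpose x y) ^^ n) y = (g ^^ n) x"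
proof (induction n)
  case (Suc n)
  show ?case
  proof (cases "n = 0")
    case False
    have "(g ^^ n) x \<noteq> x"
      using False Suc.prems i by (intro cut_funpow_neq) auto
    moreover have "(g ^^ n) x \<noteq> y"
      using False Suc.prems i by (intro cut_funpow_neq) auto
    ultimately show ?thesis using Suc.IH Suc.prems False by simp
  qed simp
qed simp

lemma cut_funpow_x:
  "n \<in> {1..card (orbit g x) - i} \<Longrightarrow> ((g \<circ> transpose x y) ^^ n) x = (g ^^ (i + n)) x"
proof (induction n)
  case (Suc n)
  show ?case
  proof (cases "n = 0")
    case False
    have "(g ^^ (i + n)) x \<noteq> x"
      using False Suc.prems i by (intro cut_funpow_neq) auto
    moreover have "(g ^^ (i + n)) x \<noteq> y"
      using False Suc.prems i by (intro cut_funpow_neq) auto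
    ultimately show ?thesis using Suc.IH Suc.prems False by simp
  qed (simp add: y)
qed simp

lemma orbit_cut_y: "orbit (g \<circ> transpose x y) y = (\<lambda>n. (g ^^ n) x) ` {1..i}"
  by (rule orbit_eqI_funpow[OF i(1) cut_funpow_y y[symmetric]])

lemma orbit_cut_x: "orbit (g \<circ> transpose x y) x = (\<lambda>n. (g ^^ n) x) ` {Suc i..card (orbit g x)}"
proof -
  have "orbit (g \<circ> transpose x y) x = (\<lambda>n. (g ^^ (i + n)) x) ` {1..card (orbit g x) - i}"
    by (rule orbit_eqI_funpow[OF _ cut_funpow_x]) (use i orbit_funpow_card(1)[OF g, of x] in simp_all)
  also have "\<dots> = (\<lambda>n. (g ^^ n) x) ` ((+) i ` {1..card (orbit g x) - i})"
    by (simp only: image_image)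
  also have "(+) i ` {1..card (orbit g x) - i} = {Suc i..card (orbit g x)}"
    using i by (simp only: image_add_atLeastAtMost) auto
  finally show ?thesis .
qed

lemma cycle_mset_cut:
  assumes "x \<in> D" "finite D" "g permutes D"
  defines "k \<equiv> card (orbit g x)"
  shows "cycle_mset D (g \<circ> transpose x y) = cycle_mset D g - {#k#} + {#i, k - i#}"
proof -
  let ?h = "g \<circ> transpose x y"
  define R where "R = orbit g ` D - {orbit g x}"
  have pw: "(g ^^ n) x \<in> orbit g x" for n
    by (rule funpow_in_orbit[OF permutation_self_in_orbit[OF g]])
  have sub: "orbit ?h x \<subseteq> orbit g x" "orbit ?h y \<subseteq> orbit g x"
    unfolding orbit_cut_x orbit_cut_y using pw by auto
  have un: "orbit ?h x \<union> orbit ?h y = orbit g x"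
  proof -
    have "{Suc i..k} \<union> {1..i} = {1..k}" using i by (auto simp: k_def)
    then show ?thesis
      unfolding orbit_cut_x orbit_cut_y image_Un[symmetric]
      using orbit_funpow_card(3)[OF g, of x] by (simp only: k_def)
  qed
  have inj: "inj_on (\<lambda>n. (g ^^ n) x) A" if "A \<subseteq> {1..k}" for A
    using orbit_funpow_card(2)[OF g, of x] that unfolding k_def by (rule inj_on_subset)
  have card: "card (orbit ?h x) = k - i" "card (orbit ?h y) = i"
    unfolding orbit_cut_x orbit_cut_y using i inj by (simp_all add: card_image k_def[symmetric])
  have "orbit ?h x \<inter> orbit ?h y = (\<lambda>n. (g ^^ n) x) ` ({Suc i..k} \<inter> {1..i})"
    unfolding orbit_cut_x orbit_cut_y k_def[symmetric]
    by (rule inj_on_image_Int[symmetric, OF inj[OF subset_refl]]) (use i k_def in auto)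
  then have disj: "orbit ?h x \<inter> orbit ?h y = {}" by simp
  have nonempty: "orbit ?h x \<noteq> {}" "orbit ?h y \<noteq> {}" by (rule orbit_nonempty)+
  have R: "c \<inter> orbit g x = {}" if "c \<in> R" for c
    using that orbit_eq_of_mem[OF g] unfolding R_def by blast
  have "y \<in> orbit g x" unfolding y using permutation_self_in_orbit[OF g] by (rule funpow_in_orbit)
  then have yx: "orbit g y = orbit g x" by (rule orbit_eq_of_mem[OF g])
  have "orbit g x \<subseteq> D" using assms permutes_orbit_subset by metis
  then have "y \<in> D" using \<open>y \<in> orbit g x\<close> by blast
  have h: "permutation ?h"
    using g by (intro permutation_compose permutation_swap_id)
  have eq: "orbit ?h ` D = insert (orbit ?h x) (insert (orbit ?h y) R)"
  proof (intro equalityI subsetI)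
    fix c assume "c \<in> orbit ?h ` D"
    then obtain z where z: "z \<in> D" "c = orbit ?h z" by blast
    show "c \<in> insert (orbit ?h x) (insert (orbit ?h y) R)"
    proof (cases "z \<in> orbit g x")
      case True
      then have "z \<in> orbit ?h x \<or> z \<in> orbit ?h y" using un by blast
      then show ?thesis using orbit_eq_of_mem[OF h] z by auto
    next
      case False
      then have "c = orbit g z" using z orbit_comp_transpose_other[OF g False, of y] yx by simp
      moreover have "orbit g z \<noteq> orbit g x" using False permutation_self_in_orbit[OF g] by metis
      ultimately show ?thesis using z by (auto simp: R_def)
    qed
  next
    fix c assume "c \<in> insert (orbit ?h x) (insert (orbit ?h y) R)"
    moreover have "c \<in> orbit ?h ` D" if cR: "c \<in> R"
    proof -
      from cR obtain z where z: "z \<in> D" "c = orbit g z" by (auto simp: R_def)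
      then have "z \<notin> orbit g x" using R[OF cR] permutation_self_in_orbit[OF g] by auto
      then have "c = orbit ?h z" using z orbit_comp_transpose_other[OF g, of z x y] yx by simp
      then show ?thesis using z by blast
    qed
    ultimately show "c \<in> orbit ?h ` D" using \<open>x \<in> D\<close> \<open>y \<in> D\<close> by blast
  qed
  have fin: "finite R" using assms by (simp add: R_def)
  have notin: "orbit ?h x \<notin> insert (orbit ?h y) R" "orbit ?h y \<notin> R"
    using R sub nonempty disj by blast+
  have "cycle_mset D ?h = {#k - i, i#} + image_mset card (mset_set R)"
    unfolding cycle_mset_def eq using fin notin card by simp
  moreover have Dg: "orbit g ` D = insert (orbit g x) R" using assms by (auto simp: R_def)
  have "orbit g x \<notin> R" by (simp add: R_def)
  then have "cycle_mset D g = add_mset k (image_mset card (mset_set R))"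
    unfolding cycle_mset_def k_def Dg using fin by simp
  ultimately show ?thesis by simp
qed

end

text \<open>Joining is cutting read backwards. Once the cycle of g (x y) through x is known, the
  cutting lemma applies to g (x y), because a second factor (x y) restores g.\<close>

lemma cycle_mset_join:
  assumes D: "finite D" "g permutes D" "x \<in> D" "y \<in> D" and ne: "orbit g x \<noteq> orbit g y"
  defines "k \<equiv> card (orbit g x)" and "l \<equiv> card (orbit g y)"
  shows "cycle_mset D (g \<circ> transpose x y) = cycle_mset D g - {#k, l#} + {#k + l#}"
proof -
  let ?h = "g \<circ> transpose x y"
  have g: "permutation g" using D permutation_permutes by blast
  have h: "permutation ?h" using g by (intro permutation_compose permutation_swap_id)
  have disj: "orbit g x \<inter> orbit g y = {}" using ne orbit_eq_of_mem[OF g] by blast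
  have x: "x \<in> orbit g x" "y \<in> orbit g y" using permutation_self_in_orbit[OF g] by auto
  \<comment> \<open>The first step from w leads to g v; from there g is followed round the cycle of
    v until v is reached.\<close>
  have walk: "((g \<circ> transpose v w) ^^ n) w = (g ^^ n) v"
    if vw: "orbit g v \<inter> orbit g w = {}" and n: "n \<in> {1..card (orbit g v)}" for v w n
    using n
  proof (induction n)
    case (Suc n)
    show ?case
    proof (cases "n = 0")
      case False
      have "(g ^^ n) v \<in> orbit g v" using permutation_self_in_orbit[OF g] by (rule funpow_in_orbit)
      then have "(g ^^ n) v \<noteq> w" using vw permutation_self_in_orbit[OF g, of w] by blast
      moreover have "(g ^^ n) v \<noteq> v"
      proof
        assume "(g ^^ n) v = v"
        then have "(g ^^ n) v = (g ^^ card (orbit g v)) v"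
          by (simp only: orbit_funpow_card(1)[OF g])
        then have "n = card (orbit g v)"
          by (rule inj_onD[OF orbit_funpow_card(2)[OF g, of v]]) (use False Suc.prems in simp_all)
        with Suc.prems show False by simp
      qed
      ultimately show ?thesis using Suc.IH Suc.prems False by simp
    qed simp
  qed simp
  have wx: "(?h ^^ n) x = (g ^^ n) y" if "n \<in> {1..l}" for n
    using walk[of y x n] disj that by (simp add: l_def transpose_commute Int_commute)
  have wy: "(?h ^^ n) y = (g ^^ n) x" if "n \<in> {1..k}" for n
    using walk[of x y n] disj that by (simp add: k_def)
  have pos: "k > 0" "l > 0" using orbit_funpow_card(4)[OF g] by (auto simp: k_def l_def)
  have xy: "(?h ^^ l) x = y" using wx[of l] pos orbit_funpow_card(1)[OF g, of y] by (simp add: l_def)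
  have yx: "(?h ^^ k) y = x" using wy[of k] pos orbit_funpow_card(1)[OF g, of x] by (simp add: k_def)
  \<comment> \<open>The joined cycle seen from x: first the l points of the cycle of y, ending at y,
    then the k points of the cycle of x.\<close>
  define u where "u n = (if n \<le> l then (g ^^ n) y else (g ^^ (n - l)) x)" for n
  have orb: "orbit ?h x = u ` {1..l + k}"
  proof (rule orbit_eqI_funpow)
    show "0 < l + k" "u (l + k) = x"
      using pos orbit_funpow_card(1)[OF g, of x] by (simp_all add: u_def k_def[symmetric])
    fix n assume n: "n \<in> {1..l + k}"
    show "(?h ^^ n) x = u n"
    proof (cases "n \<le> l")
      case False
      then have m: "n = (n - l) + l" "n - l \<in> {1..k}" using n by auto
      have "(?h ^^ n) x = (?h ^^ (n - l)) ((?h ^^ l) x)"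
        by (subst m(1), simp only: funpow_add o_apply)
      then show ?thesis using False wy[OF m(2)] xy by (simp add: u_def)
    qed (use n wx in \<open>simp add: u_def\<close>)
  qed
  also have "{1..l + k} = {1..l} \<union> (\<lambda>m. m + l) ` {1..k}"
    by (auto simp: image_iff)
  also have "u ` \<dots> = (\<lambda>n. (g ^^ n) y) ` {1..l} \<union> (\<lambda>n. (g ^^ n) x) ` {1..k}"
    unfolding image_Un image_image by (intro arg_cong2[of _ _ _ _ "(\<union>)"] image_cong) (auto simp: u_def)
  also have "\<dots> = orbit g y \<union> orbit g x"
    unfolding k_def l_def orbit_funpow_card(3)[OF g] ..
  finally have orb: "orbit ?h x = orbit g y \<union> orbit g x" .
  have "finite (orbit g x)" "finite (orbit g y)" using x by (auto intro: finite_orbit)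
  then have card: "card (orbit ?h x) = k + l"
    unfolding orb using disj by (subst card_Un_disjoint) (auto simp: k_def l_def)
  have hD: "?h permutes D" using D by (intro permutes_compose permutes_swap_id)
  have "cycle_mset D (?h \<circ> transpose x y) = cycle_mset D ?h - {#k + l#} + {#l, k + l - l#}"
    unfolding card[symmetric]
    by (rule cycle_mset_cut[OF h]) (use pos card xy D hD in auto)
  moreover have "?h \<circ> transpose x y = g" by (simp add: comp_assoc)
  moreover have "k + l \<in># cycle_mset D ?h"
    unfolding cycle_mset_def using D card by (auto intro!: image_eqI[of _ _ "orbit ?h x"])
  ultimately show ?thesis by (simp add: insert_DiffM)
qed

section \<open>Summation over all transpositions, sorted by cycle lengths\<close>

lemma sum_mset_eq_sum_count:
  fixes G :: "'a \<Rightarrow> 'b::comm_semiring_1"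
  assumes "finite I" "set_mset M \<subseteq> I"
  shows "(\<Sum>k\<in>#M. G k) = (\<Sum>k\<in>I. of_nat (count M k) * G k)"
  using assms(2)
proof (induction M)
  case (add a M)
  have "(\<Sum>k\<in>I. of_nat (count (add_mset a M) k) * G k)
      = (\<Sum>k\<in>I. of_nat (count M k) * G k + (if k = a then G k else 0))"
    by (intro sum.cong) (auto simp: algebra_simps)
  also have "\<dots> = (\<Sum>k\<in>I. of_nat (count M k) * G k) + G a"
    using add assms(1) by (simp add: sum.distrib)
  finally show ?case using add by (simp add: add.commute)
qed simp

lemma orbit_fibre:
  assumes "finite D" "g permutes D" "c \<in> orbit g ` D"
  shows "{x \<in> D. orbit g x = c} = c"
proof -
  have g: "permutation g" using assms permutation_permutes by blast
  obtain z where z: "z \<in> D" "c = orbit g z" using assms by blast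
  show ?thesis
  proof (intro equalityI subsetI)
    fix x assume "x \<in> {x \<in> D. orbit g x = c}"
    then show "x \<in> c" using permutation_self_in_orbit[OF g, of x] by simp
  next
    fix x assume x: "x \<in> c"
    then have "orbit g x = c" using orbit_eq_of_mem[OF g] z by simp
    moreover have "x \<in> D" using x permutes_orbit_subset[OF assms(2) z(1)] z by blast
    ultimately show "x \<in> {x \<in> D. orbit g x = c}" by simp
  qed
qed

lemma sum_orbit_fibre:
  fixes G :: "'a set \<Rightarrow> 'b::comm_semiring_1"
  assumes "finite D" "g permutes D" "c \<in> orbit g ` D"
  shows "(\<Sum>x | x \<in> D \<and> orbit g x = c. G (orbit g x)) = of_nat (card c) * G c"
proof -
  have "(\<Sum>x | x \<in> D \<and> orbit g x = c. G (orbit g x)) = (\<Sum>x | x \<in> D \<and> orbit g x = c. G c)"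
    by (rule sum.cong) auto
  then show ?thesis unfolding orbit_fibre[OF assms] by simp
qed

lemma sum_orbits:
  fixes G :: "'a set \<Rightarrow> 'b::comm_semiring_1"
  assumes "finite D" "g permutes D"
  shows "(\<Sum>x\<in>D. G (orbit g x)) = (\<Sum>c\<in>orbit g ` D. of_nat (card c) * G c)"
  by (subst sum.image_gen[OF assms(1), of _ "orbit g"]) (rule sum.cong, simp_all only: sum_orbit_fibre[OF assms])

lemma sum_mset_cycle_mset: "(\<Sum>c\<in>orbit g ` D. G (card c)) = (\<Sum>k\<in>#cycle_mset D g. G k)"
  by (simp add: cycle_mset_def sum_unfold_sum_mset image_mset.compositionality o_def)

text \<open>If y lies on the k-cycle of x at distance i, the cycle is cut into i and k - i, and x
  can be any of k points. If x and y lie on different cycles of lengths k and l, there are k l such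
  pairs and the cycles are joined.\<close>

lemma sum_transpositions_cycle_mset:
  fixes F :: "nat multiset \<Rightarrow> 'b::comm_semiring_1"
  assumes D: "finite D" "g permutes D"
  defines "\<beta> \<equiv> cycle_mset D g"
  shows "(\<Sum>x\<in>D. \<Sum>y\<in>D - {x}. F (cycle_mset D (g \<circ> transpose x y)))
    = (\<Sum>k\<in>#\<beta>. of_nat k * (\<Sum>i\<in>{1..<k}. F (\<beta> - {#k#} + {#i, k - i#})))
    + (\<Sum>k\<in>#\<beta>. \<Sum>l\<in>#\<beta> - {#k#}. of_nat (k * l) * F (\<beta> - {#k, l#} + {#k + l#}))"
proof -
  have g: "permutation g" using D permutation_permutes by blast
  let ?O = "orbit g ` D"
  define C where "C k = (\<Sum>i\<in>{1..<k}. F (\<beta> - {#k#} + {#i, k - i#}))" for k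
  define J where "J k l = F (\<beta> - {#k, l#} + {#k + l#})" for k l
  have fin: "finite (orbit g x)" for x using permutation_self_in_orbit[OF g] by (rule finite_orbit)
  have cut: "(\<Sum>y\<in>orbit g x - {x}. F (cycle_mset D (g \<circ> transpose x y))) = C (card (orbit g x))"
    if x: "x \<in> D" for x
  proof -
    let ?k = "card (orbit g x)"
    have inj: "inj_on (\<lambda>n. (g ^^ n) x) {1..<?k}"
      using orbit_funpow_card(2)[OF g, of x] by (rule inj_on_subset) auto
    have "insert ?k {1..<?k} = {1..?k}" using orbit_funpow_card(4)[OF g, of x] by auto
    then have ins: "insert x ((\<lambda>n. (g ^^ n) x) ` {1..<?k}) = orbit g x"
      using orbit_funpow_card(3)[OF g, of x] image_insert[of "\<lambda>n. (g ^^ n) x" ?k "{1..<?k}"]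
      by (simp only: orbit_funpow_card(1)[OF g])
    have "x \<notin> (\<lambda>n. (g ^^ n) x) ` {1..<?k}"
    proof
      assume "x \<in> (\<lambda>n. (g ^^ n) x) ` {1..<?k}"
      then obtain n where n: "n \<in> {1..<?k}" "x = (g ^^ n) x" by blast
      then have "(g ^^ n) x = (g ^^ ?k) x" by (simp only: orbit_funpow_card(1)[OF g])
      then have "n = ?k"
        by (rule inj_onD[OF orbit_funpow_card(2)[OF g, of x]]) (use n in simp_all)
      then show False using n by simp
    qed
    with ins have "orbit g x - {x} = (\<lambda>n. (g ^^ n) x) ` {1..<?k}" by blast
    then have "(\<Sum>y\<in>orbit g x - {x}. F (cycle_mset D (g \<circ> transpose x y)))
        = (\<Sum>i\<in>{1..<?k}. F (cycle_mset D (g \<circ> transpose x ((g ^^ i) x))))"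
      by (simp only: sum.reindex[OF inj] o_def)
    also have "\<dots> = C ?k"
      unfolding C_def \<beta>_def
      by (intro sum.cong refl arg_cong[of _ _ F] cycle_mset_cut[OF g]) (use x D in auto)
    finally show ?thesis .
  qed
  have join: "(\<Sum>y\<in>D - orbit g x. F (cycle_mset D (g \<circ> transpose x y)))
      = (\<Sum>c\<in>?O - {orbit g x}. of_nat (card c) * J (card (orbit g x)) (card c))" if x: "x \<in> D" for x
  proof -
    have "y \<in> orbit g x \<longleftrightarrow> orbit g y = orbit g x" for y
      using orbit_eq_of_mem[OF g, of y x] permutation_self_in_orbit[OF g, of y] by auto
    then have img: "orbit g ` (D - orbit g x) = ?O - {orbit g x}" by auto
    have "(\<Sum>y\<in>D - orbit g x. F (cycle_mset D (g \<circ> transpose x y)))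
      = (\<Sum>y\<in>D - orbit g x. J (card (orbit g x)) (card (orbit g y)))"
      unfolding J_def \<beta>_def
    proof (intro sum.cong refl arg_cong[of _ _ F] cycle_mset_join)
      fix y assume "y \<in> D - orbit g x"
      then show "orbit g x \<noteq> orbit g y" using permutation_self_in_orbit[OF g, of y] by blast
    qed (use x D in auto)
    also have "\<dots> = (\<Sum>c\<in>?O - {orbit g x}. \<Sum>y\<in>{y \<in> D - orbit g x. orbit g y = c}. J (card (orbit g x)) (card (orbit g y)))"
      unfolding img[symmetric] by (rule sum.image_gen) (use D in auto)
    also have "\<dots> = (\<Sum>c\<in>?O - {orbit g x}. of_nat (card c) * J (card (orbit g x)) (card c))"
    proof (intro sum.cong refl)
      fix c assume c: "c \<in> ?O - {orbit g x}"
      then have "{y \<in> D - orbit g x. orbit g y = c} = {y. y \<in> D \<and> orbit g y = c}"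
        using orbit_eq_of_mem[OF g, of _ x] by auto
      then show "(\<Sum>y\<in>{y \<in> D - orbit g x. orbit g y = c}. J (card (orbit g x)) (card (orbit g y)))
        = of_nat (card c) * J (card (orbit g x)) (card c)"
        using sum_orbit_fibre[OF D, of c "\<lambda>c. J (card (orbit g x)) (card c)"] c by simp
    qed
    finally show ?thesis .
  qed
  have "(\<Sum>y\<in>D - {x}. F (cycle_mset D (g \<circ> transpose x y))) = C (card (orbit g x))
      + (\<Sum>c\<in>?O - {orbit g x}. of_nat (card c) * J (card (orbit g x)) (card c))" if x: "x \<in> D" for x
  proof -
    have "D - {x} = (orbit g x - {x}) \<union> (D - orbit g x)"
      using permutes_orbit_subset[OF D(2) x] permutation_self_in_orbit[OF g, of x] by blast
    then show ?thesis
      unfolding cut[OF x, symmetric] join[OF x, symmetric]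
      using D fin by (subst sum.union_disjoint[symmetric]) auto
  qed
  then have "(\<Sum>x\<in>D. \<Sum>y\<in>D - {x}. F (cycle_mset D (g \<circ> transpose x y)))
    = (\<Sum>x\<in>D. C (card (orbit g x)) + (\<Sum>c\<in>?O - {orbit g x}. of_nat (card c) * J (card (orbit g x)) (card c)))"
    by simp
  also have "\<dots> = (\<Sum>b\<in>?O. of_nat (card b) * (C (card b) + (\<Sum>c\<in>?O - {b}. of_nat (card c) * J (card b) (card c))))"
    by (rule sum_orbits[OF D, of "\<lambda>b. C (card b) + (\<Sum>c\<in>?O - {b}. of_nat (card c) * J (card b) (card c))"])
  also have "\<dots> = (\<Sum>b\<in>?O. of_nat (card b) * (C (card b) + (\<Sum>l\<in>#\<beta> - {#card b#}. of_nat l * J (card b) l)))"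
  proof (intro sum.cong refl arg_cong2[of _ _ _ _ "(*)"] arg_cong2[of _ _ _ _ "(+)"])
    fix b assume b: "b \<in> ?O"
    have "\<beta> - {#card b#} = image_mset card (mset_set (?O - {b}))"
      using b D by (simp add: \<beta>_def cycle_mset_def mset_set_Diff image_mset_Diff)
    then show "(\<Sum>c\<in>?O - {b}. of_nat (card c) * J (card b) (card c)) = (\<Sum>l\<in>#\<beta> - {#card b#}. of_nat l * J (card b) l)"
      by (simp add: sum_unfold_sum_mset image_mset.compositionality o_def)
  qed
  also have "\<dots> = (\<Sum>k\<in>#\<beta>. of_nat k * (C k + (\<Sum>l\<in>#\<beta> - {#k#}. of_nat l * J k l)))"
    unfolding \<beta>_def by (rule sum_mset_cycle_mset)
  finally show ?thesis
    by (simp add: distrib_left sum_mset.distrib sum_mset_distrib_left C_def J_def mult.assoc)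
qed

text \<open>Substituting (i, k - i) for (k, i) passes to the index pairs of the differential
  equation. \<open>N\<close> only has to bound the parts: pairs with i + j above it have
  multiplicity 0.\<close>

lemma cut_sum_by_counts:
  fixes F :: "nat multiset \<Rightarrow> 'b::comm_semiring_1"
  assumes "\<And>k. k \<in># \<beta> \<Longrightarrow> k \<le> N"
  shows "(\<Sum>k\<in>#\<beta>. of_nat k * (\<Sum>i\<in>{1..<k}. F (\<beta> - {#k#} + {#i, k - i#})))
    = (\<Sum>(i, j)\<in>{1..N} \<times> {1..N}. of_nat (count \<beta> (i + j) * (i + j)) * F (\<beta> - {#i + j#} + {#i, j#}))"
proof -
  define G where "G k i j = of_nat (count \<beta> k * k) * F (\<beta> - {#k#} + {#i, j#})" for k i j
  have "(\<Sum>k\<in>#\<beta>. of_nat k * (\<Sum>i\<in>{1..<k}. F (\<beta> - {#k#} + {#i, k - i#})))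
      = (\<Sum>k\<in>{..N}. \<Sum>i\<in>{1..<k}. G k i (k - i))"
    using assms by (subst sum_mset_eq_sum_count[of "{..N}"])
      (auto simp: G_def sum_distrib_left mult.assoc)
  also have "\<dots> = (\<Sum>(k, i)\<in>(SIGMA k:{..N}. {1..<k}). G k i (k - i))"
    by (rule sum.Sigma) auto
  also have "\<dots> = (\<Sum>(i, j)\<in>{(i, j). 1 \<le> i \<and> 1 \<le> j \<and> i + j \<le> N}. G (i + j) i j)"
    by (rule sum.reindex_bij_witness[where i = "\<lambda>(i, j). (i + j, i)" and j = "\<lambda>(k, i). (i, k - i)"]) auto
  also have "\<dots> = (\<Sum>(i, j)\<in>{1..N} \<times> {1..N}. G (i + j) i j)"
  proof (rule sum.mono_neutral_left)
    have "count \<beta> (i + j) = 0" if "\<not> i + j \<le> N" for i j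
      using assms[of "i + j"] that by (meson not_in_iff)
    then show "\<forall>x\<in>{1..N} \<times> {1..N} - {(i, j). 1 \<le> i \<and> 1 \<le> j \<and> i + j \<le> N}. (case x of (i, j) \<Rightarrow> G (i + j) i j) = 0"
      unfolding G_def by (force simp del: of_nat_add of_nat_mult)
  qed auto
  finally show ?thesis by (simp add: G_def)
qed

text \<open>The factor \<open>count \<beta> j * count (\<beta> - {#j#}) i\<close> is the number of
  ordered choices of two different parts, so c(c - 1) when i = j occurs c times. It is also what a
  second derivative produces.\<close>

lemma join_sum_by_counts:
  fixes F :: "nat multiset \<Rightarrow> 'b::comm_semiring_1"
  assumes "\<And>k. k \<in># \<beta> \<Longrightarrow> 1 \<le> k \<and> k \<le> N"
  shows "(\<Sum>k\<in>#\<beta>. \<Sum>l\<in>#\<beta> - {#k#}. of_nat (k * l) * F (\<beta> - {#k, l#} + {#k + l#}))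
    = (\<Sum>(i, j)\<in>{1..N} \<times> {1..N}. of_nat (i * j * (count \<beta> j * count (\<beta> - {#j#}) i)) * F (\<beta> - {#i, j#} + {#i + j#}))"
proof -
  have inner: "(\<Sum>l\<in>#\<beta> - {#k#}. of_nat (k * l) * F (\<beta> - {#k, l#} + {#k + l#}))
      = (\<Sum>l\<in>{1..N}. of_nat (count (\<beta> - {#k#}) l) * (of_nat (k * l) * F (\<beta> - {#k, l#} + {#k + l#})))" for k
    using assms by (intro sum_mset_eq_sum_count) (auto dest: in_diffD)
  show ?thesis
    unfolding inner
    by (subst sum_mset_eq_sum_count[of "{1..N}"], simp, use assms in force,
        simp only: sum_distrib_left, subst sum.swap, subst sum.cartesian_product)
      (auto intro!: sum.cong simp: add_mset_commute add.commute mult_ac)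
qed

section \<open>Cycle types under relabelling and disjoint union\<close>

lemma cycle_mset_bij:
  assumes h: "bij_betw h D D'" and D: "finite D" "g permutes D"
    and eq: "\<And>x. x \<in> D \<Longrightarrow> g' (h x) = h (g x)"
  shows "cycle_mset D' g' = cycle_mset D g"
proof -
  have g: "permutation g" using D permutation_permutes by blast
  have sub: "orbit g x \<subseteq> D" if "x \<in> D" for x using D(2) that by (rule permutes_orbit_subset)
  have orb: "orbit g' (h x) = h ` orbit g x" if "x \<in> D" for x
    using that sub by (intro orbit_inverse[symmetric] permutation_self_in_orbit[OF g] eq) auto
  have "orbit g' ` D' = (`) h ` (orbit g ` D)"
    using h orb unfolding bij_betw_def by (auto simp: image_image)
  moreover have "inj_on ((`) h) (orbit g ` D)"
    using h sub by (intro inj_on_subset[OF inj_on_image_Pow, of h D]) (auto simp: bij_betw_def)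
  ultimately have "cycle_mset D' g' = image_mset (\<lambda>c. card (h ` c)) (mset_set (orbit g ` D))"
    by (simp add: cycle_mset_def image_mset_mset_set[symmetric] image_mset.compositionality o_def)
  also have "\<dots> = cycle_mset D g"
    unfolding cycle_mset_def
  proof (rule image_mset_cong)
    fix c assume "c \<in># mset_set (orbit g ` D)"
    then have "c \<subseteq> D" using sub D by auto
    then show "card (h ` c) = card c"
      using h by (intro card_image) (auto simp: bij_betw_def intro: inj_on_subset)
  qed
  finally show ?thesis .
qed

lemma cycle_mset_cong:
  assumes "finite D" "g permutes D" "\<And>x. x \<in> D \<Longrightarrow> g' x = g x"
  shows "cycle_mset D g' = cycle_mset D g"
  by (rule cycle_mset_bij[of id]) (use assms in auto)

lemma cycle_mset_Un:
  assumes "finite A" "finite B" "A \<inter> B = {}" "g permutes A \<union> B" "\<And>x. x \<in> A \<Longrightarrow> g x \<in> A"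
  shows "cycle_mset (A \<union> B) g = cycle_mset A g + cycle_mset B g"
proof -
  have g: "permutation g" using assms permutation_permutes by (metis finite_UnI)
  have "orbit g x \<subseteq> A" if "x \<in> A" for x
  proof
    fix y assume "y \<in> orbit g x"
    then show "y \<in> A" by induction (use that assms in auto)
  qed
  moreover have "orbit g y = orbit g x" if "orbit g x = orbit g y" for x y using that by simp
  ultimately have "orbit g ` A \<inter> orbit g ` B = {}"
    using assms(3) permutation_self_in_orbit[OF g] by blast
  then show ?thesis
    using assms by (simp add: cycle_mset_def image_Un mset_set_Union)
qed

lemma cycle_mset_conj_transpose:
  assumes "finite D" "g permutes D" "x \<in> D" "y \<in> D"
  shows "cycle_mset D (transpose x y \<circ> g \<circ> transpose x y) = cycle_mset D g"
  by (rule cycle_mset_bij[of "transpose x y"]) (use assms in auto)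

lemma cycle_mset_insert_fixed:
  assumes "finite D" "g permutes D" "x \<notin> D"
  shows "cycle_mset (insert x D) g = add_mset 1 (cycle_mset D g)"
proof -
  have "g permutes D \<union> {x}" using assms(2) by (rule permutes_subset) auto
  moreover have "g x = x" using assms by (simp add: permutes_not_in)
  then have "orbit g x = {x}" by (simp add: orbit_eq_singleton_iff)
  then have "cycle_mset {x} g = {#1#}" by (simp add: cycle_mset_def)
  ultimately show ?thesis
    using cycle_mset_Un[of D "{x}" g] assms by (simp add: permutes_in_image)
qed

lemma sum_mset_cycle_mset_card:
  assumes "finite D" "g permutes D"
  shows "sum_mset (cycle_mset D g) = card D" "0 \<notin># cycle_mset D g"
proof -
  have g: "permutation g" using assms permutation_permutes by blast
  have "of_nat (card D) = (\<Sum>k\<in>#cycle_mset D g. k)"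
    using sum_orbits[OF assms, of "\<lambda>_. 1 :: nat"] sum_mset_cycle_mset[of "\<lambda>k. k" g D] by simp
  then show "sum_mset (cycle_mset D g) = card D" by simp
  show "0 \<notin># cycle_mset D g"
    using assms orbit_funpow_card(4)[OF g] by (auto simp: cycle_mset_def) (metis less_irrefl)
qed

section \<open>The recursion averaged over all letters\<close>

text \<open>Evaluating the recursion at the conjugate of g by (x d+1) leaves the left side unchanged
  by centrality and lets x take over the part of the letter d+1.\<close>

lemma mono_count_Suc_conj:
  assumes x: "x \<in> {1..Suc d}"
  shows "mono_count (Suc d) (Suc r) g =
    mono_count d (Suc r) (transpose x (Suc d) \<circ> g \<circ> transpose x (Suc d))
    + (\<Sum>y\<in>{1..Suc d} - {x}. mono_count (Suc d) r (g \<circ> transpose x y))"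
proof -
  let ?p = "transpose x (Suc d)"
  have "mono_count (Suc d) r (?p \<circ> g \<circ> ?p \<circ> transpose a (Suc d)) = mono_count (Suc d) r (g \<circ> transpose x (?p a))" for a
  proof -
    have "?p (Suc d) = x" by simp
    then show ?thesis
      using x by (subst conj_transpose_comp, subst mono_count_conj_transpose)
        (simp_all only: conj_transpose_transpose transpose_commute, simp)
  qed
  then have "(\<Sum>a\<in>{1..d}. mono_count (Suc d) r (?p \<circ> g \<circ> ?p \<circ> transpose a (Suc d)))
      = (\<Sum>a\<in>{1..d}. mono_count (Suc d) r (g \<circ> transpose x (?p a)))"
    by (intro sum.cong) auto
  also have "\<dots> = (\<Sum>y\<in>{1..Suc d} - {x}. mono_count (Suc d) r (g \<circ> transpose x y))"
  proof (rule sum.reindex_bij_betw)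
    have "?p ` {1..d} = ?p ` ({1..Suc d} - {Suc d})" by (intro arg_cong[of _ _ "(`) ?p"]) auto
    also have "\<dots> = {1..Suc d} - {x}" using x by (subst image_set_diff) auto
    finally show "bij_betw ?p {1..d} ({1..Suc d} - {x})" by (simp add: bij_betw_def)
  qed
  finally show ?thesis
    using x mono_count_conj_transpose[of x "Suc d" "Suc d" "Suc r" g] by (simp only: mono_count.simps) simp
qed

text \<open>Pairing of the t^r part of F_d with a class function. The indicator of a cycle type
  gives the number of sequences whose product has that type; a general test function allows
  transpositions to be shifted from the count to the cycle type.\<close>

definition mono_weight :: "nat \<Rightarrow> nat \<Rightarrow> (nat multiset \<Rightarrow> rat) \<Rightarrow> rat" where
  "mono_weight d r F = (\<Sum>g | g permutes {1..d}. of_nat (mono_count d r g) * F (cycle_mset {1..d} g))"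

text \<open>The sum of the conjugated recursion over all x. The first term is the source of z p_1 Z,
  as the letter set aside is a fixed point; the second is the source of the cut and join
  terms.\<close>

lemma mono_weight_Suc:
  "of_nat (Suc d) * mono_weight (Suc d) (Suc r) F =
     of_nat (Suc d) * mono_weight d (Suc r) (\<lambda>\<alpha>. F (add_mset 1 \<alpha>))
   + (\<Sum>g | g permutes {1..Suc d}. of_nat (mono_count (Suc d) r g) *
       (\<Sum>x\<in>{1..Suc d}. \<Sum>y\<in>{1..Suc d} - {x}. F (cycle_mset {1..Suc d} (g \<circ> transpose x y))))"
proof -
  let ?D = "{1..Suc d}"
  let ?P = "{g. g permutes ?D}"
  define p where "p x = transpose x (Suc d)" for x
  have fin: "finite ?P" by (rule finite_permutations) simp
  have p: "p x permutes ?D" if "x \<in> ?D" for x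
    unfolding p_def using that by (intro permutes_swap_id) auto
  have fixed: "(\<Sum>g\<in>?P. of_nat (mono_count d (Suc r) (p x \<circ> g \<circ> p x)) * F (cycle_mset ?D g))
     = mono_weight d (Suc r) (\<lambda>\<alpha>. F (add_mset 1 \<alpha>))" if x: "x \<in> ?D" for x
  proof -
    have pp: "p x \<circ> (p x \<circ> g \<circ> p x) \<circ> p x = g" for g
      by (simp add: p_def fun_eq_iff)
    have cyc: "cycle_mset ?D (p x \<circ> g \<circ> p x) = cycle_mset ?D g" if "g \<in> ?P" for g
      unfolding p_def by (rule cycle_mset_conj_transpose) (use x that in auto)
    have "(\<Sum>g\<in>?P. of_nat (mono_count d (Suc r) (p x \<circ> g \<circ> p x)) * F (cycle_mset ?D g))
       = (\<Sum>g\<in>?P. of_nat (mono_count d (Suc r) g) * F (cycle_mset ?D g))"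
      by (rule sum.reindex_bij_witness[where i = "\<lambda>g. p x \<circ> g \<circ> p x" and j = "\<lambda>g. p x \<circ> g \<circ> p x"])
        (use p[OF x] cyc pp in \<open>auto intro!: permutes_compose simp del: o_apply\<close>)
    also have "\<dots> = (\<Sum>g | g permutes {1..d}. of_nat (mono_count d (Suc r) g) * F (cycle_mset ?D g))"
    proof (rule sum.mono_neutral_right[OF fin])
      show "{g. g permutes {1..d}} \<subseteq> ?P" by (auto intro: permutes_subset)
      show "\<forall>g\<in>?P - {g. g permutes {1..d}}. of_nat (mono_count d (Suc r) g) * F (cycle_mset ?D g) = 0"
        using mono_count_nonzero_permutes by fastforce
    qed
    also have "\<dots> = mono_weight d (Suc r) (\<lambda>\<alpha>. F (add_mset 1 \<alpha>))"
      unfolding mono_weight_def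
    proof (intro sum.cong refl arg_cong2[of _ _ _ _ "(*)"] arg_cong[of _ _ F])
      fix g assume "g \<in> {g. g permutes {1..d}}"
      moreover have "?D = insert (Suc d) {1..d}" by auto
      ultimately show "cycle_mset ?D g = add_mset 1 (cycle_mset {1..d} g)"
        using cycle_mset_insert_fixed[of "{1..d}" g "Suc d"] by simp
    qed
    finally show ?thesis .
  qed
  \<comment> \<open>Substituting g (x y) for g moves the transposition from the count into the
    argument of the test function.\<close>
  have moved: "(\<Sum>g\<in>?P. of_nat (mono_count (Suc d) r (g \<circ> transpose x y)) * F (cycle_mset ?D g))
     = (\<Sum>g\<in>?P. of_nat (mono_count (Suc d) r g) * F (cycle_mset ?D (g \<circ> transpose x y)))"
    if "x \<in> ?D" "y \<in> ?D" for x y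
  proof -
    have "transpose x y permutes ?D" using that by (intro permutes_swap_id) auto
    then show ?thesis
      by (intro sum.reindex_bij_witness[where i = "\<lambda>g. g \<circ> transpose x y" and j = "\<lambda>g. g \<circ> transpose x y"])
        (auto intro!: permutes_compose simp: comp_assoc simp del: o_apply)
  qed
  have "of_nat (Suc d) * mono_weight (Suc d) (Suc r) F
      = (\<Sum>x\<in>?D. \<Sum>g\<in>?P. of_nat (mono_count (Suc d) (Suc r) g) * F (cycle_mset ?D g))"
    by (simp add: mono_weight_def)
  also have "\<dots> = (\<Sum>x\<in>?D. \<Sum>g\<in>?P. of_nat (mono_count d (Suc r) (p x \<circ> g \<circ> p x)) * F (cycle_mset ?D g)
      + (\<Sum>y\<in>?D - {x}. of_nat (mono_count (Suc d) r (g \<circ> transpose x y)) * F (cycle_mset ?D g)))"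
    unfolding p_def by (intro sum.cong refl, subst mono_count_Suc_conj, assumption)
      (simp add: distrib_right sum_distrib_right del: mono_count.simps o_apply)
  also have "\<dots> = (\<Sum>x\<in>?D. mono_weight d (Suc r) (\<lambda>\<alpha>. F (add_mset 1 \<alpha>))
      + (\<Sum>y\<in>?D - {x}. \<Sum>g\<in>?P. of_nat (mono_count (Suc d) r (g \<circ> transpose x y)) * F (cycle_mset ?D g)))"
    unfolding sum.distrib[where A = ?P] by (intro sum.cong refl arg_cong2[of _ _ _ _ "(+)"] fixed sum.swap)
  also have "\<dots> = (\<Sum>x\<in>?D. mono_weight d (Suc r) (\<lambda>\<alpha>. F (add_mset 1 \<alpha>))
      + (\<Sum>y\<in>?D - {x}. \<Sum>g\<in>?P. of_nat (mono_count (Suc d) r g) * F (cycle_mset ?D (g \<circ> transpose x y))))"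
    by (intro sum.cong refl arg_cong2[of _ _ _ _ "(+)"] moved) auto
  also have "\<dots> = of_nat (Suc d) * mono_weight d (Suc r) (\<lambda>\<alpha>. F (add_mset 1 \<alpha>))
      + (\<Sum>x\<in>?D. \<Sum>y\<in>?D - {x}. \<Sum>g\<in>?P. of_nat (mono_count (Suc d) r g) * F (cycle_mset ?D (g \<circ> transpose x y)))"
    unfolding sum.distrib by simp
  also have "(\<Sum>x\<in>?D. \<Sum>y\<in>?D - {x}. \<Sum>g\<in>?P. of_nat (mono_count (Suc d) r g) * F (cycle_mset ?D (g \<circ> transpose x y)))
     = (\<Sum>g\<in>?P. of_nat (mono_count (Suc d) r g) *
       (\<Sum>x\<in>?D. \<Sum>y\<in>?D - {x}. F (cycle_mset ?D (g \<circ> transpose x y))))"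
    unfolding sum_distrib_left by (subst sum.swap[of _ ?P], intro sum.cong refl sum.swap)
  finally show ?thesis .
qed

section \<open>Monotone sequences of transpositions\<close>

text \<open>Pairs stand for transpositions: for s < t each determines the other, and monotonicity,
  restriction to a component and relabelling become plain list operations.\<close>

definition swap_prod :: "('a \<times> 'a) list \<Rightarrow> 'a \<Rightarrow> 'a" where
  "swap_prod ps = foldr (\<lambda>(s, t) f. transpose s t \<circ> f) ps id"

lemma swap_prod_simps [simp]:
  "swap_prod [] = id"
  "swap_prod ((s, t) # ps) = transpose s t \<circ> swap_prod ps"
  by (simp_all add: swap_prod_def)

lemma swap_prod_snoc: "swap_prod (ps @ [(s, t)]) = swap_prod ps \<circ> transpose s t"
  by (induction ps) (auto simp: comp_assoc fun_eq_iff)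

lemma swap_prod_permutes: "set ps \<subseteq> D \<times> D \<Longrightarrow> swap_prod ps permutes D"
proof (induction ps)
  case (Cons p ps)
  then show ?case
    by (cases p) (auto intro!: permutes_compose permutes_swap_id simp del: o_apply)
qed (simp add: permutes_id del: id_apply)

definition mono_seqs :: "nat set \<Rightarrow> nat \<Rightarrow> (nat \<times> nat) list set" where
  "mono_seqs D r = {ps. length ps = r \<and> set ps \<subseteq> {(s, t). s \<in> D \<and> t \<in> D \<and> s < t} \<and> sorted (map snd ps)}"

lemma mono_seqsD:
  assumes "ps \<in> mono_seqs D r"
  shows "length ps = r" "set ps \<subseteq> D \<times> D" "sorted (map snd ps)"
    "\<And>s t. (s, t) \<in> set ps \<Longrightarrow> s \<in> D \<and> t \<in> D \<and> s < t"
  using assms by (auto simp: mono_seqs_def)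

lemma finite_mono_seqs: "finite D \<Longrightarrow> finite (mono_seqs D r)"
  by (rule finite_subset[OF _ finite_lists_length_eq[of "D \<times> D" r]]) (auto simp: mono_seqs_def)

lemma mono_seqs_0: "mono_seqs D 0 = {[]}"
  by (auto simp: mono_seqs_def)

text \<open>By sortedness the last pair has the largest second entry: if that is d+1 the pair can be
  stripped, otherwise d+1 does not occur at all.\<close>

lemma mono_seqs_Suc:
  "mono_seqs {1..Suc d} (Suc r) = mono_seqs {1..d} (Suc r)
     \<union> (\<lambda>(a, ps). ps @ [(a, Suc d)]) ` ({1..d} \<times> mono_seqs {1..Suc d} r)" (is "?L = ?R")
proof (intro equalityI subsetI)
  fix qs assume qs: "qs \<in> ?L"
  then have "qs \<noteq> []" by (auto simp: mono_seqs_def)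
  then obtain ps s t where ps: "qs = ps @ [(s, t)]"
    by (metis append_butlast_last_id surj_pair)
  have st: "1 \<le> s" "s < t" "t \<le> Suc d" using mono_seqsD(4)[OF qs, of s t] ps by auto
  have le: "v \<le> t" if "(u, v) \<in> set qs" for u v
    using mono_seqsD(3)[OF qs] that st by (auto simp: ps sorted_append)
  show "qs \<in> ?R"
  proof (cases "t = Suc d")
    case True
    have "ps \<in> mono_seqs {1..Suc d} r"
      using qs by (auto simp: ps mono_seqs_def sorted_append)
    then show ?thesis using st True by (auto simp: ps intro!: image_eqI[of _ _ "(s, ps)"])
  next
    case False
    have "set qs \<subseteq> {(s, t). s \<in> {1..d} \<and> t \<in> {1..d} \<and> s < t}"
    proof clarify
      fix u v assume uv: "(u, v) \<in> set qs"
      show "u \<in> {1..d} \<and> v \<in> {1..d} \<and> u < v"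
        using mono_seqsD(4)[OF qs uv] le[OF uv] st False by auto
    qed
    then show ?thesis using qs by (simp add: mono_seqs_def)
  qed
next
  fix qs assume "qs \<in> ?R"
  then show "qs \<in> ?L"
  proof
    assume "qs \<in> mono_seqs {1..d} (Suc r)"
    then show ?thesis by (fastforce simp: mono_seqs_def)
  next
    assume "qs \<in> (\<lambda>(a, ps). ps @ [(a, Suc d)]) ` ({1..d} \<times> mono_seqs {1..Suc d} r)"
    then show ?thesis by (fastforce simp: mono_seqs_def sorted_append)
  qed
qed

lemma card_mono_seqs: "card {ps \<in> mono_seqs {1..d} r. swap_prod ps = g} = mono_count d r g"
proof (induction d r g rule: mono_count.induct)
  case (1 d g)
  have "{ps \<in> mono_seqs {1..d} 0. swap_prod ps = g} = (if g = id then {[]} else {})"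
    by (auto simp: mono_seqs_0 simp del: id_apply)
  then show ?case by simp
next
  case (2 r g)
  have "{ps \<in> mono_seqs {1..0} (Suc r). swap_prod ps = g} = {}"
    by (auto simp: mono_seqs_def length_Suc_conv)
  then show ?case by (simp only: mono_count.simps card.empty)
next
  case (3 d r g)
  let ?B = "\<lambda>a. {ps \<in> mono_seqs {1..Suc d} r. swap_prod ps = g \<circ> transpose a (Suc d)}"
  let ?f = "\<lambda>(a, ps). ps @ [(a, Suc d)]"
  have eq: "swap_prod (ps @ [(a, Suc d)]) = g \<longleftrightarrow> swap_prod ps = g \<circ> transpose a (Suc d)" for ps a
    unfolding swap_prod_snoc by (metis comp_assoc comp_id transpose_comp_involutory)
  have split: "{ps \<in> mono_seqs {1..Suc d} (Suc r). swap_prod ps = g}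
      = {ps \<in> mono_seqs {1..d} (Suc r). swap_prod ps = g} \<union> ?f ` (SIGMA a:{1..d}. ?B a)"
  proof -
    have "(SIGMA a:{1..d}. ?B a) = {x \<in> {1..d} \<times> mono_seqs {1..Suc d} r. swap_prod (?f x) = g}"
    proof (rule Set.set_eqI)
      fix x
      show "x \<in> (SIGMA a:{1..d}. ?B a) \<longleftrightarrow> x \<in> {x \<in> {1..d} \<times> mono_seqs {1..Suc d} r. swap_prod (?f x) = g}"
        by (cases x) (simp only: mem_Sigma_iff mem_Collect_eq prod.case eq, blast)
    qed
    then have "?f ` (SIGMA a:{1..d}. ?B a) = ?f ` {x \<in> {1..d} \<times> mono_seqs {1..Suc d} r. swap_prod (?f x) = g}"
      by (rule arg_cong)
    moreover have "{x \<in> A \<union> f ` B. P x} = {x \<in> A. P x} \<union> f ` {x \<in> B. P (f x)}"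
      for A :: "'z set" and f :: "'y \<Rightarrow> 'z" and P B by blast
    ultimately show ?thesis unfolding mono_seqs_Suc by (simp only:)
  qed
  have fin: "finite (mono_seqs {1..d} (Suc r))" "finite (mono_seqs {1..Suc d} r)"
    by (simp_all add: finite_mono_seqs)
  have "Suc d \<in> snd ` set qs" if "qs \<in> ?f ` (SIGMA a:{1..d}. ?B a)" for qs
    using that by force
  moreover have "Suc d \<notin> snd ` set qs" if "qs \<in> mono_seqs {1..d} (Suc r)" for qs
    using mono_seqsD(2)[OF that] by auto
  ultimately have "{ps \<in> mono_seqs {1..d} (Suc r). swap_prod ps = g} \<inter> ?f ` (SIGMA a:{1..d}. ?B a) = {}"
    by blast
  then have "card {ps \<in> mono_seqs {1..Suc d} (Suc r). swap_prod ps = g}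
     = card {ps \<in> mono_seqs {1..d} (Suc r). swap_prod ps = g} + card (?f ` (SIGMA a:{1..d}. ?B a))"
    unfolding split using fin by (intro card_Un_disjoint) auto
  also have "card (?f ` (SIGMA a:{1..d}. ?B a)) = card (SIGMA a:{1..d}. ?B a)"
    by (rule card_image) (auto simp: inj_on_def)
  also have "\<dots> = (\<Sum>a\<in>{1..d}. card (?B a))" using fin by (intro card_SigmaI) auto
  also have "\<dots> = (\<Sum>a\<in>{1..d}. mono_count (Suc d) r (g \<circ> transpose a (Suc d)))"
    by (intro sum.cong refl 3(2))
  finally show ?case by (simp only: mono_count.simps 3(1))
qed

definition seq_count :: "nat set \<Rightarrow> nat \<Rightarrow> nat multiset \<Rightarrow> nat" where
  "seq_count D r \<alpha> = card {ps \<in> mono_seqs D r. cycle_mset D (swap_prod ps) = \<alpha>}"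

lemma seq_count_eq_mono_weight:
  "of_nat (seq_count {1..d} r \<alpha>) = mono_weight d r (\<lambda>\<beta>. of_bool (\<beta> = \<alpha>))"
proof -
  let ?M = "mono_seqs {1..d} r" and ?P = "{g. g permutes {1..d}}"
  have fin: "finite ?M" by (simp add: finite_mono_seqs)
  have "of_nat (seq_count {1..d} r \<alpha>) = (\<Sum>ps\<in>?M. of_bool (cycle_mset {1..d} (swap_prod ps) = \<alpha>) :: rat)"
    using fin by (simp add: seq_count_def of_bool_def sum.If_cases Int_def)
  also have "\<dots> = (\<Sum>g\<in>?P. \<Sum>ps\<in>{ps \<in> ?M. swap_prod ps = g}. of_bool (cycle_mset {1..d} (swap_prod ps) = \<alpha>))"
  proof (rule sum.group[symmetric])
    show "finite ?P" by (rule finite_permutations) simp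
    show "swap_prod ` ?M \<subseteq> ?P" using swap_prod_permutes[OF mono_seqsD(2)] by blast
  qed (rule fin)
  also have "\<dots> = mono_weight d r (\<lambda>\<beta>. of_bool (\<beta> = \<alpha>))"
    unfolding mono_weight_def
  proof (intro sum.cong refl)
    fix g
    have "(\<Sum>ps\<in>{ps \<in> ?M. swap_prod ps = g}. of_bool (cycle_mset {1..d} (swap_prod ps) = \<alpha>) :: rat)
        = (\<Sum>ps\<in>{ps \<in> ?M. swap_prod ps = g}. of_bool (cycle_mset {1..d} g = \<alpha>))"
      by (rule sum.cong) auto
    then show "(\<Sum>ps\<in>{ps \<in> ?M. swap_prod ps = g}. of_bool (cycle_mset {1..d} (swap_prod ps) = \<alpha>))
       = of_nat (mono_count d r g) * (of_bool (cycle_mset {1..d} g = \<alpha>) :: rat)"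
      using card_mono_seqs[of d r g] by simp
  qed
  finally show ?thesis .
qed

lemma seq_count_nonzero:
  assumes "seq_count D r \<alpha> \<noteq> 0" "finite D"
  shows "sum_mset \<alpha> = card D" "0 \<notin># \<alpha>"
proof -
  from assms obtain ps where "ps \<in> mono_seqs D r" "cycle_mset D (swap_prod ps) = \<alpha>"
    unfolding seq_count_def by (metis (mono_tags, lifting) card.empty empty_Collect_eq)
  then show "sum_mset \<alpha> = card D" "0 \<notin># \<alpha>"
    using sum_mset_cycle_mset_card[OF assms(2), of "swap_prod ps"] swap_prod_permutes mono_seqsD(2) by blast+
qed

lemma mono_weight_add_mset:
  "mono_weight d r (\<lambda>\<beta>. of_bool (add_mset k \<beta> = \<alpha>))
     = (if k \<in># \<alpha> then of_nat (seq_count {1..d} r (\<alpha> - {#k#})) else 0)"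
proof (cases "k \<in># \<alpha>")
  case True
  then have "add_mset k \<beta> = \<alpha> \<longleftrightarrow> \<beta> = \<alpha> - {#k#}" for \<beta> by auto
  then show ?thesis using True by (simp only: seq_count_eq_mono_weight if_True)
next
  case False
  then have "add_mset k \<beta> \<noteq> \<alpha>" for \<beta> by auto
  then show ?thesis using False by (simp add: mono_weight_def)
qed

text \<open>
  The coefficient at \<open>p\<^sub>\<alpha>\<close> of \<open>(i + j) p\<^sub>i p\<^sub>j \<partial>T/\<partial>p\<^sub>i\<^sub>+\<^sub>j\<close> and of \<open>i j p\<^sub>i\<^sub>+\<^sub>j \<partial>\<^sup>2T/\<partial>p\<^sub>i\<partial>p\<^sub>j\<close>, where \<open>T\<close> is given by its
  coefficients.
\<close>

definition cut_coeff :: "(nat multiset \<Rightarrow> 'b::comm_semiring_1) \<Rightarrow> nat multiset \<Rightarrow> nat \<times> nat \<Rightarrow> 'b" where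
  "cut_coeff T \<alpha> = (\<lambda>(i, j). if {#i, j#} \<subseteq># \<alpha> then
     of_nat ((i + j) * Suc (count (\<alpha> - {#i, j#}) (i + j))) * T (\<alpha> - {#i, j#} + {#i + j#}) else 0)"

definition join_coeff :: "(nat multiset \<Rightarrow> 'b::comm_semiring_1) \<Rightarrow> nat multiset \<Rightarrow> nat \<times> nat \<Rightarrow> 'b" where
  "join_coeff T \<alpha> = (\<lambda>(i, j). if i + j \<in># \<alpha> then
     of_nat (i * j * (Suc (count (\<alpha> - {#i + j#}) i) * Suc (count (add_mset i (\<alpha> - {#i + j#})) j)))
       * T (\<alpha> - {#i + j#} + {#i, j#}) else 0)"

text \<open>Transposes the cutting operator: the left side looks for \<alpha> among the cuts of
  \<beta>, the right side recovers \<beta> from \<alpha> by replacing i, j with i + j. The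
  multiplicity of i + j in \<beta> is one more than in the common rest, which explains the
  \<open>Suc\<close>.\<close>

lemma cut_coeff_of_bool:
  "of_nat (count \<beta> (i + j) * (i + j)) * of_bool (\<beta> - {#i + j#} + {#i, j#} = \<alpha>)
     = (cut_coeff (\<lambda>\<gamma>. of_bool (\<beta> = \<gamma>)) \<alpha> (i, j) :: 'b::comm_semiring_1)"
proof (cases "i + j \<in># \<beta> \<and> \<beta> - {#i + j#} + {#i, j#} = \<alpha>")
  case True
  then obtain \<gamma> where \<gamma>: "\<beta> = add_mset (i + j) \<gamma>" by (metis insert_DiffM)
  then have "\<alpha> = \<gamma> + {#i, j#}" using True by auto
  then show ?thesis using \<gamma> by (simp add: cut_coeff_def mult.commute)
next
  case False
  have "\<not> ({#i, j#} \<subseteq># \<alpha> \<and> \<beta> = \<alpha> - {#i, j#} + {#i + j#})"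
  proof
    assume *: "{#i, j#} \<subseteq># \<alpha> \<and> \<beta> = \<alpha> - {#i, j#} + {#i + j#}"
    then have "\<beta> - {#i + j#} + {#i, j#} = \<alpha>" by (metis add_diff_cancel_right' subset_mset.diff_add)
    then show False using False * by simp
  qed
  then have "cut_coeff (\<lambda>\<gamma>. of_bool (\<beta> = \<gamma>)) \<alpha> (i, j) = (0 :: 'b)" by (auto simp: cut_coeff_def)
  moreover have "of_nat (count \<beta> (i + j) * (i + j)) * of_bool (\<beta> - {#i + j#} + {#i, j#} = \<alpha>) = (0 :: 'b)"
    using False by (auto simp: not_in_iff)
  ultimately show ?thesis by (simp only:)
qed

lemma join_coeff_of_bool:
  "of_nat (i * j * (count \<beta> j * count (\<beta> - {#j#}) i)) * of_bool (\<beta> - {#i, j#} + {#i + j#} = \<alpha>)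
     = (join_coeff (\<lambda>\<gamma>. of_bool (\<beta> = \<gamma>)) \<alpha> (i, j) :: 'b::comm_semiring_1)"
proof (cases "j \<in># \<beta> \<and> i \<in># \<beta> - {#j#} \<and> \<beta> - {#i, j#} + {#i + j#} = \<alpha>")
  case True
  then obtain \<gamma> where \<gamma>: "\<beta> = \<gamma> + {#i, j#}" by (metis insert_DiffM add_mset_commute union_mset_add_mset_right add.right_neutral)
  then have "\<alpha> = add_mset (i + j) \<gamma>" using True by auto
  then show ?thesis using \<gamma> by (simp add: join_coeff_def mult_ac del: of_nat_mult of_nat_Suc of_nat_add mult_Suc mult_Suc_right)
next
  case False
  have "\<not> (i + j \<in># \<alpha> \<and> \<beta> = \<alpha> - {#i + j#} + {#i, j#})"
  proof
    assume *: "i + j \<in># \<alpha> \<and> \<beta> = \<alpha> - {#i + j#} + {#i, j#}"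
    then have "\<beta> - {#i, j#} + {#i + j#} = \<alpha>" by simp
    then show False using False * by simp
  qed
  then have "join_coeff (\<lambda>\<gamma>. of_bool (\<beta> = \<gamma>)) \<alpha> (i, j) = (0 :: 'b)" by (auto simp: join_coeff_def)
  moreover have "of_nat (i * j * (count \<beta> j * count (\<beta> - {#j#}) i)) * of_bool (\<beta> - {#i, j#} + {#i + j#} = \<alpha>) = (0 :: 'b)"
    using False by (auto simp: not_in_iff)
  ultimately show ?thesis by (simp only:)
qed

lemma sum_cut_coeff:
  "(\<Sum>g\<in>P. w g * cut_coeff (\<lambda>\<gamma>. h g \<gamma>) \<alpha> p) = cut_coeff (\<lambda>\<gamma>. \<Sum>g\<in>P. w g * h g \<gamma>) \<alpha> p"
  by (cases p) (simp add: cut_coeff_def sum_distrib_left mult_ac del: of_nat_mult of_nat_Suc of_nat_add mult_Suc mult_Suc_right)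

lemma sum_join_coeff:
  "(\<Sum>g\<in>P. w g * join_coeff (\<lambda>\<gamma>. h g \<gamma>) \<alpha> p) = join_coeff (\<lambda>\<gamma>. \<Sum>g\<in>P. w g * h g \<gamma>) \<alpha> p"
  by (cases p) (simp add: join_coeff_def sum_distrib_left mult_ac del: of_nat_mult of_nat_Suc of_nat_add mult_Suc mult_Suc_right)

text \<open>The averaged recursion tested on the indicator of \<alpha>: this is the linear equation
  for \<open>Z\<close>, coefficient by coefficient and before division by d!. \<open>N\<close> is
  left free to be matched with the infinite sum over pairs later.\<close>

lemma seq_count_Suc:
  fixes \<alpha> :: "nat multiset"
  assumes N: "Suc d \<le> N"
  defines "T \<equiv> \<lambda>d r \<alpha>. of_nat (seq_count {1..d} r \<alpha>) :: rat"
  shows "of_nat (Suc d) * T (Suc d) (Suc r) \<alpha> =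
    of_nat (Suc d) * (if 1 \<in># \<alpha> then T d (Suc r) (\<alpha> - {#1#}) else 0)
    + (\<Sum>p\<in>{1..N} \<times> {1..N}. cut_coeff (T (Suc d) r) \<alpha> p + join_coeff (T (Suc d) r) \<alpha> p)"
proof -
  let ?D = "{1..Suc d}"
  let ?I = "{1..N} \<times> {1..N}"
  let ?F = "\<lambda>\<beta>. of_bool (\<beta> = \<alpha>) :: rat"
  have inner: "(\<Sum>x\<in>?D. \<Sum>y\<in>?D - {x}. ?F (cycle_mset ?D (g \<circ> transpose x y)))
     = (\<Sum>p\<in>?I. cut_coeff (\<lambda>\<gamma>. of_bool (cycle_mset ?D g = \<gamma>)) \<alpha> p + join_coeff (\<lambda>\<gamma>. of_bool (cycle_mset ?D g = \<gamma>)) \<alpha> p)"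
    if g: "g permutes ?D" for g
  proof -
    let ?\<beta> = "cycle_mset ?D g"
    have "k \<le> Suc d" if "k \<in># ?\<beta>" for k
      using sum_mset_cycle_mset_card(1)[OF _ g] that by (metis card_atLeastAtMost diff_Suc_1 finite_atLeastAtMost le_add1 multi_member_split sum_mset.add_mset)
    moreover have "1 \<le> k" if "k \<in># ?\<beta>" for k
      using sum_mset_cycle_mset_card(2)[OF _ g] that by (cases k) auto
    ultimately have k: "k \<in># ?\<beta> \<Longrightarrow> 1 \<le> k \<and> k \<le> N" for k using N by fastforce
    show ?thesis
      unfolding sum_transpositions_cycle_mset[OF finite_atLeastAtMost g, where F = ?F]
      by (subst cut_sum_by_counts[of _ N], use k in blast, subst join_sum_by_counts[of _ N], use k in blast)
        (simp only: cut_coeff_of_bool join_coeff_of_bool sum.distrib case_prod_eta)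
  qed
  have T: "T (Suc d) r = (\<lambda>\<gamma>. \<Sum>g | g permutes ?D. of_nat (mono_count (Suc d) r g) * of_bool (cycle_mset ?D g = \<gamma>))"
    by (intro ext) (simp only: T_def seq_count_eq_mono_weight mono_weight_def)
  have "(\<Sum>g | g permutes ?D. of_nat (mono_count (Suc d) r g) *
       (\<Sum>x\<in>?D. \<Sum>y\<in>?D - {x}. ?F (cycle_mset ?D (g \<circ> transpose x y))))
    = (\<Sum>g | g permutes ?D. \<Sum>p\<in>?I. of_nat (mono_count (Suc d) r g) *
        cut_coeff (\<lambda>\<gamma>. of_bool (cycle_mset ?D g = \<gamma>)) \<alpha> p + of_nat (mono_count (Suc d) r g) *
        join_coeff (\<lambda>\<gamma>. of_bool (cycle_mset ?D g = \<gamma>)) \<alpha> p)"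
    by (intro sum.cong refl) (simp only: mem_Collect_eq inner sum_distrib_left distrib_left)
  also have "\<dots> = (\<Sum>p\<in>?I. cut_coeff (T (Suc d) r) \<alpha> p + join_coeff (T (Suc d) r) \<alpha> p)"
    unfolding T by (subst sum.swap) (simp only: sum.distrib sum_cut_coeff sum_join_coeff)
  finally show ?thesis
    using mono_weight_Suc[of d r ?F] unfolding T_def seq_count_eq_mono_weight mono_weight_add_mset
    by (simp only: seq_count_eq_mono_weight)
qed

lemma seq_count_0: "seq_count {1..d} 0 \<alpha> = of_bool (\<alpha> = replicate_mset d 1)"
proof -
  have "cycle_mset {1..d} id = replicate_mset d 1"
  proof (induction d)
    case (Suc d)
    have "{1..Suc d} = insert (Suc d) {1..d}" by auto
    moreover have "cycle_mset (insert (Suc d) {1..d}) id = add_mset 1 (cycle_mset {1..d} id)"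
      by (rule cycle_mset_insert_fixed) (auto intro: permutes_id)
    ultimately show ?case by (simp only: Suc replicate_mset_Suc)
  qed (simp add: cycle_mset_def)
  then have "{ps \<in> mono_seqs {1..d} 0. cycle_mset {1..d} (swap_prod ps) = \<alpha>}
    = (if \<alpha> = replicate_mset d 1 then {[]} else {})"
    by (auto simp: mono_seqs_0 simp del: id_apply)
  then show ?thesis by (simp add: seq_count_def)
qed

text \<open>The t^0 part of the linear equation, where only the empty sequence and fixed points
  remain.\<close>

lemma seq_count_Suc_0:
  "seq_count {1..Suc d} 0 \<alpha> = (if 1 \<in># \<alpha> then seq_count {1..d} 0 (\<alpha> - {#1#}) else 0)"
  unfolding seq_count_0 by (cases "1 \<in># \<alpha>") (auto dest!: multi_member_split)

section \<open>Connected components\<close>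

text \<open>The relation of lying in the same component of the graph whose edges are the
  transpositions.\<close>

definition linked :: "('a \<times> 'a) list \<Rightarrow> ('a \<times> 'a) set" where
  "linked ps = (set ps \<union> (set ps)\<inverse>)\<^sup>*"

definition connected_seq :: "'a set \<Rightarrow> ('a \<times> 'a) list \<Rightarrow> bool" where
  "connected_seq D ps \<longleftrightarrow> (\<forall>x\<in>D. \<forall>y\<in>D. (x, y) \<in> linked ps)"

lemma linked_sym: "(x, y) \<in> linked ps \<Longrightarrow> (y, x) \<in> linked ps"
  unfolding linked_def by (metis converse_Un converse_converse rtrancl_converseI sup_commute)

lemma linked_trans: "(x, y) \<in> linked ps \<Longrightarrow> (y, z) \<in> linked ps \<Longrightarrow> (x, z) \<in> linked ps"
  unfolding linked_def by (rule rtrancl_trans)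

lemma linked_refl [simp]: "(x, x) \<in> linked ps"
  by (simp add: linked_def)

lemma linked_edge: "(s, t) \<in> set ps \<Longrightarrow> (s, t) \<in> linked ps"
  by (auto simp: linked_def)

lemma linked_mono: "set ps \<subseteq> set qs \<Longrightarrow> linked ps \<subseteq> linked qs"
  unfolding linked_def by (rule rtrancl_mono) auto

text \<open>No edge crosses the border of \<open>A\<close>, so a path starting in \<open>A\<close>
  stays there, and testing the second entry alone selects exactly the edges inside
  \<open>A\<close>.\<close>

lemma linked_closed:
  assumes "(x, y) \<in> linked ps" "x \<in> A" "\<And>s t. (s, t) \<in> set ps \<Longrightarrow> s \<in> A \<longleftrightarrow> t \<in> A"
  shows "y \<in> A \<and> (x, y) \<in> linked (filter (\<lambda>p. snd p \<in> A) ps)"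
  using assms(1) unfolding linked_def
proof (induction rule: rtrancl_induct)
  case (step y z)
  then have "z \<in> A" using assms(3) by blast
  moreover have "(y, z) \<in> set (filter (\<lambda>p. snd p \<in> A) ps) \<union> (set (filter (\<lambda>p. snd p \<in> A) ps))\<inverse>"
    using step \<open>z \<in> A\<close> by auto
  ultimately show ?case using step by (meson rtrancl.rtrancl_into_rtrancl)
qed (use assms in simp)

lemma swap_prod_filter:
  assumes "\<And>s t. (s, t) \<in> set ps \<Longrightarrow> s \<in> A \<longleftrightarrow> t \<in> A" "x \<in> A"
  shows "swap_prod ps x = swap_prod (filter (\<lambda>p. snd p \<in> A) ps) x \<and> swap_prod ps x \<in> A"
  using assms(1)
proof (induction ps)
  case (Cons p ps)
  obtain s t where p: "p = (s, t)" by (cases p)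
  have st: "s \<in> A \<longleftrightarrow> t \<in> A" using Cons.prems p by simp
  have IH: "swap_prod ps x = swap_prod (filter (\<lambda>p. snd p \<in> A) ps) x" "swap_prod ps x \<in> A"
    using Cons by auto
  show ?case
  proof (cases "t \<in> A")
    case True
    then show ?thesis using IH st by (auto simp: p transpose_def)
  next
    case False
    then have "transpose s t (swap_prod ps x) = swap_prod ps x"
      using IH st by (intro transpose_apply_other) auto
    then show ?thesis using IH False by (simp add: p)
  qed
qed (use assms in simp)

lemma cycle_mset_swap_prod_split:
  assumes "finite D" "A \<subseteq> D" "set ps \<subseteq> D \<times> D" "\<And>s t. (s, t) \<in> set ps \<Longrightarrow> s \<in> A \<longleftrightarrow> t \<in> A"
  shows "cycle_mset D (swap_prod ps) = cycle_mset A (swap_prod (filter (\<lambda>p. snd p \<in> A) ps))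
    + cycle_mset (D - A) (swap_prod (filter (\<lambda>p. snd p \<notin> A) ps))"
proof -
  let ?g = "swap_prod ps"
  have fin: "finite A" "finite (D - A)" using assms finite_subset by auto
  have D: "D = A \<union> (D - A)" using assms by auto
  have g: "?g permutes A \<union> (D - A)" unfolding D[symmetric] using assms by (intro swap_prod_permutes)
  have "cycle_mset D ?g = cycle_mset A ?g + cycle_mset (D - A) ?g"
    by (subst D, rule cycle_mset_Un) (use fin g swap_prod_filter[OF assms(4)] in blast)+
  also have "cycle_mset A ?g = cycle_mset A (swap_prod (filter (\<lambda>p. snd p \<in> A) ps))"
  proof (rule cycle_mset_cong[OF fin(1)])
    show "swap_prod (filter (\<lambda>p. snd p \<in> A) ps) permutes A"
      using assms(4) by (intro swap_prod_permutes) auto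
  qed (use swap_prod_filter[OF assms(4)] in blast)
  also have "cycle_mset (D - A) ?g = cycle_mset (D - A) (swap_prod (filter (\<lambda>p. snd p \<notin> A) ps))"
  proof (rule cycle_mset_cong[OF fin(2)])
    show "swap_prod (filter (\<lambda>p. snd p \<notin> A) ps) permutes D - A"
      using assms(3,4) by (intro swap_prod_permutes) auto
    fix x assume "x \<in> D - A"
    then show "?g x = swap_prod (filter (\<lambda>p. snd p \<notin> A) ps) x"
      using swap_prod_filter[of ps "- A" x] assms(4) by auto
  qed
  finally show ?thesis .
qed

text \<open>The empty sequence on the empty set counts as connected, so the value at
  \<open>{}\<close>, 0, \<open>{#}\<close> is 1; the term d = 0 of the Hurwitz series has to be set
  to 0 separately.\<close>

definition connected_count :: "nat set \<Rightarrow> nat \<Rightarrow> nat multiset \<Rightarrow> nat" where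
  "connected_count D r \<alpha> = card {ps \<in> mono_seqs D r. connected_seq D ps \<and> cycle_mset D (swap_prod ps) = \<alpha>}"

text \<open>
  The component of \<open>x\<close> splits a monotone sequence in two; conversely, as transpositions of the two
  parts never share their larger element, two monotone sequences merge in exactly one way, which
  the stable sort computes.
\<close>

lemma merge_mono_seqs:
  assumes us: "us \<in> mono_seqs A q" and vs: "vs \<in> mono_seqs B r" and disj: "A \<inter> B = {}"
  defines "ps \<equiv> sort_key snd (us @ vs)"
  shows "ps \<in> mono_seqs (A \<union> B) (q + r)" "filter (\<lambda>p. snd p \<in> A) ps = us" "filter (\<lambda>p. snd p \<notin> A) ps = vs"
    "set ps = set us \<union> set vs"
proof -
  show set: "set ps = set us \<union> set vs" by (simp add: ps_def)
  show "ps \<in> mono_seqs (A \<union> B) (q + r)"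
    using us vs set by (auto simp: mono_seqs_def ps_def)
  have A: "\<forall>p\<in>set us. snd p \<in> A" "\<forall>p\<in>set vs. snd p \<notin> A"
    using mono_seqsD(4)[OF us] mono_seqsD(4)[OF vs] disj by fastforce+
  then have "filter (\<lambda>p. snd p \<in> A) (us @ vs) = us"
    by (simp add: filter_True filter_False)
  then show "filter (\<lambda>p. snd p \<in> A) ps = us"
    using mono_seqsD(3)[OF us] by (simp add: ps_def filter_sort sort_key_id_if_sorted)
  from A have "filter (\<lambda>p. snd p \<notin> A) (us @ vs) = vs"
    by (simp add: filter_True filter_False)
  then show "filter (\<lambda>p. snd p \<notin> A) ps = vs"
    using mono_seqsD(3)[OF vs] by (simp add: ps_def filter_sort sort_key_id_if_sorted)
qed

text \<open>A stable sort is determined by its sublists of equal key, and each key class lies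
  entirely in one of the two filtered lists, in its original order.\<close>

lemma merge_filters:
  assumes "sorted (map f ps)"
  shows "sort_key f (filter (\<lambda>p. f p \<in> A) ps @ filter (\<lambda>p. f p \<notin> A) ps) = ps"
proof (rule properties_for_sort_key)
  show "mset ps = mset (filter (\<lambda>p. f p \<in> A) ps @ filter (\<lambda>p. f p \<notin> A) ps)"
    by simp
  fix k
  show "filter (\<lambda>x. f k = f x) ps = filter (\<lambda>x. f k = f x) (filter (\<lambda>p. f p \<in> A) ps @ filter (\<lambda>p. f p \<notin> A) ps)"
  proof (cases "f k \<in> A")
    case True
    then have "filter (\<lambda>x. f k = f x) (filter (\<lambda>p. f p \<in> A) ps) = filter (\<lambda>x. f k = f x) ps"
      "filter (\<lambda>x. f k = f x) (filter (\<lambda>p. f p \<notin> A) ps) = []"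
      by (auto intro!: filter_cong simp: filter_empty_conv)
    then show ?thesis by simp
  next
    case False
    then have "filter (\<lambda>x. f k = f x) (filter (\<lambda>p. f p \<notin> A) ps) = filter (\<lambda>x. f k = f x) ps"
      "filter (\<lambda>x. f k = f x) (filter (\<lambda>p. f p \<in> A) ps) = []"
      by (auto intro!: filter_cong simp: filter_empty_conv)
    then show ?thesis by simp
  qed
qed fact

text \<open>\<open>A\<close> is the component of x: the part on \<open>A\<close> is connected, the
  part on the complement is unrestricted. Marking one point singles out one component, so no sum
  over set partitions arises.\<close>

lemma seq_count_split:
  assumes D: "finite D" and x: "x \<in> D"
  shows "seq_count D r \<alpha> = (\<Sum>A | A \<subseteq> D \<and> x \<in> A. \<Sum>q\<le>r. \<Sum>(\<beta>, \<gamma>) | \<beta> + \<gamma> = \<alpha>.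
    connected_count A q \<beta> * seq_count (D - A) (r - q) \<gamma>)"
proof -
  let ?I = "{A. A \<subseteq> D \<and> x \<in> A} \<times> {..r} \<times> {(\<beta>, \<gamma>). \<beta> + \<gamma> = \<alpha>}"
  define X where "X A q \<beta> = {ps \<in> mono_seqs A q. connected_seq A ps \<and> cycle_mset A (swap_prod ps) = \<beta>}" for A q \<beta>
  define Y where "Y A q \<beta> = {ps \<in> mono_seqs A q. cycle_mset A (swap_prod ps) = \<beta>}" for A q \<beta>
  define B where "B = (\<lambda>(A, q, \<beta>, \<gamma>). X A q \<beta> \<times> Y (D - A) (r - q) \<gamma>)"
  define comp where "comp ps = {y \<in> D. (x, y) \<in> linked ps}" for ps
  have finI: "finite ?I" using D by (intro finite_cartesian_product finite_mset_splits) auto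
  have finX: "finite (X A q \<beta>)" and finY: "finite (Y A q \<beta>)" if "finite A" for A q \<beta>
    using finite_mono_seqs[OF that] by (auto simp: X_def Y_def)
  have finB: "finite (B i)" if "i \<in> ?I" for i
    using that D finite_subset[of _ D] by (auto simp: B_def intro!: finite_cartesian_product finX finY)
  have bij: "bij_betw (\<lambda>(_, us, vs). sort_key snd (us @ vs)) (SIGMA i:?I. B i) (Y D r \<alpha>)"
  proof (rule bij_betw_byWitness[where f' = "\<lambda>ps. let A = comp ps; us = filter (\<lambda>p. snd p \<in> A) ps;
      vs = filter (\<lambda>p. snd p \<notin> A) ps in
      ((A, length us, cycle_mset A (swap_prod us), cycle_mset (D - A) (swap_prod vs)), us, vs)"])
    have fwd: "sort_key snd (us @ vs) \<in> Y D r \<alpha> \<and> comp (sort_key snd (us @ vs)) = A"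
      if "A \<subseteq> D" "x \<in> A" "q \<le> r" "\<beta> + \<gamma> = \<alpha>" "us \<in> X A q \<beta>" "vs \<in> Y (D - A) (r - q) \<gamma>" for A q \<beta> \<gamma> us vs
    proof -
      let ?ps = "sort_key snd (us @ vs)"
      have us: "us \<in> mono_seqs A q" "connected_seq A us" "cycle_mset A (swap_prod us) = \<beta>"
        and vs: "vs \<in> mono_seqs (D - A) (r - q)" "cycle_mset (D - A) (swap_prod vs) = \<gamma>"
        using that by (auto simp: X_def Y_def)
      note merge = merge_mono_seqs[OF us(1) vs(1)]
      have "A \<union> (D - A) = D" using that by blast
      then have ps: "?ps \<in> mono_seqs D r" using merge(1) that by auto
      have cl: "s \<in> A \<longleftrightarrow> t \<in> A" if "(s, t) \<in> set ?ps" for s t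
        using that mono_seqsD(4)[OF us(1), of s t] mono_seqsD(4)[OF vs(1), of s t] by auto
      have "cycle_mset D (swap_prod ?ps) = \<alpha>"
        using cycle_mset_swap_prod_split[OF D \<open>A \<subseteq> D\<close> mono_seqsD(2)[OF ps] cl] merge(2,3) us vs that by auto
      \<comment> \<open>No edge of the merged sequence leaves \<open>A\<close>, and
        \<open>us\<close> alone already connects it.\<close>
      moreover have "comp ?ps = A"
      proof
        show "comp ?ps \<subseteq> A"
        proof
          fix y assume "y \<in> comp ?ps"
          then have "(x, y) \<in> linked ?ps" by (simp add: comp_def)
          then show "y \<in> A" by (rule linked_closed[THEN conjunct1, OF _ \<open>x \<in> A\<close> cl])
        qed
        have "linked us \<subseteq> linked ?ps" by (rule linked_mono) simp
        then show "A \<subseteq> comp ?ps"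
          using us(2) that by (auto simp: comp_def connected_seq_def)
      qed
      ultimately show ?thesis using ps by (simp add: Y_def)
    qed
    show "(\<lambda>(_, us, vs). sort_key snd (us @ vs)) ` (SIGMA i:?I. B i) \<subseteq> Y D r \<alpha>"
      using fwd by (fastforce simp: B_def)
    show "\<forall>a\<in>SIGMA i:?I. B i. (let A = comp ((\<lambda>(_, us, vs). sort_key snd (us @ vs)) a);
        us = filter (\<lambda>p. snd p \<in> A) ((\<lambda>(_, us, vs). sort_key snd (us @ vs)) a);
        vs = filter (\<lambda>p. snd p \<notin> A) ((\<lambda>(_, us, vs). sort_key snd (us @ vs)) a) in
      ((A, length us, cycle_mset A (swap_prod us), cycle_mset (D - A) (swap_prod vs)), us, vs)) = a"
    proof
      fix a assume "a \<in> (SIGMA i:?I. B i)"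
      then obtain A q \<beta> \<gamma> us vs where a: "a = ((A, q, \<beta>, \<gamma>), us, vs)" "A \<subseteq> D" "x \<in> A" "q \<le> r" "\<beta> + \<gamma> = \<alpha>"
        "us \<in> X A q \<beta>" "vs \<in> Y (D - A) (r - q) \<gamma>"
        by (auto simp: B_def)
      then have us: "us \<in> mono_seqs A q" "cycle_mset A (swap_prod us) = \<beta>"
        and vs: "vs \<in> mono_seqs (D - A) (r - q)" "cycle_mset (D - A) (swap_prod vs) = \<gamma>"
        by (auto simp: X_def Y_def)
      have "comp (sort_key snd (us @ vs)) = A" using fwd a by blast
      then show "(let A = comp ((\<lambda>(_, us, vs). sort_key snd (us @ vs)) a);
        us = filter (\<lambda>p. snd p \<in> A) ((\<lambda>(_, us, vs). sort_key snd (us @ vs)) a);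
        vs = filter (\<lambda>p. snd p \<notin> A) ((\<lambda>(_, us, vs). sort_key snd (us @ vs)) a) in
      ((A, length us, cycle_mset A (swap_prod us), cycle_mset (D - A) (swap_prod vs)), us, vs)) = a"
        using merge_mono_seqs(2,3)[OF us(1) vs(1)] us vs mono_seqsD(1)[OF us(1)] by (simp add: a(1) Let_def)
    qed
    have bwd: "((comp ps, length (filter (\<lambda>p. snd p \<in> comp ps) ps), cycle_mset (comp ps) (swap_prod (filter (\<lambda>p. snd p \<in> comp ps) ps)),
        cycle_mset (D - comp ps) (swap_prod (filter (\<lambda>p. snd p \<notin> comp ps) ps))),
        filter (\<lambda>p. snd p \<in> comp ps) ps, filter (\<lambda>p. snd p \<notin> comp ps) ps) \<in> (SIGMA i:?I. B i)"
      if "ps \<in> Y D r \<alpha>" for ps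
    proof -
      let ?A = "comp ps"
      let ?us = "filter (\<lambda>p. snd p \<in> ?A) ps" and ?vs = "filter (\<lambda>p. snd p \<notin> ?A) ps"
      have ps: "ps \<in> mono_seqs D r" and \<alpha>: "cycle_mset D (swap_prod ps) = \<alpha>" using that by (auto simp: Y_def)
      have A: "?A \<subseteq> D" "x \<in> ?A" using x by (auto simp: comp_def)
      have cl: "s \<in> ?A \<longleftrightarrow> t \<in> ?A" if "(s, t) \<in> set ps" for s t
        using mono_seqsD(4)[OF ps that] linked_edge[OF that] linked_sym[OF linked_edge[OF that]]
          linked_trans[of x s ps t] linked_trans[of x t ps s]
        by (auto simp: comp_def)
      have len: "length ?us + length ?vs = r"
        using mono_seqsD(1)[OF ps] sum_length_filter_compl[of "\<lambda>p. snd p \<in> ?A" ps] by simp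
      have us: "?us \<in> mono_seqs ?A (length ?us)" and vs: "?vs \<in> mono_seqs (D - ?A) (r - length ?us)"
        using ps cl len mono_seqsD(4)[OF ps] by (fastforce simp: mono_seqs_def sorted_filter)+
      have "connected_seq ?A ?us"
        unfolding connected_seq_def
      proof (intro ballI)
        fix y z assume "y \<in> ?A" "z \<in> ?A"
        then have "(x, y) \<in> linked ps" "(x, z) \<in> linked ps" by (auto simp: comp_def)
        then have "(x, y) \<in> linked ?us" "(x, z) \<in> linked ?us"
          using linked_closed[OF _ A(2) cl] by blast+
        then show "(y, z) \<in> linked ?us" using linked_sym linked_trans by metis
      qed
      then show ?thesis
        using us vs A len cycle_mset_swap_prod_split[OF D A(1) mono_seqsD(2)[OF ps] cl] \<alpha>
        by (auto simp: B_def X_def Y_def)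
    qed
    then show "(\<lambda>ps. let A = comp ps; us = filter (\<lambda>p. snd p \<in> A) ps; vs = filter (\<lambda>p. snd p \<notin> A) ps in
      ((A, length us, cycle_mset A (swap_prod us), cycle_mset (D - A) (swap_prod vs)), us, vs)) ` Y D r \<alpha> \<subseteq> (SIGMA i:?I. B i)"
      unfolding Let_def by blast
    show "\<forall>ps\<in>Y D r \<alpha>. (\<lambda>(_, us, vs). sort_key snd (us @ vs)) (let A = comp ps; us = filter (\<lambda>p. snd p \<in> A) ps;
      vs = filter (\<lambda>p. snd p \<notin> A) ps in
      ((A, length us, cycle_mset A (swap_prod us), cycle_mset (D - A) (swap_prod vs)), us, vs)) = ps"
      using merge_filters[of snd] by (auto simp: Y_def Let_def mono_seqs_def)
  qed
  have "seq_count D r \<alpha> = card (Y D r \<alpha>)" by (simp add: seq_count_def Y_def)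
  also have "\<dots> = card (SIGMA i:?I. B i)" using bij_betw_same_card[OF bij] by simp
  also have "\<dots> = (\<Sum>i\<in>?I. card (B i))" using finI finB by (intro card_SigmaI) auto
  also have "\<dots> = (\<Sum>(A, q, \<beta>, \<gamma>)\<in>?I. connected_count A q \<beta> * seq_count (D - A) (r - q) \<gamma>)"
    by (intro sum.cong refl) (auto simp: B_def X_def Y_def connected_count_def seq_count_def card_cartesian_product)
  finally show ?thesis by (simp add: sum.cartesian_product case_prod_beta)
qed

section \<open>Relabelling by increasing bijections\<close>

lemma swap_prod_map:
  assumes "inj_on h D" "set ps \<subseteq> D \<times> D" "x \<in> D"
  shows "swap_prod (map (map_prod h h) ps) (h x) = h (swap_prod ps x) \<and> swap_prod ps x \<in> D"
  using assms(2)
proof (induction ps)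
  case (Cons p ps)
  obtain s t where p: "p = (s, t)" by (cases p)
  have st: "s \<in> D" "t \<in> D" using Cons.prems p by auto
  have "h (swap_prod ps x) = h s \<longleftrightarrow> swap_prod ps x = s" "h (swap_prod ps x) = h t \<longleftrightarrow> swap_prod ps x = t"
    using Cons st assms(1) by (auto simp: inj_on_eq_iff)
  then show ?case using Cons st by (auto simp: p transpose_def)
qed (use assms in simp)

lemma map_mono_seqs:
  assumes h: "strict_mono_on D h" "h ` D \<subseteq> D'" and ps: "ps \<in> mono_seqs D r"
  shows "map (map_prod h h) ps \<in> mono_seqs D' r"
proof -
  have "sorted_wrt (\<lambda>x y. h x \<le> h y) (map snd ps)"
  proof (rule sorted_wrt_mono_rel)
    fix x y assume xy: "x \<in> set (map snd ps)" "y \<in> set (map snd ps)" "x \<le> y"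
    then have "x \<in> D" "y \<in> D" using mono_seqsD(2)[OF ps] by auto
    then show "h x \<le> h y"
      using xy(3) strict_mono_onD[OF h(1), of x y] by (cases "x = y") auto
  qed (use mono_seqsD(3)[OF ps] in simp)
  then have "sorted (map h (map snd ps))" by (simp only: sorted_wrt_map)
  moreover have "map snd (map (map_prod h h) ps) = map h (map snd ps)" by simp
  ultimately have "sorted (map snd (map (map_prod h h) ps))" by (simp only:)
  moreover have "set (map (map_prod h h) ps) \<subseteq> {(s, t). s \<in> D' \<and> t \<in> D' \<and> s < t}"
    using mono_seqsD(4)[OF ps] h by (fastforce simp: strict_mono_on_def)
  ultimately show ?thesis using mono_seqsD(1)[OF ps] by (simp add: mono_seqs_def)
qed

lemma connected_seq_map:
  assumes "connected_seq D ps"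
  shows "connected_seq (h ` D) (map (map_prod h h) ps)"
proof -
  have "(h x, h y) \<in> linked (map (map_prod h h) ps)" if "(x, y) \<in> linked ps" for x y
    using that unfolding linked_def
  proof (induction rule: rtrancl_induct)
    case (step y z)
    then have "(h y, h z) \<in> set (map (map_prod h h) ps) \<union> (set (map (map_prod h h) ps))\<inverse>"
      by force
    with step.IH show ?case by (rule rtrancl.rtrancl_into_rtrancl)
  qed simp
  then show ?thesis using assms by (auto simp: connected_seq_def)
qed

text \<open>An increasing map preserves both s < t and sortedness, so it carries sequences to
  sequences injectively. The reverse inequality will come from its inverse, which is increasing as
  well.\<close>

lemma relabel_count_le:
  assumes h: "strict_mono_on D h" "h ` D = D'" and D: "finite D"
  shows "seq_count D r \<alpha> \<le> seq_count D' r \<alpha>" "connected_count D r \<alpha> \<le> connected_count D' r \<alpha>"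
proof -
  have inj: "inj_on h D" using h(1) by (rule strict_mono_on_imp_inj_on)
  have inj_map: "inj_on (map (map_prod h h)) (mono_seqs D r)"
  proof (rule inj_onI)
    fix ps qs assume "ps \<in> mono_seqs D r" "qs \<in> mono_seqs D r" "map (map_prod h h) ps = map (map_prod h h) qs"
    moreover have "inj_on (map_prod h h) (D \<times> D)" using inj by (auto simp: inj_on_def)
    moreover from calculation have "set ps \<union> set qs \<subseteq> D \<times> D"
      using mono_seqsD(2) by blast
    ultimately show "ps = qs"
      using inj_on_map_eq_map[of "map_prod h h" ps qs] inj_on_subset by blast
  qed
  have cyc: "cycle_mset D' (swap_prod (map (map_prod h h) ps)) = cycle_mset D (swap_prod ps)"
    if "ps \<in> mono_seqs D r" for ps
    using h inj D swap_prod_permutes[OF mono_seqsD(2)[OF that]] swap_prod_map[OF inj mono_seqsD(2)[OF that]]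
    by (intro cycle_mset_bij[of h]) (auto simp: bij_betw_def)
  have D': "finite D'" using h D by auto
  show "seq_count D r \<alpha> \<le> seq_count D' r \<alpha>"
    unfolding seq_count_def
  proof (rule card_inj_on_le)
    show "inj_on (map (map_prod h h)) {ps \<in> mono_seqs D r. cycle_mset D (swap_prod ps) = \<alpha>}"
      using inj_map by (rule inj_on_subset) auto
  qed (use cyc map_mono_seqs[OF h(1)] h(2) finite_mono_seqs[OF D'] in auto)
  show "connected_count D r \<alpha> \<le> connected_count D' r \<alpha>"
    unfolding connected_count_def
  proof (rule card_inj_on_le)
    show "inj_on (map (map_prod h h)) {ps \<in> mono_seqs D r. connected_seq D ps \<and> cycle_mset D (swap_prod ps) = \<alpha>}"
      using inj_map by (rule inj_on_subset) auto
  qed (use cyc map_mono_seqs[OF h(1)] h(2) connected_seq_map[of D _ h] finite_mono_seqs[OF D'] in auto)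
qed

lemma count_lessThan_card:
  assumes "finite D"
  shows "seq_count D r \<alpha> = seq_count {..<card D} r \<alpha>" "connected_count D r \<alpha> = connected_count {..<card D} r \<alpha>"
proof -
  obtain h where h: "bij_betw h {..<card D} D" "strict_mono_on {..<card D} h"
    using ex_bij_betw_strict_mono_card[OF assms] .
  let ?h = "inv_into {..<card D} h"
  have img: "h ` {..<card D} = D" "?h ` D = {..<card D}"
    using h(1) bij_betw_inv_into[OF h(1)] by (auto simp: bij_betw_def)
  have "strict_mono_on D ?h"
  proof (rule strict_mono_onI)
    fix x y assume "x \<in> D" "y \<in> D" "x < y"
    moreover from this have "h (?h x) = x" "h (?h y) = y" "?h x \<in> {..<card D}" "?h y \<in> {..<card D}"
      using h(1) img by (auto simp: bij_betw_inv_into_right)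
    ultimately show "?h x < ?h y"
      using h(2) by (metis linorder_neqE_nat order_less_asym strict_mono_onD)
  qed
  then show "seq_count D r \<alpha> = seq_count {..<card D} r \<alpha>" "connected_count D r \<alpha> = connected_count {..<card D} r \<alpha>"
    using relabel_count_le[OF h(2) img(1)] relabel_count_le[OF _ img(2) assms] by (simp_all add: le_antisym)
qed

lemma count_atLeastAtMost_card:
  assumes "finite D"
  shows "seq_count D r \<alpha> = seq_count {1..card D} r \<alpha>" "connected_count D r \<alpha> = connected_count {1..card D} r \<alpha>"
  using count_lessThan_card[OF assms] count_lessThan_card[of "{1..card D}"] by simp_all

lemma card_subsets_containing:
  assumes "finite D" "x \<in> D" "1 \<le> a"
  shows "card {A. A \<subseteq> D \<and> x \<in> A \<and> card A = a} = (card D - 1) choose (a - 1)"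
proof -
  have "bij_betw (insert x) {B. B \<subseteq> D - {x} \<and> card B = a - 1} {A. A \<subseteq> D \<and> x \<in> A \<and> card A = a}"
  proof (rule bij_betw_byWitness[where f' = "\<lambda>A. A - {x}"])
    show "insert x ` {B. B \<subseteq> D - {x} \<and> card B = a - 1} \<subseteq> {A. A \<subseteq> D \<and> x \<in> A \<and> card A = a}"
    proof clarify
      fix B assume B: "B \<subseteq> D - {x}" "card B = a - 1"
      then have "finite B" "x \<notin> B" using assms finite_subset by auto
      then show "insert x B \<subseteq> D \<and> x \<in> insert x B \<and> card (insert x B) = a"
        using B assms by auto
    qed
    show "(\<lambda>A. A - {x}) ` {A. A \<subseteq> D \<and> x \<in> A \<and> card A = a} \<subseteq> {B. B \<subseteq> D - {x} \<and> card B = a - 1}"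
      by auto
  qed auto
  then have "card {A. A \<subseteq> D \<and> x \<in> A \<and> card A = a} = card {B. B \<subseteq> D - {x} \<and> card B = a - 1}"
    by (rule bij_betw_same_card[symmetric])
  also have "\<dots> = card (D - {x}) choose (a - 1)" using assms by (intro n_subsets) auto
  finally show ?thesis using assms by simp
qed

text \<open>The marked point is d; the binomial coefficient chooses the other a - 1 letters of its
  component, and only sizes matter by relabelling.\<close>

lemma seq_count_split_by_size:
  assumes d: "1 \<le> d"
  shows "seq_count {1..d} r \<alpha> = (\<Sum>a\<in>{1..d}. ((d - 1) choose (a - 1)) *
    (\<Sum>q\<le>r. \<Sum>(\<beta>, \<gamma>) | \<beta> + \<gamma> = \<alpha>. connected_count {1..a} q \<beta> * seq_count {1..d - a} (r - q) \<gamma>))"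
proof -
  let ?D = "{1..d}"
  let ?S = "{A. A \<subseteq> ?D \<and> d \<in> A}"
  define G where "G a = (\<Sum>q\<le>r. \<Sum>(\<beta>, \<gamma>) | \<beta> + \<gamma> = \<alpha>. connected_count {1..a} q \<beta> * seq_count {1..d - a} (r - q) \<gamma>)" for a
  have dD: "d \<in> ?D" using d by simp
  have "seq_count ?D r \<alpha> = (\<Sum>A\<in>?S. G (card A))"
    unfolding seq_count_split[OF finite_atLeastAtMost dD] G_def
  proof (intro sum.cong refl)
    fix A q and p :: "nat multiset \<times> nat multiset" assume "A \<in> ?S"
    then have "finite A" "finite (?D - A)" "card (?D - A) = d - card A"
      by (auto simp: card_Diff_subset finite_subset[of A ?D])
    then show "(case p of (\<beta>, \<gamma>) \<Rightarrow> connected_count A q \<beta> * seq_count (?D - A) (r - q) \<gamma>)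
      = (case p of (\<beta>, \<gamma>) \<Rightarrow> connected_count {1..card A} q \<beta> * seq_count {1..d - card A} (r - q) \<gamma>)"
      using count_atLeastAtMost_card(2)[of A q "fst p"] count_atLeastAtMost_card(1)[of "?D - A" "r - q" "snd p"]
      by (simp only: case_prod_beta)
  qed
  also have "\<dots> = (\<Sum>a\<in>?D. \<Sum>A | A \<in> ?S \<and> card A = a. G (card A))"
  proof (rule sum.group[symmetric])
    have "1 \<le> card A \<and> card A \<le> d" if "A \<in> ?S" for A
      using that card_mono[of ?D A] finite_subset[of A ?D] by (auto simp: Suc_le_eq card_gt_0_iff)
    then show "card ` ?S \<subseteq> ?D" by auto
  qed auto
  also have "\<dots> = (\<Sum>a\<in>?D. ((d - 1) choose (a - 1)) * G a)"
  proof (intro sum.cong refl)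
    fix a assume a: "a \<in> ?D"
    have "(\<Sum>A | A \<in> ?S \<and> card A = a. G (card A)) = (\<Sum>A | A \<subseteq> ?D \<and> d \<in> A \<and> card A = a. G a)"
      by (rule sum.cong) auto
    then show "(\<Sum>A | A \<in> ?S \<and> card A = a. G (card A)) = ((d - 1) choose (a - 1)) * G a"
      using card_subsets_containing[OF _ dD, of a] a by simp
  qed
  finally show ?thesis by (simp add: G_def)
qed

section \<open>Translation into tuples of permutations\<close>

lemma inj_on_transpose_pair: "inj_on (\<lambda>(s, t). transpose s t) {(s, t). s < (t :: 'a :: linorder)}"
proof (rule inj_onI, clarify)
  fix s t s' t' :: 'a
  assume *: "s < t" "s' < t'" "transpose s t = transpose s' t'"
  have "{x. transpose u v x \<noteq> x} = {u, v}" if "u < v" for u v :: 'a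
    using that by (auto simp: transpose_def)
  from this[OF *(1)] this[OF *(2)] have "{s, t} = {s', t'}" using *(3) by simp
  then show "s = s' \<and> t = t'" using * by (auto simp: doubleton_eq_iff)
qed

lemma foldr_transpositions: "foldr (\<circ>) (map (\<lambda>(s, t). transpose s t) ps) id = swap_prod ps"
  by (induction ps) (auto simp: case_prod_beta fun_eq_iff)

lemma swap_prod_linked: "(x, swap_prod ps x) \<in> linked ps"
proof (induction ps)
  case (Cons p ps)
  obtain s t where p: "p = (s, t)" by (cases p)
  have "linked ps \<subseteq> linked (p # ps)" by (rule linked_mono) auto
  with Cons have "(x, swap_prod ps x) \<in> linked (p # ps)" by blast
  moreover have "(y, transpose s t y) \<in> linked (p # ps)" for y
    using linked_edge[of s t "p # ps"] linked_sym[of s t "p # ps"] by (auto simp: p transpose_def)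
  ultimately show ?case unfolding p by (simp, blast intro: linked_trans)
qed simp

text \<open>As \<sigma> is the inverse of the product of the transpositions, it moves points only
  within components and adds nothing to connectedness.\<close>

lemma transitive_iff_connected_seq:
  assumes ps: "ps \<in> mono_seqs {1..d} r"
  defines "\<sigma> \<equiv> inv' (swap_prod ps)" and "\<tau> \<equiv> map (\<lambda>(s, t). transpose s t) ps"
  shows "(\<forall>x\<in>{1..d}. \<forall>y\<in>{1..d}. \<exists>g\<in>generate (sym_group d) (insert \<sigma> (set \<tau>)). g x = y)
     \<longleftrightarrow> connected_seq {1..d} ps" (is "?L \<longleftrightarrow> ?R")
proof
  have P: "swap_prod ps permutes {1..d}" using ps by (intro swap_prod_permutes mono_seqsD(2))
  have \<sigma>: "\<sigma> permutes {1..d}" unfolding \<sigma>_def using P by (rule permutes_inv)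
  have trans: "transpose s t permutes {1..d}" if "(s, t) \<in> set ps" for s t
    using mono_seqsD(4)[OF ps that] by (intro permutes_swap_id) auto
  have tr_linked: "(x, transpose s t x) \<in> linked ps" if "(s, t) \<in> set ps" for s t x
    using linked_edge[OF that] linked_sym[OF linked_edge[OF that]] by (auto simp: transpose_def)
  {
    fix g assume "g \<in> generate (sym_group d) (insert \<sigma> (set \<tau>))"
    then have "(x, g x) \<in> linked ps" for x
    proof (induction arbitrary: x)
      case one
      then show ?case by (simp add: sym_group_def)
    next
      case (incl h)
      then show ?case
      proof
        assume "h = \<sigma>"
        then show ?thesis
          using swap_prod_linked[of "\<sigma> x" ps] permutes_inverses(1)[OF P, of x] linked_sym
          by (simp add: \<sigma>_def)
      qed (auto simp: \<tau>_def tr_linked)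
    next
      case (inv h)
      then show ?case
      proof
        assume "h = \<sigma>"
        then have "inv\<^bsub>sym_group d\<^esub> h = swap_prod ps"
          using \<sigma> permutes_inv_inv[OF P] by (simp add: \<sigma>_def sym_group_carrier)
        then show ?thesis by (simp add: swap_prod_linked)
      next
        assume "h \<in> set \<tau>"
        then obtain s t where st: "(s, t) \<in> set ps" "h = transpose s t" by (auto simp: \<tau>_def)
        then have "inv\<^bsub>sym_group d\<^esub> h = h" using trans[OF st(1)] by (simp add: sym_group_carrier)
        then show ?thesis using st tr_linked by simp
      qed
    next
      case (eng h1 h2)
      then show ?case unfolding sym_group_mult o_apply by (blast intro: linked_trans)
    qed
  }
  then show "?L \<Longrightarrow> ?R" unfolding connected_seq_def by metis
  \<comment> \<open>A path is turned into a group element edge by edge, one transposition for each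
    edge.\<close>
  have "\<exists>g\<in>generate (sym_group d) (insert \<sigma> (set \<tau>)). g x = y" if "(x, y) \<in> linked ps" for x y
    using that unfolding linked_def
  proof (induction rule: rtrancl_induct)
    case base
    show ?case
      by (rule bexI[of _ id]) (use generate.one[of "sym_group d"] in \<open>auto simp: sym_group_one\<close>)
  next
    case (step y z)
    then obtain g where g: "g \<in> generate (sym_group d) (insert \<sigma> (set \<tau>))" "g x = y" by blast
    have "transpose y z \<in> set \<tau>"
      using step(2) by (force simp: \<tau>_def transpose_commute image_iff)
    then have "transpose y z \<circ> g \<in> generate (sym_group d) (insert \<sigma> (set \<tau>))"
      using generate.eng[OF generate.incl g(1), of "transpose y z"] by (simp add: sym_group_mult)
    then show ?case using g by (intro bexI[of _ "transpose y z \<circ> g"]) auto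
  qed
  then show "?R \<Longrightarrow> ?L" unfolding connected_seq_def by blast
qed

lemma cycle_type_inv:
  assumes "g permutes {1..d}"
  shows "cycle_type d (inv' g) = cycle_mset {1..d} g"
proof -
  have "permutation g" using assms permutation_permutes by blast
  then show ?thesis by (simp add: cycle_type_def cycle_mset_def orbit_inv_eq)
qed

lemma monotone_transpositions_iff:
  "monotone_transpositions d \<tau> \<longleftrightarrow> (\<exists>ps \<in> mono_seqs {1..d} (length \<tau>). \<tau> = map (\<lambda>(s, t). transpose s t) ps)"
proof
  assume "monotone_transpositions d \<tau>"
  then obtain s t :: "nat \<Rightarrow> nat" where
    st: "\<And>i. i < length \<tau> \<Longrightarrow> 1 \<le> s i \<and> s i < t i \<and> t i \<le> d \<and> \<tau> ! i = transpose (s i) (t i)"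
    and mono: "\<And>i j. i \<le> j \<Longrightarrow> j < length \<tau> \<Longrightarrow> t i \<le> t j"
    unfolding monotone_transpositions_def by blast
  let ?ps = "map (\<lambda>i. (s i, t i)) [0..<length \<tau>]"
  have "set ?ps \<subseteq> {(s, t). s \<in> {1..d} \<and> t \<in> {1..d} \<and> s < t}" using st by fastforce
  moreover have "sorted (map snd ?ps)" using mono by (auto simp: sorted_iff_nth_mono)
  ultimately have "?ps \<in> mono_seqs {1..d} (length \<tau>)" by (simp add: mono_seqs_def)
  moreover have "\<tau> = map (\<lambda>(s, t). transpose s t) ?ps" by (rule nth_equalityI) (use st in auto)
  ultimately show "\<exists>ps \<in> mono_seqs {1..d} (length \<tau>). \<tau> = map (\<lambda>(s, t). transpose s t) ps" by blast
next
  assume "\<exists>ps \<in> mono_seqs {1..d} (length \<tau>). \<tau> = map (\<lambda>(s, t). transpose s t) ps"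
  then obtain ps where ps: "ps \<in> mono_seqs {1..d} (length \<tau>)" and \<tau>: "\<tau> = map (\<lambda>(s, t). transpose s t) ps"
    by blast
  show "monotone_transpositions d \<tau>"
    unfolding monotone_transpositions_def
  proof (rule exI[of _ "\<lambda>i. fst (ps ! i)"], rule exI[of _ "\<lambda>i. snd (ps ! i)"], intro conjI allI impI)
    fix i assume i: "i < length \<tau>"
    then have "(fst (ps ! i), snd (ps ! i)) \<in> set ps" using \<tau> by simp
    note * = mono_seqsD(4)[OF ps this]
    show "1 \<le> fst (ps ! i)" "fst (ps ! i) < snd (ps ! i)" "snd (ps ! i) \<le> d"
      "\<tau> ! i = transpose (fst (ps ! i)) (snd (ps ! i))"
      using * i by (auto simp: \<tau> case_prod_beta)
  next
    fix i j assume "i \<le> j \<and> j < length \<tau>"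
    then show "snd (ps ! i) \<le> snd (ps ! j)"
      using mono_seqsD(3)[OF ps] \<tau> by (auto simp: sorted_iff_nth_mono)
  qed
qed

text \<open>The product relation determines \<sigma> as the inverse of \<open>swap_prod ps\<close>,
  and inversion preserves the cycle type, so tuples correspond to connected sequences.\<close>

lemma monotone_hurwitz_eq_connected_count:
  "monotone_hurwitz r \<alpha> = connected_count {1..sum_mset \<alpha>} r \<alpha>"
proof -
  let ?d = "sum_mset \<alpha>"
  let ?S = "{ps \<in> mono_seqs {1..?d} r. connected_seq {1..?d} ps \<and> cycle_mset {1..?d} (swap_prod ps) = \<alpha>}"
  let ?tr = "map (\<lambda>(s, t). transpose s t) :: (nat \<times> nat) list \<Rightarrow> _"
  let ?f = "\<lambda>ps. (inv' (swap_prod ps), ?tr ps)"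
  have perm: "swap_prod ps permutes {1..?d}" if "ps \<in> mono_seqs {1..?d} r" for ps
    using that by (intro swap_prod_permutes mono_seqsD(2))
  have inj: "inj_on ?f ?S"
  proof (rule inj_onI)
    fix ps qs assume "ps \<in> ?S" "qs \<in> ?S" "?f ps = ?f qs"
    then show "ps = qs"
      by (intro inj_on_map_eq_map[THEN iffD1, of "\<lambda>(s, t). transpose s t" ps qs] inj_on_subset[OF inj_on_transpose_pair])
        (auto simp: mono_seqs_def)
  qed
  have "monotone_factorizations ?d r \<alpha> = ?f ` ?S"
  proof (intro equalityI subsetI)
    fix x assume "x \<in> monotone_factorizations ?d r \<alpha>"
    then obtain \<sigma> \<tau> where x: "x = (\<sigma>, \<tau>)" and \<sigma>: "\<sigma> permutes {1..?d}" "cycle_type ?d \<sigma> = \<alpha>"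
      and \<tau>: "length \<tau> = r" "monotone_transpositions ?d \<tau>" and prod: "\<sigma> \<circ> foldr (\<circ>) \<tau> id = id"
      and trans: "\<forall>x\<in>{1..?d}. \<forall>y\<in>{1..?d}. \<exists>g\<in>generate (sym_group ?d) (insert \<sigma> (set \<tau>)). g x = y"
      by (auto simp: monotone_factorizations_def simp del: atLeastAtMost_iff)
    from \<tau> obtain ps where ps: "ps \<in> mono_seqs {1..?d} r" "\<tau> = ?tr ps"
      unfolding monotone_transpositions_iff by blast
    have "\<sigma> = \<sigma> \<circ> swap_prod ps \<circ> inv' (swap_prod ps)"
      using permutes_inv_o(1)[OF perm[OF ps(1)]] by (simp add: comp_assoc)
    then have \<sigma>_eq: "\<sigma> = inv' (swap_prod ps)" using prod by (simp add: ps(2) foldr_transpositions)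
    have "ps \<in> ?S"
      using trans \<sigma>(2) ps(1) transitive_iff_connected_seq[OF ps(1)] cycle_type_inv[OF perm[OF ps(1)]]
      unfolding \<sigma>_eq ps(2) by simp
    then show "x \<in> ?f ` ?S" using x \<sigma>_eq ps(2) by blast
  next
    fix x assume "x \<in> ?f ` ?S"
    then obtain ps where ps: "ps \<in> ?S" "x = ?f ps" by blast
    then have ps1: "ps \<in> mono_seqs {1..?d} r" by blast
    have "monotone_transpositions ?d (?tr ps)"
      unfolding monotone_transpositions_iff using ps1 mono_seqsD(1)[OF ps1] by auto
    moreover have "inv' (swap_prod ps) \<circ> foldr (\<circ>) (?tr ps) id = id"
      unfolding foldr_transpositions by (rule permutes_inv_o(2)[OF perm[OF ps1]])
    ultimately show "x \<in> monotone_factorizations ?d r \<alpha>"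
      using ps permutes_inv[OF perm[OF ps1]] cycle_type_inv[OF perm[OF ps1]] mono_seqsD(1)[OF ps1]
        transitive_iff_connected_seq[OF ps1]
      unfolding monotone_factorizations_def by simp
  qed
  then show ?thesis
    unfolding monotone_hurwitz_def connected_count_def using card_image[OF inj] by simp
qed

lemma connected_count_nonzero:
  assumes "connected_count {1..d} r \<alpha> \<noteq> 0"
  shows "\<alpha> \<in> partitions_of d"
proof -
  from assms obtain ps where "ps \<in> mono_seqs {1..d} r" "cycle_mset {1..d} (swap_prod ps) = \<alpha>"
    unfolding connected_count_def by (metis (mono_tags, lifting) card.empty empty_Collect_eq)
  moreover from this have "swap_prod ps permutes {1..d}" by (intro swap_prod_permutes mono_seqsD(2))
  ultimately show ?thesis
    using sum_mset_cycle_mset_card[of "{1..d}" "swap_prod ps"] by (auto simp: partitions_of_def)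
qed

section \<open>Power series\<close>

lemma mfps_nth_deriv: "mfps_nth (mfps_deriv v f) m = of_nat (Suc (count m v)) * mfps_nth f (add_mset v m)"
  by (simp add: mfps_deriv_def)

lemma mfps_nth_const_mult:
  fixes g :: "('v, 'a :: comm_ring_1) mfps"
  shows "mfps_nth (mfps_const c * g) m = c * mfps_nth g m"
proof -
  have "mfps_nth (mfps_const c * g) m = (\<Sum>(k, l)\<in>{({#} :: 'v multiset, m)}. mfps_nth (mfps_const c) k * mfps_nth g l)"
    unfolding mfps_nth_mult
    by (rule sum.mono_neutral_right) (auto simp: mfps_const_def split: if_splits)
  then show ?thesis by (simp add: mfps_const_def)
qed

lemma mfps_nth_of_nat_mult:
  fixes g :: "('v, 'a :: comm_ring_1) mfps"
  shows "mfps_nth (of_nat n * g) m = of_nat n * mfps_nth g m"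
  by (induction n) (simp_all add: distrib_right)

lemma mfps_nth_sum:
  fixes f :: "'i \<Rightarrow> ('v, 'a :: comm_ring_1) mfps"
  shows "mfps_nth (sum f A) m = (\<Sum>i\<in>A. mfps_nth (f i) m)"
  by (induction A rule: infinite_finite_induct) simp_all

lemma mfps_nth_X_power_mult_eq:
  fixes g :: "('v, 'a :: comm_ring_1) mfps"
  shows "mfps_nth (mfps_X v ^ n * g) m =
    (if n \<le> count m v then mfps_nth g (m - replicate_mset n v) else 0)"
proof (induction n arbitrary: m)
  case (Suc n)
  have "m - {#v#} - replicate_mset n v = m - replicate_mset (Suc n) v" by simp
  then show ?case using Suc
    by (auto simp: mult.assoc mfps_nth_X_mult count_greater_zero_iff[symmetric] simp del: count_greater_zero_iff replicate_mset_Suc)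
qed simp

lemma mfps_nth_prod_X:
  "mfps_nth (\<Prod>i\<in>#\<alpha>. mfps_X (f i) :: ('v, 'a :: comm_ring_1) mfps) m = (if m = image_mset f \<alpha> then 1 else 0)"
proof (induction \<alpha> arbitrary: m)
  case (add i \<alpha>)
  have "m = add_mset (f i) (image_mset f \<alpha>) \<longleftrightarrow> f i \<in># m \<and> m - {#f i#} = image_mset f \<alpha>"
    by (metis add_mset_remove_trivial insert_DiffM union_single_eq_member)
  then show ?case using add by (simp add: mfps_nth_X_mult)
qed (simp add: mfps_nth_one)

lemma mfps_nth_mfps_sum:
  assumes "finite B" "B \<subseteq> A" "\<And>i. i \<in> A - B \<Longrightarrow> mfps_nth (f i) m = 0"
  shows "mfps_nth (mfps_sum f A) m = (\<Sum>i\<in>B. mfps_nth (f i) m)"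
  unfolding mfps_sum_def mfps_nth_Abs
  by (rule sum.mono_neutral_left) (use assms in auto)

lemma mfps_sum_cong: "(\<And>i. i \<in> A \<Longrightarrow> f i = g i) \<Longrightarrow> mfps_sum f A = mfps_sum g A"
  unfolding mfps_sum_def by (intro arg_cong[of _ _ Abs_mfps] ext sum.cong) auto

lemma mfps_sum_mult_right:
  fixes f :: "'i \<Rightarrow> ('v, 'a :: comm_ring_1) mfps"
  assumes "mfps_summable f A"
  shows "mfps_sum f A * g = mfps_sum (\<lambda>i. f i * g) A"
proof (rule mfps_ext)
  fix m
  \<comment> \<open>Only divisors of m enter the coefficient of a product at m; \<open>B\<close>
    collects the indices contributing to any of these finitely many monomials.\<close>
  define B where "B = (\<Union>k\<in>{k. k \<subseteq># m}. {i \<in> A. mfps_nth (f i) k \<noteq> 0})"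
  have B: "finite B" "B \<subseteq> A"
    using assms finite_submultisets[of m] by (auto simp: B_def mfps_summable_def)
  have zero: "mfps_nth (f i) k = 0" if "i \<in> A - B" "k + l = m" for i k l
    using that by (auto simp: B_def)
  have "mfps_nth (mfps_sum f A * g) m = (\<Sum>(k, l) | k + l = m. (\<Sum>i\<in>B. mfps_nth (f i) k) * mfps_nth g l)"
    unfolding mfps_nth_mult
    by (intro sum.cong refl) (use B zero in \<open>auto intro!: arg_cong2[of _ _ _ _ "(*)"] mfps_nth_mfps_sum\<close>)
  also have "\<dots> = (\<Sum>i\<in>B. mfps_nth (f i * g) m)"
    unfolding mfps_nth_mult by (simp add: sum_distrib_right case_prod_beta) (rule sum.swap)
  also have "\<dots> = mfps_nth (mfps_sum (\<lambda>i. f i * g) A) m"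
  proof (rule mfps_nth_mfps_sum[OF B, symmetric])
    fix i assume "i \<in> A - B"
    then show "mfps_nth (f i * g) m = 0"
      unfolding mfps_nth_mult by (intro sum.neutral) (auto simp: zero)
  qed
  finally show "mfps_nth (mfps_sum f A * g) m = mfps_nth (mfps_sum (\<lambda>i. f i * g) A) m" .
qed

lemma mfps_deriv_diff: "mfps_deriv v (f - g :: ('v, 'a :: comm_ring_1) mfps) = mfps_deriv v f - mfps_deriv v g"
  by (rule mfps_ext) (simp only: mfps_nth_deriv mfps_nth_diff right_diff_distrib)

text \<open>The exponent of v in k + l is the sum of the two exponents. This splits the coefficient
  into two sums, and in each of them one v is removed from one factor.\<close>

lemma mfps_deriv_mult:
  fixes f g :: "('v, 'a :: comm_ring_1) mfps"
  shows "mfps_deriv v (f * g) = mfps_deriv v f * g + f * mfps_deriv v g"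
proof (rule mfps_ext)
  fix m
  define S where "S m = {(k, l). k + l = m}" for m :: "'v multiset"
  have fin: "finite (S m)" for m by (simp add: S_def)
  let ?m = "add_mset v m"
  have left: "(\<Sum>(k, l)\<in>S ?m. of_nat (count k v) * mfps_nth f k * mfps_nth g l)
     = (\<Sum>(k, l)\<in>S m. mfps_nth (mfps_deriv v f) k * mfps_nth g l)" for f g :: "('v, 'a) mfps"
  proof -
    have "(\<Sum>(k, l)\<in>S ?m. of_nat (count k v) * mfps_nth f k * mfps_nth g l)
      = (\<Sum>(k, l)\<in>{(k, l) \<in> S ?m. v \<in># k}. of_nat (count k v) * mfps_nth f k * mfps_nth g l)"
      by (rule sum.mono_neutral_right) (auto simp: fin, metis count_eq_zero_iff mult_zero_left of_nat_0)
    also have "\<dots> = (\<Sum>(k, l)\<in>S m. mfps_nth (mfps_deriv v f) k * mfps_nth g l)"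
      by (rule sum.reindex_bij_witness[where i = "\<lambda>(k, l). (add_mset v k, l)" and j = "\<lambda>(k, l). (k - {#v#}, l)"])
        (auto simp: S_def mfps_nth_deriv dest!: multi_member_split)
    finally show ?thesis .
  qed
  have right: "(\<Sum>(k, l)\<in>S ?m. of_nat (count l v) * mfps_nth f k * mfps_nth g l)
     = (\<Sum>(k, l)\<in>S m. mfps_nth f k * mfps_nth (mfps_deriv v g) l)"
  proof -
    have "(\<Sum>(k, l)\<in>S ?m. of_nat (count l v) * mfps_nth f k * mfps_nth g l)
      = (\<Sum>(k, l)\<in>S ?m. of_nat (count k v) * mfps_nth g k * mfps_nth f l)"
      by (rule sum.reindex_bij_witness[where i = prod.swap and j = prod.swap]) (auto simp: S_def add.commute mult_ac)
    also have "\<dots> = (\<Sum>(k, l)\<in>S m. mfps_nth (mfps_deriv v g) k * mfps_nth f l)" by (rule left)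
    also have "\<dots> = (\<Sum>(k, l)\<in>S m. mfps_nth f k * mfps_nth (mfps_deriv v g) l)"
      by (rule sum.reindex_bij_witness[where i = prod.swap and j = prod.swap]) (auto simp: S_def add.commute mult_ac)
    finally show ?thesis .
  qed
  have "mfps_nth (mfps_deriv v (f * g)) m = (\<Sum>(k, l)\<in>S ?m. of_nat (count ?m v) * (mfps_nth f k * mfps_nth g l))"
    by (simp add: S_def mfps_nth_deriv mfps_nth_mult sum_distrib_left case_prod_beta)
  also have "\<dots> = (\<Sum>(k, l)\<in>S ?m. of_nat (count k v) * mfps_nth f k * mfps_nth g l + of_nat (count l v) * mfps_nth f k * mfps_nth g l)"
  proof (intro sum.cong refl, clarify)
    fix k l assume "(k, l) \<in> S ?m"
    then have "k + l = ?m" by (simp add: S_def)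
    then have "count ?m v = count k v + count l v" by (metis count_union)
    then show "of_nat (count ?m v) * (mfps_nth f k * mfps_nth g l) =
      of_nat (count k v) * mfps_nth f k * mfps_nth g l + of_nat (count l v) * mfps_nth f k * mfps_nth g l"
      by (simp only: of_nat_add) (simp add: algebra_simps)
  qed
  also have "\<dots> = mfps_nth (mfps_deriv v f * g + f * mfps_deriv v g) m"
    unfolding case_prod_beta sum.distrib left[unfolded case_prod_beta] right[unfolded case_prod_beta]
    by (simp only: mfps_nth_add mfps_nth_mult S_def case_prod_unfold)
  finally show "mfps_nth (mfps_deriv v (f * g)) m = mfps_nth (mfps_deriv v f * g + f * mfps_deriv v g) m" .
qed

lemma mfps_nth_X_mult_deriv:
  fixes f :: "('v, 'a :: comm_ring_1) mfps"
  shows "mfps_nth (mfps_X v * mfps_deriv v f) m = of_nat (count m v) * mfps_nth f m"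
  by (auto simp: mfps_nth_X_mult mfps_nth_deriv not_in_iff dest!: multi_member_split)

lemma mfps_deriv_X_mult_deriv:
  fixes f :: "('v, 'a :: comm_ring_1) mfps"
  assumes "u \<noteq> v"
  shows "mfps_deriv u (mfps_X v * mfps_deriv v f) = mfps_X v * mfps_deriv v (mfps_deriv u f)"
  by (rule mfps_ext) (use assms in \<open>simp add: mfps_nth_deriv mfps_nth_X_mult_deriv\<close>)

text \<open>The left side multiplies a coefficient by its exponent of v, while h has no v-free term,
  so h g at exponent n involves g only at exponents below n. Induction on this exponent gives
  0.\<close>

lemma euler_equation_zero:
  fixes g h :: "('v, 'a :: {idom, ring_char_0}) mfps"
  assumes eq: "mfps_X v * mfps_deriv v g = h * g"
    and h: "\<And>m. v \<notin># m \<Longrightarrow> mfps_nth h m = 0" and g: "\<And>m. v \<notin># m \<Longrightarrow> mfps_nth g m = 0"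
  shows "g = 0"
proof -
  have "mfps_nth g m = 0" for m
  proof (induction "count m v" arbitrary: m rule: less_induct)
    case less
    show ?case
    proof (cases "v \<in># m")
      case True
      have "mfps_nth (h * g) m = 0"
        unfolding mfps_nth_mult
      proof (rule sum.neutral, clarify)
        fix k l assume "m = k + l"
        show "mfps_nth h k * mfps_nth g l = 0"
        proof (cases "v \<in># k")
          case True
          then have "count l v < count (k + l) v" by simp
          then show ?thesis using less[of l] \<open>m = k + l\<close> by simp
        qed (simp add: h)
      qed
      then have "of_nat (count m v) * mfps_nth g m = 0"
        by (simp only: eq[symmetric] mfps_nth_X_mult_deriv)
      then show ?thesis using True by (simp add: count_eq_zero_iff)
    qed (rule g)
  qed
  then show ?thesis by (intro mfps_ext) simp
qed

section \<open>Monomials as triples of a z-exponent, a t-exponent and a partition\<close>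

text \<open>\<open>Var_p k\<close> has index k + 2 and stands for p_{k+1}: the bound 2 drops z and
  t, and subtracting 1 yields the mathematical index.\<close>

definition parts :: "indet multiset \<Rightarrow> nat multiset" where
  "parts m = image_mset (\<lambda>v. indet_index v - 1) (filter_mset (\<lambda>v. 2 \<le> indet_index v) m)"

definition monom :: "nat \<Rightarrow> nat \<Rightarrow> nat multiset \<Rightarrow> indet multiset" where
  "monom d r \<alpha> = replicate_mset d Var_z + replicate_mset r Var_t + image_mset p_var \<alpha>"

lemma parts_simps [simp]:
  "parts {#} = {#}"
  "parts (add_mset Var_z m) = parts m"
  "parts (add_mset Var_t m) = parts m"
  "parts (add_mset (Var_p k) m) = add_mset (Suc k) (parts m)"
  "parts (k' + l) = parts k' + parts l"
  by (simp_all add: parts_def)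

lemma p_var_neq [simp]: "p_var i \<noteq> Var_z" "p_var i \<noteq> Var_t" "Var_z \<noteq> p_var i" "Var_t \<noteq> p_var i"
  by (simp_all add: p_var_def)

lemma parts_add_p_var: "1 \<le> i \<Longrightarrow> parts (add_mset (p_var i) m) = add_mset i (parts m)"
  by (simp add: p_var_def)

lemma zero_notin_parts: "0 \<notin># parts m"
  by (auto simp: parts_def)

lemma count_parts: "1 \<le> i \<Longrightarrow> count (parts m) i = count m (p_var i)"
proof (induction m)
  case (add v m)
  then show ?case by (cases v) (auto simp: p_var_def)
qed simp

lemma mem_parts: "1 \<le> i \<Longrightarrow> p_var i \<in># m \<longleftrightarrow> i \<in># parts m"
  by (metis count_parts count_eq_zero_iff)

lemma parts_diff_p_var: "1 \<le> i \<Longrightarrow> parts (m - {#p_var i#}) = parts m - {#i#}"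
  by (metis add_mset_remove_trivial diff_single_trivial insert_DiffM mem_parts parts_add_p_var)

lemma parts_diff_zt: "parts (m - replicate_mset n Var_z) = parts m" "parts (m - replicate_mset n Var_t) = parts m"
proof -
  have z: "parts (m - {#Var_z#}) = parts m" and t: "parts (m - {#Var_t#}) = parts m" for m
    by (metis diff_single_trivial insert_DiffM parts_simps(2,3))+
  have Suc: "m - replicate_mset (Suc n) v = m - replicate_mset n v - {#v#}" for n and v :: indet and m
    by simp
  show "parts (m - replicate_mset n Var_z) = parts m"
    by (induction n) (simp, simp only: Suc z)
  show "parts (m - replicate_mset n Var_t) = parts m"
    by (induction n) (simp, simp only: Suc t)
qed

lemma monom_parts [simp]: "monom (count m Var_z) (count m Var_t) (parts m) = m"
proof (induction m)
  case (add v m)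
  then show ?case by (cases v) (auto simp: monom_def p_var_def)
qed (simp add: monom_def)

text \<open>A part 0 has to be excluded because \<open>p_var 0\<close> and \<open>p_var 1\<close>
  are the same indeterminate.\<close>

lemma parts_monom [simp]: "0 \<notin># \<alpha> \<Longrightarrow> parts (monom d r \<alpha>) = \<alpha>"
proof -
  assume "0 \<notin># \<alpha>"
  then have "parts (image_mset p_var \<alpha>) = \<alpha>"
    by (induction \<alpha>) (auto simp: parts_add_p_var Suc_le_eq)
  moreover have "parts (replicate_mset d Var_z) = {#}" "parts (replicate_mset r Var_t) = {#}"
    by (induction d, simp_all) (induction r, simp_all)
  ultimately show ?thesis by (simp add: monom_def)
qed

lemma count_monom [simp]: "count (monom d r \<alpha>) Var_z = d" "count (monom d r \<alpha>) Var_t = r"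
  by (auto simp: monom_def count_image_mset)

lemma monom_add: "monom d r \<alpha> + monom e s \<beta> = monom (d + e) (r + s) (\<alpha> + \<beta>)"
  by (simp add: monom_def multiset_eq_iff)

definition series_of :: "(nat \<Rightarrow> nat \<Rightarrow> nat multiset \<Rightarrow> rat) \<Rightarrow> series" where
  "series_of c = Abs_mfps (\<lambda>m. c (count m Var_z) (count m Var_t) (parts m))"

lemma mfps_nth_series_of: "mfps_nth (series_of c) m = c (count m Var_z) (count m Var_t) (parts m)"
  by (simp add: series_of_def)

lemma mfps_nth_series_of_mult:
  assumes "count m Var_z = d" "count m Var_t = r" "parts m = \<alpha>"
  shows "mfps_nth (series_of b * series_of c) m
    = (\<Sum>a\<le>d. \<Sum>q\<le>r. \<Sum>(\<beta>, \<gamma>) | \<beta> + \<gamma> = \<alpha>. b a q \<beta> * c (d - a) (r - q) \<gamma>)"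
proof -
  have "mfps_nth (series_of b * series_of c) m
    = (\<Sum>(a, q, \<beta>, \<gamma>)\<in>{..d} \<times> {..r} \<times> {(\<beta>, \<gamma>). \<beta> + \<gamma> = \<alpha>}. b a q \<beta> * c (d - a) (r - q) \<gamma>)"
    unfolding mfps_nth_mult
  proof (rule sum.reindex_bij_witness[where
      i = "\<lambda>(a, q, \<beta>, \<gamma>). (monom a q \<beta>, monom (d - a) (r - q) \<gamma>)" and
      j = "\<lambda>(k, l). (count k Var_z, count k Var_t, parts k, parts l)"], goal_cases)
    case (1 x)
    then obtain k l where x: "x = (k, l)" "m = k + l" by auto
    then have "d - count k Var_z = count l Var_z" "r - count k Var_t = count l Var_t" using assms by auto
    then show ?case using x by simp
  next
    case (2 x)
    then show ?case using assms by auto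
  next
    case (3 x)
    then obtain a q \<beta> \<gamma> where x: "x = (a, q, \<beta>, \<gamma>)" "\<beta> + \<gamma> = \<alpha>" by auto
    then have "0 \<notin># \<beta>" "0 \<notin># \<gamma>" using zero_notin_parts[of m] assms by auto
    then show ?case using x by simp
  next
    case (4 x)
    then obtain a q \<beta> \<gamma> where x: "x = (a, q, \<beta>, \<gamma>)" "\<beta> + \<gamma> = \<alpha>" "a \<le> d" "q \<le> r" by auto
    then have "monom a q \<beta> + monom (d - a) (r - q) \<gamma> = m"
      using monom_parts[of m] by (simp add: monom_add assms)
    then show ?case using x by simp
  next
    case (5 x)
    then obtain k l where x: "x = (k, l)" "m = k + l" by auto
    then have "d - count k Var_z = count l Var_z" "r - count k Var_t = count l Var_t" using assms by auto
    then show ?case using x by (simp add: mfps_nth_series_of)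
  qed
  then show ?thesis by (simp add: sum.cartesian_product case_prod_beta)
qed

section \<open>The series of all sequences and its relation to the connected ones\<close>

text \<open>This is \<open>Z\<close>. Unlike the Hurwitz series it includes d = 0, which gives it
  the constant term 1.\<close>

definition all_series :: series where
  "all_series = series_of (\<lambda>d r \<alpha>. of_nat (seq_count {1..d} r \<alpha>) / fact d)"

text \<open>At each monomial at most one choice of d, r and \<alpha> contributes to the nested sums.
  That \<alpha> be a partition of d need not be demanded on the right, since the connected count
  vanishes otherwise.\<close>

lemma monotone_hurwitz_series_eq:
  "monotone_hurwitz_series = series_of (\<lambda>d r \<alpha>. if d = 0 then 0 else of_nat (connected_count {1..d} r \<alpha>) / fact d)"
proof (rule mfps_ext)
  fix m
  define P where "P d r = (\<Sum>\<alpha>\<in>partitions_of d. of_nat (monotone_hurwitz r \<alpha>) * (\<Prod>i\<in>#\<alpha>. p_ser i))" for d r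
  define G where "G d = mfps_sum (\<lambda>r. t_ser ^ r * P d r) UNIV" for d
  have image_p_var: "k = image_mset p_var \<alpha> \<longleftrightarrow> count k Var_z = 0 \<and> count k Var_t = 0 \<and> parts k = \<alpha>"
    if "0 \<notin># \<alpha>" for k \<alpha>
    using monom_parts[of k] parts_monom[OF that, of 0 0] by (auto simp: monom_def count_image_mset)
  have P: "mfps_nth (P d r) k = (if count k Var_z = 0 \<and> count k Var_t = 0 \<and> parts k \<in> partitions_of d
      then of_nat (monotone_hurwitz r (parts k)) else 0)" for d r k
  proof -
    have "mfps_nth (P d r) k = (\<Sum>\<alpha>\<in>partitions_of d. if parts k = \<alpha> then
        (if count k Var_z = 0 \<and> count k Var_t = 0 then of_nat (monotone_hurwitz r \<alpha>) else 0) else 0)"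
      unfolding P_def mfps_nth_sum
      by (intro sum.cong refl)
        (auto simp: mfps_nth_of_nat_mult mfps_nth_prod_X image_p_var partitions_of_def count_eq_zero_iff)
    then show ?thesis using finite_partitions_of by (auto simp: count_eq_zero_iff)
  qed
  have G: "mfps_nth (G d) k = mfps_nth (P d (count k Var_t)) (k - replicate_mset (count k Var_t) Var_t)" for d k
  proof -
    have "mfps_nth (G d) k = (\<Sum>r\<in>{count k Var_t}. mfps_nth (t_ser ^ r * P d r) k)"
      unfolding G_def by (rule mfps_nth_mfps_sum) (auto simp: mfps_nth_X_power_mult_eq P)
    then show ?thesis by (simp add: mfps_nth_X_power_mult_eq)
  qed
  have summand: "mfps_nth (mfps_const (1 / fact d) * z_ser ^ d * G d) k =
      (if d = count k Var_z \<and> parts k \<in> partitions_of d then of_nat (monotone_hurwitz (count k Var_t) (parts k)) / fact d else 0)" for d k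
    by (auto simp: mult.assoc mfps_nth_const_mult mfps_nth_X_power_mult_eq G P parts_diff_zt simp del: diff_diff_add_mset)
  have "mfps_nth monotone_hurwitz_series m
      = (\<Sum>d\<in>{1..} \<inter> {count m Var_z}. mfps_nth (mfps_const (1 / fact d) * z_ser ^ d * G d) m)"
    unfolding monotone_hurwitz_series_def P_def[symmetric] G_def[symmetric]
    by (rule mfps_nth_mfps_sum) (auto simp: summand)
  also have "\<dots> = (if count m Var_z = 0 then 0 else
      of_nat (connected_count {1..count m Var_z} (count m Var_t) (parts m)) / fact (count m Var_z))"
  proof (cases "count m Var_z")
    case (Suc n)
    have "connected_count {1..Suc n} (count m Var_t) (parts m) = 0" if "parts m \<notin> partitions_of (Suc n)"
      using that connected_count_nonzero by blast
    moreover have "sum_mset (parts m) = Suc n" if "parts m \<in> partitions_of (Suc n)"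
      using that by (simp add: partitions_of_def)
    moreover have Int: "{1..} \<inter> {Suc n} = {Suc n}" by auto
    ultimately show ?thesis unfolding Suc Int summand monotone_hurwitz_eq_connected_count by simp
  qed simp
  finally show "mfps_nth monotone_hurwitz_series m = mfps_nth (series_of (\<lambda>d r \<alpha>. if d = 0 then 0
      else of_nat (connected_count {1..d} r \<alpha>) / fact d)) m"
    by (simp add: mfps_nth_series_of)
qed

lemma mfps_nth_monotone_hurwitz_series_0:
  "Var_z \<notin># m \<Longrightarrow> mfps_nth monotone_hurwitz_series m = 0"
  by (simp add: monotone_hurwitz_series_eq mfps_nth_series_of not_in_iff)

lemma z_D_z_series_of: "z_ser * D_z (series_of c) = series_of (\<lambda>d r \<alpha>. of_nat d * c d r \<alpha>)"
  by (rule mfps_ext) (simp add: mfps_nth_X_mult_deriv mfps_nth_series_of)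

lemma all_series_connected:
  "z_ser * D_z all_series = z_ser * D_z monotone_hurwitz_series * all_series"
proof (rule mfps_ext)
  fix m
  define d r \<alpha> where m: "d = count m Var_z" "r = count m Var_t" "\<alpha> = parts m"
  define C where "C a q \<beta> = (if a = 0 then 0 else of_nat (connected_count {1..a} q \<beta>) / fact a :: rat)" for a q \<beta>
  define S where "S a = (\<Sum>q\<le>r. \<Sum>(\<beta>, \<gamma>) | \<beta> + \<gamma> = \<alpha>.
      of_nat (connected_count {1..a} q \<beta> * seq_count {1..d - a} (r - q) \<gamma>) :: rat)" for a
  have summand: "(\<Sum>q\<le>r. \<Sum>(\<beta>, \<gamma>) | \<beta> + \<gamma> = \<alpha>. of_nat a * C a q \<beta> * (of_nat (seq_count {1..d - a} (r - q) \<gamma>) / fact (d - a)))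
     = (if a = 0 then 0 else of_nat a / (fact a * fact (d - a)) * S a)" for a
    by (cases "a = 0") (auto simp: C_def S_def sum_distrib_left case_prod_beta intro!: sum.cong)
  have "mfps_nth (z_ser * D_z monotone_hurwitz_series * all_series) m
    = (\<Sum>a\<le>d. if a = 0 then 0 else of_nat a / (fact a * fact (d - a)) * S a)"
    unfolding monotone_hurwitz_series_eq C_def[symmetric] z_D_z_series_of all_series_def
    by (subst mfps_nth_series_of_mult[OF m(1,2,3)[symmetric]]) (simp only: summand)
  also have "\<dots> = (\<Sum>a\<in>{1..d}. of_nat a / (fact a * fact (d - a)) * S a)"
    by (rule sum.mono_neutral_cong_right) auto
  \<comment> \<open>The identity a (d choose a) = d (d-1 choose a-1), divided by d!: the Euler
    operator on H accounts for the marked point.\<close>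
  also have "\<dots> = (\<Sum>a\<in>{1..d}. of_nat d / fact d * (of_nat ((d - 1) choose (a - 1)) * S a))"
  proof (intro sum.cong refl)
    fix a assume a: "a \<in> {1..d}"
    then obtain b e where "a = Suc b" "d = Suc e" "b \<le> e" by (cases a; cases d) auto
    then have "of_nat d / fact d * of_nat ((d - 1) choose (a - 1)) = (of_nat a / (fact a * fact (d - a)) :: rat)"
      by (simp add: binomial_fact field_simps del: of_nat_Suc)
    then show "of_nat a / (fact a * fact (d - a)) * S a = of_nat d / fact d * (of_nat ((d - 1) choose (a - 1)) * S a)"
      by (simp only: mult.assoc[symmetric])
  qed
  also have "\<dots> = of_nat d / fact d * of_nat (seq_count {1..d} r \<alpha>)"
  proof (cases "d = 0")
    case False
    then have "of_nat (seq_count {1..d} r \<alpha>) = (\<Sum>a\<in>{1..d}. of_nat ((d - 1) choose (a - 1)) * S a)"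
      by (subst seq_count_split_by_size) (simp_all add: S_def case_prod_beta)
    then show ?thesis by (simp only: sum_distrib_left)
  qed simp
  also have "\<dots> = mfps_nth (z_ser * D_z all_series) m"
    by (simp add: mfps_nth_X_mult_deriv all_series_def mfps_nth_series_of m)
  finally show "mfps_nth (z_ser * D_z all_series) m = mfps_nth (z_ser * D_z monotone_hurwitz_series * all_series) m" ..
qed

text \<open>Differentiating z Z_z = Z z H_z by p_i shows that the difference G of both sides
  satisfies z G_z = (z H_z) G. It has no z-free term, so it vanishes.\<close>

lemma D_p_all_series:
  assumes "1 \<le> i"
  shows "D_p i all_series = all_series * D_p i monotone_hurwitz_series"
proof -
  let ?Z = all_series and ?H = monotone_hurwitz_series
  let ?G = "D_p i ?Z - ?Z * D_p i ?H"
  have comm: "D_p i (z_ser * D_z F) = z_ser * D_z (D_p i F)" for F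
    by (rule mfps_deriv_X_mult_deriv) simp
  have "z_ser * D_z ?G = z_ser * D_z (D_p i ?Z) - z_ser * D_z ?Z * D_p i ?H - ?Z * (z_ser * D_z (D_p i ?H))"
    by (simp add: mfps_deriv_diff mfps_deriv_mult algebra_simps)
  also have "\<dots> = z_ser * D_z ?H * ?G"
    unfolding comm[symmetric] all_series_connected mfps_deriv_mult[of _ "z_ser * D_z ?H"]
    by (simp add: algebra_simps)
  finally have "z_ser * D_z ?G = z_ser * D_z ?H * ?G" .
  then have "?G = 0"
  proof (rule euler_equation_zero)
    fix m assume m: "Var_z \<notin># m"
    then show "mfps_nth (z_ser * D_z ?H) m = 0"
      by (simp add: mfps_nth_X_mult_deriv not_in_iff)
    have "seq_count {1..0} (count m Var_t) (add_mset i (parts m)) = 0"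
      using seq_count_nonzero(1)[of "{1..0}" "count m Var_t" "add_mset i (parts m)"] assms by fastforce
    then have "mfps_nth (D_p i ?Z) m = 0"
      using m assms by (simp add: mfps_nth_deriv all_series_def mfps_nth_series_of parts_add_p_var not_in_iff)
    moreover have "mfps_nth (?Z * D_p i ?H) m = 0"
      unfolding mfps_nth_mult
    proof (rule sum.neutral, clarify)
      fix k l assume "m = k + l"
      then have "Var_z \<notin># add_mset (p_var i) l" using m by auto
      then show "mfps_nth ?Z k * mfps_nth (D_p i ?H) l = 0"
        by (simp add: mfps_nth_deriv mfps_nth_monotone_hurwitz_series_0)
    qed
    ultimately show "mfps_nth ?G m = 0" by simp
  qed
  then show ?thesis by simp
qed

definition linear_join_cut_term :: "series \<Rightarrow> nat \<times> nat \<Rightarrow> series" where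
  "linear_join_cut_term F = (\<lambda>(i, j).
     of_nat (i + j) * p_ser i * p_ser j * D_p (i + j) F + of_nat (i * j) * p_ser (i + j) * D_p i (D_p j F))"

lemma mfps_nth_linear_join_cut_term:
  assumes "p \<in> {1..} \<times> {1..}"
  shows "mfps_nth (linear_join_cut_term (series_of c) p) m =
     cut_coeff (c (count m Var_z) (count m Var_t)) (parts m) p
   + join_coeff (c (count m Var_z) (count m Var_t)) (parts m) p"
proof -
  obtain i j where p: "p = (i, j)" and ij: "1 \<le> i" "1 \<le> j" using assms by auto
  have cut: "mfps_nth (of_nat (i + j) * p_ser i * p_ser j * D_p (i + j) (series_of c)) m
     = cut_coeff (c (count m Var_z) (count m Var_t)) (parts m) (i, j)"
  proof -
    have "{#i, j#} \<subseteq># parts m \<longleftrightarrow> i \<in># parts m \<and> j \<in># parts m - {#i#}"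
      by (metis add_mset_commute insert_subset_eq_iff single_subset_iff)
    moreover have "count (m - {#p_var i#} - {#p_var j#}) Var_z = count m Var_z"
      "count (m - {#p_var i#} - {#p_var j#}) Var_t = count m Var_t" by simp_all
    moreover have "parts m - {#i#} - {#j#} = parts m - {#i, j#}" by (simp add: add_mset_commute)
    ultimately show ?thesis
      using ij by (simp add: mult.assoc mfps_nth_of_nat_mult mfps_nth_X_mult mfps_nth_deriv mfps_nth_series_of
          mem_parts parts_diff_p_var parts_add_p_var cut_coeff_def count_parts[symmetric]
          del: of_nat_Suc of_nat_add diff_diff_add_mset count_diff mult_Suc_right)
  qed
  have "count (m - {#p_var (i + j)#}) Var_z = count m Var_z" "count (m - {#p_var (i + j)#}) Var_t = count m Var_t"
    "count (add_mset (p_var k) n) Var_z = count n Var_z" "count (add_mset (p_var k) n) Var_t = count n Var_t" for k n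
    by simp_all
  then have join: "mfps_nth (of_nat (i * j) * p_ser (i + j) * D_p i (D_p j (series_of c))) m
     = join_coeff (c (count m Var_z) (count m Var_t)) (parts m) (i, j)"
    using ij by (simp add: mult.assoc mfps_nth_of_nat_mult mfps_nth_X_mult mfps_nth_deriv mfps_nth_series_of
        mem_parts parts_diff_p_var parts_add_p_var join_coeff_def count_parts[symmetric] add_mset_commute
        del: of_nat_Suc of_nat_add count_diff count_add_mset mult_Suc mult_Suc_right)
  show ?thesis using cut join by (simp add: p linear_join_cut_term_def)
qed

section \<open>The join-cut equation\<close>

lemma cut_coeff_divide: "cut_coeff (\<lambda>\<alpha>. T \<alpha> / c) \<alpha> p = (cut_coeff T \<alpha> p / c :: rat)"
  by (cases p) (simp add: cut_coeff_def)

lemma join_coeff_divide: "join_coeff (\<lambda>\<alpha>. T \<alpha> / c) \<alpha> p = (join_coeff T \<alpha> p / c :: rat)"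
  by (cases p) (simp add: join_coeff_def)

lemma coeffs_zero_outside:
  assumes "p \<in> {1..} \<times> {1..} - {1..N} \<times> {1..N}" "sum_mset \<alpha> \<le> N"
  shows "cut_coeff T \<alpha> p = 0" "join_coeff T \<alpha> p = 0"
proof -
  obtain i j where p: "p = (i, j)" and big: "N < i \<or> N < j" using assms(1) by force
  have le: "k \<le> N" if "k \<in># \<alpha>" for k
    using that assms(2) by (metis le_add1 le_trans multi_member_split sum_mset.add_mset)
  have "\<not> {#i, j#} \<subseteq># \<alpha>" using big le[of i] le[of j] mset_subset_eqD[of "{#i, j#}" \<alpha>] by force
  then show "cut_coeff T \<alpha> p = 0" by (simp add: cut_coeff_def p)
  have "i + j \<notin># \<alpha>" using big le[of "i + j"] by auto
  then show "join_coeff T \<alpha> p = 0" by (simp add: join_coeff_def p)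
qed

text \<open>Covers d = 0, which the recursion of the counts does not reach: there only the empty
  partition has a nonzero count, whereas cutting and joining evaluate at nonempty ones.\<close>

lemma coeffs_zero_empty:
  assumes "p \<in> {1..} \<times> {1..}"
  shows "cut_coeff (\<lambda>\<alpha>. of_nat (seq_count {1..0} r \<alpha>) / c) \<alpha> p = (0 :: rat)"
    "join_coeff (\<lambda>\<alpha>. of_nat (seq_count {1..0} r \<alpha>) / c) \<alpha> p = (0 :: rat)"
proof -
  obtain i j where p: "p = (i, j)" "1 \<le> i" "1 \<le> j" using assms by auto
  have "seq_count {1..0} r (add_mset k \<beta>) = 0" if "1 \<le> k" for k \<beta>
    using seq_count_nonzero(1)[of "{1..0}" r "add_mset k \<beta>"] that by auto
  then show "cut_coeff (\<lambda>\<alpha>. of_nat (seq_count {1..0} r \<alpha>) / c) \<alpha> p = (0 :: rat)"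
    "join_coeff (\<lambda>\<alpha>. of_nat (seq_count {1..0} r \<alpha>) / c) \<alpha> p = (0 :: rat)"
    unfolding p cut_coeff_def join_coeff_def using p(2,3) by (simp_all del: One_nat_def)
qed

lemma mfps_nth_linear_join_cut:
  assumes N: "sum_mset (parts m) \<le> N"
  shows "mfps_nth (mfps_sum (linear_join_cut_term (series_of c)) ({1..} \<times> {1..})) m
    = (\<Sum>p\<in>{1..N} \<times> {1..N}. cut_coeff (c (count m Var_z) (count m Var_t)) (parts m) p
        + join_coeff (c (count m Var_z) (count m Var_t)) (parts m) p)"
proof -
  have "mfps_nth (mfps_sum (linear_join_cut_term (series_of c)) ({1..} \<times> {1..})) m
    = (\<Sum>p\<in>{1..N} \<times> {1..N}. mfps_nth (linear_join_cut_term (series_of c) p) m)"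
  proof (rule mfps_nth_mfps_sum)
    fix p assume p: "p \<in> {1..} \<times> {1..} - {1..N} \<times> {1..N}"
    then have "p \<in> {1..} \<times> {1..}" by blast
    then show "mfps_nth (linear_join_cut_term (series_of c) p) m = 0"
      by (simp only: mfps_nth_linear_join_cut_term coeffs_zero_outside[OF p N] add_0_left)
  qed auto
  also have "\<dots> = (\<Sum>p\<in>{1..N} \<times> {1..N}. cut_coeff (c (count m Var_z) (count m Var_t)) (parts m) p
        + join_coeff (c (count m Var_z) (count m Var_t)) (parts m) p)"
    by (intro sum.cong refl mfps_nth_linear_join_cut_term) auto
  finally show ?thesis .
qed

lemma linear_join_cut_all_series:
  "z_ser * D_z all_series = z_ser * p_ser 1 * all_series
     + t_ser * mfps_sum (linear_join_cut_term all_series) ({1..} \<times> {1..})"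
proof (rule mfps_ext)
  fix m
  define d r \<alpha> where m: "d = count m Var_z" "r = count m Var_t" "\<alpha> = parts m"
  define T where "T = (\<lambda>d r \<alpha>. of_nat (seq_count {1..d} r \<alpha>) :: rat)"
  \<comment> \<open>Two bounds are served: at least d for the recursion of the counts, and at least
    the size of \<alpha> for truncating the infinite sum. They may differ, as m is an arbitrary
    monomial.\<close>
  define N where "N = max d (sum_mset \<alpha>)"
  let ?I = "{1..N} \<times> {1..N}"
  have lhs: "mfps_nth (z_ser * D_z all_series) m = of_nat d * (T d r \<alpha> / fact d)"
    by (simp add: mfps_nth_X_mult_deriv all_series_def mfps_nth_series_of m T_def)
  have fixed: "mfps_nth (z_ser * p_ser 1 * all_series) m
      = (if d \<noteq> 0 \<and> 1 \<in># \<alpha> then T (d - 1) r (\<alpha> - {#1#}) / fact (d - 1) else 0)"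
  proof -
    define n where "n = m - {#Var_z#}"
    have n: "parts n = \<alpha>" "count n Var_z = d - 1" "count n Var_t = r"
      using parts_diff_zt(1)[of m 1] by (simp_all add: n_def m)
    have "mfps_nth (p_ser 1 * all_series) n = (if 1 \<in># \<alpha> then T (d - 1) r (\<alpha> - {#1#}) / fact (d - 1) else 0)"
      using n by (simp add: mfps_nth_X_mult mem_parts parts_diff_p_var all_series_def mfps_nth_series_of T_def)
    then show ?thesis by (simp add: mult.assoc mfps_nth_X_mult n_def[symmetric] m(1) count_eq_zero_iff)
  qed
  have joincut: "mfps_nth (t_ser * mfps_sum (linear_join_cut_term all_series) ({1..} \<times> {1..})) m
    = (if r = 0 then 0 else (\<Sum>p\<in>?I. cut_coeff (\<lambda>\<alpha>. T d (r - 1) \<alpha> / fact d) \<alpha> p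
        + join_coeff (\<lambda>\<alpha>. T d (r - 1) \<alpha> / fact d) \<alpha> p))"
  proof (cases "r = 0")
    case False
    have "parts (m - {#Var_t#}) = \<alpha>" using parts_diff_zt(2)[of m 1] by (simp add: m)
    moreover have "count (m - {#Var_t#}) Var_z = d" "count (m - {#Var_t#}) Var_t = r - 1" by (simp_all add: m)
    moreover have "sum_mset \<alpha> \<le> N" by (simp add: N_def)
    ultimately show ?thesis
      using False mfps_nth_linear_join_cut[of "m - {#Var_t#}" N] unfolding all_series_def
      by (simp add: mfps_nth_X_mult m(2) T_def count_eq_zero_iff)
  qed (simp add: mfps_nth_X_mult m(2) count_eq_zero_iff)
  show "mfps_nth (z_ser * D_z all_series) m = mfps_nth (z_ser * p_ser 1 * all_series
     + t_ser * mfps_sum (linear_join_cut_term all_series) ({1..} \<times> {1..})) m"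
  proof (cases d)
    case 0
    have "cut_coeff (\<lambda>\<alpha>. T d (r - 1) \<alpha> / fact d) \<alpha> p = 0" "join_coeff (\<lambda>\<alpha>. T d (r - 1) \<alpha> / fact d) \<alpha> p = 0"
      if "p \<in> ?I" for p
      unfolding T_def 0 by (rule coeffs_zero_empty; use that in force)+
    then have "(\<Sum>p\<in>?I. cut_coeff (\<lambda>\<alpha>. T d (r - 1) \<alpha> / fact d) \<alpha> p
        + join_coeff (\<lambda>\<alpha>. T d (r - 1) \<alpha> / fact d) \<alpha> p) = 0"
      by (intro sum.neutral ballI) (simp only: add_0_left)
    then have zero: "mfps_nth (t_ser * mfps_sum (linear_join_cut_term all_series) ({1..} \<times> {1..})) m = 0"
      unfolding joincut by (simp only: if_cancel)
    show ?thesis unfolding mfps_nth_add lhs fixed zero by (simp add: 0)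
  next
    case (Suc e)
    have rec: "of_nat d * T d r \<alpha> = of_nat d * (if 1 \<in># \<alpha> then T e r (\<alpha> - {#1#}) else 0)
      + (if r = 0 then 0 else (\<Sum>p\<in>?I. cut_coeff (T d (r - 1)) \<alpha> p + join_coeff (T d (r - 1)) \<alpha> p))"
    proof (cases r)
      case 0
      then show ?thesis using seq_count_Suc_0[of e \<alpha>] by (simp add: Suc T_def)
    next
      case (Suc r')
      have "Suc e \<le> N" using \<open>d = Suc e\<close> by (simp add: N_def)
      from seq_count_Suc[OF this, of r' \<alpha>] show ?thesis by (simp only: Suc \<open>d = Suc e\<close> T_def nat.simps if_False diff_Suc_1)
    qed
    have "of_nat d * (T d r \<alpha> / fact d) = (of_nat d * T d r \<alpha>) / fact d" by simp
    also have "\<dots> = (if 1 \<in># \<alpha> then T e r (\<alpha> - {#1#}) / fact e else 0)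
      + (if r = 0 then 0 else (\<Sum>p\<in>?I. cut_coeff (T d (r - 1)) \<alpha> p / fact d + join_coeff (T d (r - 1)) \<alpha> p / fact d))"
      unfolding rec add_divide_distrib by (auto simp: Suc sum_divide_distrib add_divide_distrib simp del: of_nat_Suc)
    finally show ?thesis
      unfolding mfps_nth_add lhs fixed joincut cut_coeff_divide join_coeff_divide by (simp add: Suc)
  qed
qed

text \<open>From Z_i = Z H_i follows Z_ij = Z (H_ij + H_i H_j), the origin of the quadratic
  term.\<close>

lemma join_cut_term_mult_all_series:
  assumes "p \<in> {1..} \<times> {1..}"
  shows "join_cut_term monotone_hurwitz_series p * all_series = linear_join_cut_term all_series p"
proof -
  obtain i j where p: "p = (i, j)" "1 \<le> i" "1 \<le> j" "1 \<le> i + j" using assms by auto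
  have "D_p i (D_p j all_series) = D_p i (all_series * D_p j monotone_hurwitz_series)"
    using p by (simp add: D_p_all_series)
  also have "\<dots> = all_series * D_p i monotone_hurwitz_series * D_p j monotone_hurwitz_series
      + all_series * D_p i (D_p j monotone_hurwitz_series)"
    using p by (simp add: mfps_deriv_mult D_p_all_series)
  finally show ?thesis
    using p by (simp add: join_cut_term_def linear_join_cut_term_def D_p_all_series algebra_simps)
qed

lemma all_series_nonzero: "all_series \<noteq> 0"
proof
  assume "all_series = 0"
  then have "mfps_nth all_series {#} = 0" by simp
  then show False using seq_count_0[of 0 "{#}"] by (simp add: all_series_def mfps_nth_series_of)
qed

text \<open>Multiplying by 2 t clears the denominator and absorbs the 1/2, so everything takes place
  in the power series ring.\<close>

lemma join_cut_equation_iff: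
  "join_cut_equation F \<longleftrightarrow>
    z_ser * D_z F - z_ser * p_ser 1 = t_ser * mfps_sum (join_cut_term F) ({1..} \<times> {1..})"
proof -
  let ?A = "z_ser * D_z F - z_ser * p_ser 1" and ?S = "mfps_sum (join_cut_term F) ({1..} \<times> {1..})"
  have half: "mfps_const (1/2) * (2 * f) = f" for f :: series
    by (rule mfps_ext) (simp only: mfps_nth_const_mult mult_2[of f] mfps_nth_add, simp)
  have "join_cut_equation F \<longleftrightarrow> ?A = mfps_const (1/2) * ?S * (2 * t_ser)"
    unfolding join_cut_equation_def mult_fract using two_t_ser_nonzero by (simp add: eq_fract)
  also have "mfps_const (1/2) * ?S * (2 * t_ser) = mfps_const (1/2) * (2 * (t_ser * ?S))"
    by (simp only: mult_ac)
  finally show ?thesis by (simp only: half)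
qed

lemma join_cut_equation_monotone_hurwitz_series: "join_cut_equation monotone_hurwitz_series"
proof -
  let ?H = monotone_hurwitz_series and ?Z = all_series and ?I = "{1..} \<times> {1..} :: (nat \<times> nat) set"
  have "mfps_sum (join_cut_term ?H) ?I * ?Z = mfps_sum (linear_join_cut_term ?Z) ?I"
    unfolding mfps_sum_mult_right[OF join_cut_term_summable]
    by (intro mfps_sum_cong join_cut_term_mult_all_series)
  then have "(t_ser * mfps_sum (join_cut_term ?H) ?I) * ?Z = z_ser * D_z ?Z - z_ser * p_ser 1 * ?Z"
    unfolding linear_join_cut_all_series by (simp only: mult.assoc add_diff_cancel_left')
  also have "\<dots> = (z_ser * D_z ?H - z_ser * p_ser 1) * ?Z"
    unfolding all_series_connected by (simp only: left_diff_distrib)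
  \<comment> \<open>\<open>Z\<close> is cancelled as a nonzero element of an integral
    domain.\<close>
  finally have "t_ser * mfps_sum (join_cut_term ?H) ?I = z_ser * D_z ?H - z_ser * p_ser 1"
    using all_series_nonzero by (simp only: mult_cancel_right simp_thms)
  then show ?thesis unfolding join_cut_equation_iff by (rule sym)
qed

section \<open>Uniqueness of the solution\<close>

text \<open>Congruence modulo v^(r+1).\<close>

definition agree_upto :: "'v \<Rightarrow> nat \<Rightarrow> ('v, 'a) mfps \<Rightarrow> ('v, 'a) mfps \<Rightarrow> bool" where
  "agree_upto v r f g \<longleftrightarrow> (\<forall>m. count m v \<le> r \<longrightarrow> mfps_nth f m = mfps_nth g m)"

lemma agree_upto_refl: "agree_upto v r f f"
  by (simp add: agree_upto_def)

lemma agree_upto_add: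
  fixes f g :: "('v, 'a :: comm_ring_1) mfps"
  shows "agree_upto v r f f' \<Longrightarrow> agree_upto v r g g' \<Longrightarrow> agree_upto v r (f + g) (f' + g')"
  by (simp add: agree_upto_def)

lemma agree_upto_mult:
  fixes f g :: "('v, 'a :: comm_ring_1) mfps"
  assumes "agree_upto v r f f'" "agree_upto v r g g'"
  shows "agree_upto v r (f * g) (f' * g')"
  unfolding agree_upto_def mfps_nth_mult
  by (intro allI impI sum.cong refl) (use assms in \<open>auto simp: agree_upto_def\<close>)

lemma agree_upto_deriv:
  "u \<noteq> v \<Longrightarrow> agree_upto v r f f' \<Longrightarrow> agree_upto v r (mfps_deriv u f) (mfps_deriv u f')"
  by (simp add: agree_upto_def mfps_nth_deriv)

lemma agree_upto_mfps_sum: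
  assumes "\<And>i. i \<in> A \<Longrightarrow> agree_upto v r (f i) (g i)"
  shows "agree_upto v r (mfps_sum f A) (mfps_sum g A)"
  unfolding agree_upto_def mfps_sum_def mfps_nth_Abs
  by (intro allI impI sum.cong) (use assms in \<open>auto simp: agree_upto_def\<close>)

text \<open>The term involves no derivative by t, so no power of t is lost.\<close>

lemma agree_upto_join_cut_term:
  "agree_upto Var_t r F G \<Longrightarrow> agree_upto Var_t r (join_cut_term F p) (join_cut_term G p)"
  by (cases p) (auto simp: join_cut_term_def intro!: agree_upto_add agree_upto_mult agree_upto_deriv agree_upto_refl)

lemma join_cut_equation_unique:
  assumes F: "join_cut_equation F" "mfps_coeff Var_z 0 F = 0"
    and G: "join_cut_equation G" "mfps_coeff Var_z 0 G = 0"
  shows "F = G"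
proof -
  let ?S = "\<lambda>F. mfps_sum (join_cut_term F) ({1..} \<times> {1..})"
  have initial: "mfps_nth F m = 0" if "mfps_coeff Var_z 0 F = 0" "count m Var_z = 0" for F :: series and m
  proof -
    have "mfps_nth (mfps_coeff Var_z 0 F) m = mfps_nth F m" using that(2) by (simp add: mfps_coeff_def)
    then show ?thesis using that(1) by simp
  qed
  have coeff: "of_nat (count m Var_z) * mfps_nth F m = mfps_nth (z_ser * p_ser 1) m + mfps_nth (t_ser * ?S F) m"
    if "join_cut_equation F" for F m
  proof -
    have "z_ser * D_z F = z_ser * p_ser 1 + t_ser * ?S F"
      using that unfolding join_cut_equation_iff by (metis diff_add_cancel add.commute)
    then show ?thesis by (metis mfps_nth_X_mult_deriv mfps_nth_add)
  qed
  \<comment> \<open>The left side of the equation multiplies a coefficient by its z-exponent: a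
    positive one can be divided out, and exponent 0 is settled by the initial condition.\<close>
  have eqI: "mfps_nth F m = mfps_nth G m" if "mfps_nth (t_ser * ?S F) m = mfps_nth (t_ser * ?S G) m" for m
  proof (cases "count m Var_z = 0")
    case False
    have "of_nat (count m Var_z) * mfps_nth F m = of_nat (count m Var_z) * mfps_nth G m"
      unfolding coeff[OF F(1)] coeff[OF G(1)] that ..
    then show ?thesis using False by simp
  qed (simp add: initial F G)
  \<comment> \<open>The factor t gains one order: agreement of F and G up to t^r gives agreement of
    the right sides up to t^(r+1).\<close>
  have "agree_upto Var_t r F G" for r
  proof (induction r)
    case 0
    show ?case unfolding agree_upto_def
      by (intro allI impI eqI) (simp add: mfps_nth_X_mult count_eq_zero_iff)
  next
    case (Suc r)
    then have "agree_upto Var_t r (?S F) (?S G)"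
      by (intro agree_upto_mfps_sum agree_upto_join_cut_term)
    then show ?case unfolding agree_upto_def
      by (intro allI impI eqI) (auto simp: mfps_nth_X_mult)
  qed
  then show ?thesis by (intro mfps_ext) (auto simp: agree_upto_def)
qed

theorem theorem0p2:
  shows "join_cut_equation monotone_hurwitz_series
    \<and> mfps_coeff Var_z 0 monotone_hurwitz_series = 0
    \<and> (\<forall>F. join_cut_equation F \<and> mfps_coeff Var_z 0 F = 0 \<longrightarrow> F = monotone_hurwitz_series)"
proof -
  have "mfps_coeff Var_z 0 monotone_hurwitz_series = 0"
    by (rule mfps_ext) (simp add: mfps_coeff_def mfps_nth_monotone_hurwitz_series_0 count_eq_zero_iff)
  then show ?thesis
    using join_cut_equation_monotone_hurwitz_series join_cut_equation_unique by blast
qed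

end
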